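(* Let $K,L$ be positive integers with $L\ge 10$ and $\frac{3L}{2}\le K\le 3L-2$. Let $m_0$ be a trigonometric polynomial with real coefficients, $m_0(0)=1$ and $$|m_0(\xi_1)|^2=(\cos(\pi\xi_1))^{2K}\sum_{n=0}^{L-1}\binom{K-1+n}{n}(\sin(\pi\xi_1))^{2n},\qquad \xi_1\in\mathbb{R},$$ let $m_1$ be a trigonometric polynomial with $|m_1(\xi_1)|^2=|m_0(\xi_1+\frac12)|^2$ for $\xi_1\in\mathbb{R}$, let $\phi_1\in L^2(\mathbb{R})$ be given by $\hat\phi_1(\xi_1)=\prod_{j=0}^\infty m_0(2^{-j}\xi_1)$, and let $\psi\in L^2(\mathbb{R}^2)$ be given by $\hat\psi(\xi)=m_1(4\xi_1)\hat\phi_1(\xi_1)\hat\phi_1(2\xi_2)$. Set $\phi(x_1,x_2)=\phi_1(x_1)\phi_1(x_2)$ and $\tilde\psi(x_1,x_2)=\psi(x_2,x_1)$. Then there exists $\hat c_1>0$ such that the shearlet system $\mathcal{SH}(c;\phi,\psi,\tilde\psi)$ (see context) forms a frame for $L^2(\mathbb{R}^2)$ for every $c=(c_1,c_2)\in(\mathbb{R}^+)^2$ with $c_2\le c_1\le\hat c_1$.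
   Context: Fourier transform: $\hat f(\xi)=\int f(x)e^{-2\pi i\langle x,\xi\rangle}\,dx$. Trigonometric polynomials are finite linear combinations of $e^{2\pi i n\xi_1}$, $n\in\mathbb{Z}$. Matrices: $A_a=\begin{pmatrix} a&0\\0&\sqrt a\end{pmatrix}$, $\tilde A_a=\begin{pmatrix}\sqrt a&0\\0&a\end{pmatrix}$ ($a>0$), $S_s=\begin{pmatrix}1&s\\0&1\end{pmatrix}$ ($s\in\mathbb{R}$), and for $c=(c_1,c_2)\in(\mathbb{R}^+)^2$, $M_c=\begin{pmatrix}c_1&0\\0&c_2\end{pmatrix}$, $\tilde M_c=\begin{pmatrix}c_2&0\\0&c_1\end{pmatrix}$. Cone-adapted regular discrete shearlet system: $\mathcal{SH}(c;\phi,\psi,\tilde\psi)=\Phi(c_1,\phi)\cup\Psi(c,\psi)\cup\tilde\Psi(c,\tilde\psi)$, where $$\Phi(c_1,\phi)=\{\phi(\cdot-c_1m): m\in\mathbb{Z}^2\},$$ $$\Psi(c,\psi)=\{2^{3j/4}\psi(S_{-k}A_{2^j}\,\cdot\,-M_cm): j\ge0,\ |k|\le\lceil2^{j/2}\rceil,\ m\in\mathbb{Z}^2\},$$ $$\tilde\Psi(c,\tilde\psi)=\{2^{3j/4}\tilde\psi(S_{-k}^T\tilde A_{2^j}\,\cdot\,-\tilde M_cm): j\ge0,\ |k|\le\lceil2^{j/2}\rceil,\ m\in\mathbb{Z}^2\}.$$ A countable family $(\sigma_i)_{i}$ in $L^2(\mathbb{R}^2)$ is a frame for $L^2(\mathbb{R}^2)$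 if there are $0<A\le B<\infty$ with $A\|f\|_2^2\le\sum_i|\langle f,\sigma_i\rangle|^2\le B\|f\|_2^2$ for all $f\in L^2(\mathbb{R}^2)$. *)

theory Defs
  imports "HOL-Analysis.Analysis"
begin

text \<open>
  Elements of \<open>L\<^sup>2\<close> are handled through their Borel representatives; every class has one, and
  the notions below do not depend on its choice.
\<close>

definition L2 :: "('a::euclidean_space \<Rightarrow> complex) set"
  where "L2 = {f. f \<in> borel_measurable lborel \<and> integrable lborel (\<lambda>x. (cmod (f x))\<^sup>2)}"

definition L2_inner :: "('a::euclidean_space \<Rightarrow> complex) \<Rightarrow> ('a \<Rightarrow> complex) \<Rightarrow> complex"
  where "L2_inner f g = (LINT x|lborel. f x * cnj (g x))"

definition L2_norm :: "('a::euclidean_space \<Rightarrow> complex) \<Rightarrow> real"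
  where "L2_norm f = sqrt (LINT x|lborel. (cmod (f x))\<^sup>2)"

text \<open>
  The Fourier transform on \<open>L\<^sup>2\<close>: the Fourier integral need not converge for \<open>f \<in> L\<^sup>2\<close>, so \<open>g\<close> is
  required to be the \<open>L\<^sup>2\<close>-limit of the Fourier integrals of \<open>f\<close> restricted to balls. For
  integrable \<open>f\<close> this is the usual integral, up to a null set. As an element of \<open>L\<^sup>2\<close> the transform
  is determined only almost everywhere, hence a relation and not a function.
\<close>

definition fourier_integral_on ::
    "'a::euclidean_space set \<Rightarrow> ('a \<Rightarrow> complex) \<Rightarrow> 'a \<Rightarrow> complex"
  where "fourier_integral_on S f \<xi> =
    (LINT x:S|lborel. f x * exp (- 2 * complex_of_real pi * \<i> * complex_of_real (x \<bullet> \<xi>)))"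

definition has_L2_fourier_transform ::
    "('a::euclidean_space \<Rightarrow> complex) \<Rightarrow> ('a \<Rightarrow> complex) \<Rightarrow> bool"
  where "has_L2_fourier_transform f g \<longleftrightarrow> f \<in> L2 \<and> g \<in> L2 \<and>
    ((\<lambda>R. \<integral>\<^sup>+ \<xi>. ennreal ((cmod (g \<xi> - fourier_integral_on (cball 0 R) f \<xi>))\<^sup>2) \<partial>lborel)
      \<longlongrightarrow> 0) at_top"

definition trig_polynomial :: "(real \<Rightarrow> complex) \<Rightarrow> bool"
  where "trig_polynomial p \<longleftrightarrow> (\<exists>(N::int set) (a::int \<Rightarrow> complex). finite N \<and>
    (\<forall>\<xi>. p \<xi> = (\<Sum>n\<in>N. a n * exp (2 * complex_of_real pi * \<i> * of_int n * complex_of_real \<xi>))))"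

definition real_trig_polynomial :: "(real \<Rightarrow> complex) \<Rightarrow> bool"
  where "real_trig_polynomial p \<longleftrightarrow> (\<exists>(N::int set) (a::int \<Rightarrow> real). finite N \<and>
    (\<forall>\<xi>. p \<xi> = (\<Sum>n\<in>N. complex_of_real (a n)
        * exp (2 * complex_of_real pi * \<i> * of_int n * complex_of_real \<xi>))))"

definition is_L2_frame :: "'i set \<Rightarrow> ('i \<Rightarrow> 'a::euclidean_space \<Rightarrow> complex) \<Rightarrow> bool"
  where "is_L2_frame I \<sigma> \<longleftrightarrow> countable I \<and> (\<forall>i\<in>I. \<sigma> i \<in> L2) \<and>
    (\<exists>A B. 0 < A \<and> A \<le> B \<and>
      (\<forall>f\<in>L2. (\<lambda>i. (cmod (L2_inner f (\<sigma> i)))\<^sup>2) summable_on I \<and>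
        A * (L2_norm f)\<^sup>2 \<le> (\<Sum>\<^sub>\<infinity>i\<in>I. (cmod (L2_inner f (\<sigma> i)))\<^sup>2) \<and>
        (\<Sum>\<^sub>\<infinity>i\<in>I. (cmod (L2_inner f (\<sigma> i)))\<^sup>2) \<le> B * (L2_norm f)\<^sup>2))"

definition diag2 :: "real \<Rightarrow> real \<Rightarrow> real^2^2"
  where "diag2 a b = vector [vector [a, 0], vector [0, b]]"

definition scaling :: "real \<Rightarrow> real^2^2"
  where "scaling a = diag2 a (sqrt a)"

definition scaling_tilde :: "real \<Rightarrow> real^2^2"
  where "scaling_tilde a = diag2 (sqrt a) a"

definition shear :: "real \<Rightarrow> real^2^2"
  where "shear s = vector [vector [1, s], vector [0, 1]]"

definition sampling :: "real^2 \<Rightarrow> real^2^2"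
  where "sampling c = diag2 (c$1) (c$2)"

definition sampling_tilde :: "real^2 \<Rightarrow> real^2^2"
  where "sampling_tilde c = diag2 (c$2) (c$1)"

definition lattice :: "int^2 \<Rightarrow> real^2"
  where "lattice m = (\<chi> i. real_of_int (m $ i))"

text \<open>
  The system is a family over the disjoint union of the three index sets: \<open>Coarse m\<close>
  for \<open>\<phi>\<close>, \<open>Horizontal j k m\<close> for \<open>\<psi>\<close> and \<open>Vertical j k m\<close> for its flipped companion.
\<close>

datatype shearlet_index =
    Coarse "int^2"
  | Horizontal nat int "int^2"
  | Vertical nat int "int^2"

definition shearlet_indices :: "shearlet_index set"
  where "shearlet_indices =
    {Coarse m | m. True} \<union>
    {Horizontal j k m | j k m. \<bar>k\<bar> \<le> \<lceil>2 powr (real j / 2)\<rceil>} \<union>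
    {Vertical j k m | j k m. \<bar>k\<bar> \<le> \<lceil>2 powr (real j / 2)\<rceil>}"

fun shearlet_system ::
    "real^2 \<Rightarrow> (real^2 \<Rightarrow> complex) \<Rightarrow> (real^2 \<Rightarrow> complex) \<Rightarrow> (real^2 \<Rightarrow> complex) \<Rightarrow>
     shearlet_index \<Rightarrow> real^2 \<Rightarrow> complex"
  where
    "shearlet_system c \<phi> \<psi> \<psi>t (Coarse m) = (\<lambda>x. \<phi> (x - (c$1) *\<^sub>R lattice m))"
  | "shearlet_system c \<phi> \<psi> \<psi>t (Horizontal j k m) = (\<lambda>x.
       complex_of_real (2 powr (3 * real j / 4)) *
       \<psi> ((shear (- real_of_int k) ** scaling (2 ^ j)) *v x - sampling c *v lattice m))"
  | "shearlet_system c \<phi> \<psi> \<psi>t (Vertical j k m) = (\<lambda>x.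
       complex_of_real (2 powr (3 * real j / 4)) *
       \<psi>t ((transpose (shear (- real_of_int k)) ** scaling_tilde (2 ^ j)) *v x
            - sampling_tilde c *v lattice m))"

end

theory Submission
  imports Defs
begin

text \<open>
  By the Parseval identity for Fourier series, the coefficients of \<open>f\<close> against the translates of one
  generator \<open>\<sigma>\<close> along a lattice have square sum equal to the integral over a period cell of the squared
  modulus of the periodization of \<open>g * cnj s\<close>, where \<open>g\<close> and \<open>s\<close> are the transforms of \<open>f\<close> and \<open>\<sigma>\<close>.
  The arithmetic-geometric mean inequality compares this with the integral of
  \<open>\<bar>g\<bar>\<^sup>2 * \<bar>s\<bar>\<^sup>2\<close>, the error being governed by the products of \<open>s\<close> with its
  translates along the dual lattice. For the given mask the transforms decay of order 4, because
  \<open>(K + L - 1) choose (L - 1) \<le> 4 ^ (K - 4)\<close>, and the transform of \<open>\<psi>\<close> vanishes to order at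
  least 4 on the line \<open>\<xi>\<^sub>1 = 0\<close>, so these errors are summable over all scales and shears and are of
  order \<open>c\<^sub>1\<^sup>2\<close>.

  The coarse part of the system carries the weight \<open>1 / c\<^sub>1\<^sup>2\<close> but the cone parts the possibly
  much larger weight \<open>1 / (c\<^sub>1 * c\<^sub>2)\<close>. The transform is therefore split into a low-frequency part,
  controlled by \<open>\<phi>\<close>, and a high-frequency part, controlled by the cones up to a multiple of the
  low-frequency part; combining the two estimates gives a threshold for \<open>c\<^sub>1\<close> independent of \<open>c\<^sub>2\<close>.
\<close>

subsection \<open>Integration over the plane\<close>

text \<open>The order 4 results from a trade between two powers. The mask is at most
  \<open>2 ^ (K - 4)\<close> times the \<open>K\<close>-th power of a cosine, and the product of the
  first \<open>J\<close> dyadic cosines has size about \<open>1 / 2 ^ J\<close> at the right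
  \<open>J\<close>; so each scale loses a factor \<open>2 ^ K\<close> and regains only
  \<open>2 ^ (K - 4)\<close>. Order 4 in each variable is exactly what is spent later: two orders
  make the sum over the dual lattice converge and produce the gain \<open>c1 ^ 2\<close>, the other
  two, together with the zero on the axis, pay for the sums over shears and scales. The
  low-frequency part leaks into the cone estimate with a constant that is not small. It can be
  tolerated because, once that estimate is multiplied by \<open>c1 * c2\<close>, this constant no
  longer depends on the sampling at all; only the two aliasing errors have to be absorbed, and both
  are multiples of \<open>c1 ^ 2\<close>. Sums and integrals stay in \<open>ennreal\<close> as far
  as possible, so that Tonelli applies without convergence conditions; real numbers return where
  terms have to be subtracted or absorbed.\<close>

abbreviation nsq :: "complex \<Rightarrow> ennreal"
  where "nsq z \<equiv> ennreal ((cmod z)\<^sup>2)"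

abbreviation sqint :: "'a measure \<Rightarrow> ('a \<Rightarrow> complex) \<Rightarrow> ennreal"
  where "sqint M f \<equiv> (\<integral>\<^sup>+x. nsq (f x) \<partial>M)"

abbreviation nn_sum :: "('i \<Rightarrow> ennreal) \<Rightarrow> ennreal"  (binder "\<Sum>\<^sup>+" 10)
  where "nn_sum f \<equiv> nn_integral (count_space UNIV) f"

text \<open>Lebesgue measure is determined by boxes, and the preimage of a box under an invertible
  matrix is its image under the inverse, with volume divided by the absolute determinant. As an
  equality of measures this serves nonnegative and complex integrals alike.\<close>

lemma lborel_linear_image:
  fixes A :: "real^2^2"
  assumes "det A \<noteq> 0"
  shows "lborel = density (distr lborel borel ((*v) A)) (\<lambda>_. ennreal \<bar>det A\<bar>)"
proof (rule lborel_eqI)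
  fix l u :: "real^2" assume le: "\<And>b. b \<in> Basis \<Longrightarrow> l \<bullet> b \<le> u \<bullet> b"
  have inv: "invertible A" using assms by (simp add: invertible_det_nz)
  let ?S = "(*v) A -` box l u"
  have "bij ((*v) A)" using inv by (simp add: invertible_eq_bij)
  then have img: "(*v) A ` ?S = box l u"
    by (simp add: bij_is_surj surj_image_vimage_eq)
  have meas: "?S \<in> sets borel"
    by (intro borel_open continuous_open_vimage open_box)
       (simp_all add: continuous_on_eq_continuous_at matrix_vector_mult_linear_continuous_at)
  obtain B where B: "B ** A = mat 1" "A ** B = mat 1"
    using inv unfolding invertible_def by blast
  have img2: "?S = (*v) B ` box l u"
    using B img by (auto simp: image_iff matrix_vector_mul_assoc) (metis B(1) matrix_vector_mul_assoc matrix_vector_mul_lid)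
  have lm: "?S \<in> lmeasurable"
    unfolding img2 by (rule measurable_linear_image) auto
  have "measure lebesgue (box l u) = \<bar>det (matrix ((*v) A))\<bar> * measure lebesgue ?S"
    using measure_linear_image[OF matrix_vector_mul_linear lm, of A] img by simp
  then have eq: "measure lborel (box l u) = \<bar>det A\<bar> * measure lborel ?S"
    using meas by (simp add: matrix_of_matrix_vector_mul)
  have fin: "emeasure lborel ?S = ennreal (measure lborel ?S)"
    using lm meas by (simp add: fmeasurable_def emeasure_eq_ennreal_measure)
  have "emeasure (density (distr lborel borel ((*v) A)) (\<lambda>_. ennreal \<bar>det A\<bar>)) (box l u) 
    = ennreal \<bar>det A\<bar> * emeasure lborel ?S"
    by (simp add: emeasure_density nn_integral_cmult emeasure_distr borel_measurable_continuous_onI continuous_on_eq_continuous_at matrix_vector_mult_linear_continuous_at)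
  also have "\<dots> = ennreal (measure lborel (box l u))"
    by (simp add: fin eq ennreal_mult)
  also have "\<dots> = ennreal (\<Prod>b\<in>Basis. (u - l) \<bullet> b)"
    using le by simp
  finally show "emeasure (density (distr lborel borel ((*v) A)) (\<lambda>_. ennreal \<bar>det A\<bar>)) (box l u) = ennreal (\<Prod>b\<in>Basis. (u - l) \<bullet> b)" .
qed simp

lemma matrix_vector_mult_measurable [measurable]:
  "(*v) (A::real^2^2) \<in> borel_measurable borel"
  by (simp add: borel_measurable_continuous_onI continuous_on_eq_continuous_at matrix_vector_mult_linear_continuous_at)

lemma nn_integral_linear:
  fixes A :: "real^2^2"
  assumes "det A \<noteq> 0" and [measurable]: "f \<in> borel_measurable borel"
  shows "(\<integral>\<^sup>+x. f x \<partial>lborel) = ennreal \<bar>det A\<bar> * (\<integral>\<^sup>+x. f (A *v x) \<partial>lborel)"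
  by (subst lborel_linear_image[OF assms(1)])
     (simp add: nn_integral_density nn_integral_distr nn_integral_cmult)

lemma integral_linear:
  fixes A :: "real^2^2" and f :: "real^2 \<Rightarrow> complex"
  assumes "det A \<noteq> 0" and [measurable]: "f \<in> borel_measurable borel"
  shows "(\<integral>x. f x \<partial>lborel) = \<bar>det A\<bar> *\<^sub>R (\<integral>x. f (A *v x) \<partial>lborel)"
  by (subst lborel_linear_image[OF assms(1)])
     (simp add: integral_density integral_distr)

lemma nn_integral_translate:
  fixes t :: "'a::euclidean_space"
  assumes [measurable]: "f \<in> borel_measurable borel"
  shows "(\<integral>\<^sup>+x. f (x + t) \<partial>lborel) = (\<integral>\<^sup>+x. f x \<partial>lborel)"
  by (subst lborel_distr_plus[of t, symmetric]) (simp add: nn_integral_distr add.commute)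

lemma integral_translate:
  fixes t :: "'a::euclidean_space" and f :: "'a \<Rightarrow> complex"
  assumes [measurable]: "f \<in> borel_measurable borel"
  shows "(\<integral>x. f (x + t) \<partial>lborel) = (\<integral>x. f x \<partial>lborel)"
  by (subst lborel_distr_plus[of t, symmetric]) (simp add: integral_distr add.commute)

section \<open>The fundamental cell and the tiling of the plane\<close>

definition unit_cube :: "(real^2) set"
  where "unit_cube = {x. \<forall>i. 0 \<le> x$i \<and> x$i < 1}"

text \<open>Lebesgue measure carried by the half-open cube, but with the whole plane as its space:
  functions on the plane need no restriction, and Borel measurability is unchanged.\<close>

definition torus :: "(real^2) measure"
  where "torus = density lborel (indicator unit_cube)"

definition chr :: "int^2 \<Rightarrow> real^2 \<Rightarrow> complex"
  where "chr m x = cis (2 * pi * (lattice m \<bullet> x))"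

lemma vec_nth_measurable [measurable]: "(\<lambda>x::real^2. x $ i) \<in> borel_measurable borel"
  by (intro borel_measurable_continuous_onI continuous_intros)

lemma unit_cube_eq: "unit_cube = {x. 0 \<le> x$1 \<and> x$1 < 1 \<and> 0 \<le> x$2 \<and> x$2 < 1}"
  by (auto simp: unit_cube_def forall_2)

lemma unit_cube_measurable [measurable]: "unit_cube \<in> sets borel"
  unfolding unit_cube_eq by measurable

lemma sets_torus [simp, measurable_cong]: "sets torus = sets borel"
  by (simp add: torus_def)

lemma space_torus [simp]: "space torus = UNIV"
  by (simp add: torus_def)

lemma nn_integral_torus:
  assumes [measurable]: "f \<in> borel_measurable borel"
  shows "(\<integral>\<^sup>+x. f x \<partial>torus) = (\<integral>\<^sup>+x. f x * indicator unit_cube x \<partial>lborel)"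
  by (simp add: torus_def nn_integral_density mult.commute)

lemma AE_torus: "(\<And>x. x \<in> unit_cube \<Longrightarrow> P x) \<Longrightarrow> AE x in torus. P x"
  unfolding torus_def by (subst AE_density) (auto split: split_indicator)

text \<open>Every point lies in exactly one integer translate of the half-open cube, the one given
  by the floors of its coordinates; Tonelli and translation invariance do the rest.\<close>

lemma nn_integral_tiling:
  fixes f :: "real^2 \<Rightarrow> ennreal"
  assumes [measurable]: "f \<in> borel_measurable borel"
  shows "(\<integral>\<^sup>+x. f x \<partial>lborel) = (\<integral>\<^sup>+x. (\<Sum>\<^sup>+m. f (x + lattice m)) \<partial>torus)"
proof -
  have 1: "(\<Sum>\<^sup>+m. f x * indicator unit_cube (x - lattice m)) = f x" for x
  proof -
    define m0 :: "int^2" where "m0 = (\<chi> i. \<lfloor>x$i\<rfloor>)"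
    have "x - lattice m \<in> unit_cube \<longleftrightarrow> m = m0" for m
      unfolding unit_cube_def m0_def lattice_def
      by (simp add: vec_eq_iff algebra_simps) (smt (verit) floor_eq_iff)
    then have "indicator unit_cube (x - lattice m) = (indicator {m0} m :: ennreal)" for m
      by (simp add: indicator_def)
    then show ?thesis by (simp add: nn_integral_count_space_indicator[symmetric] nn_integral_count_space_finite flip: nn_integral_count_space_indicator)
  qed
  have "(\<integral>\<^sup>+x. f x \<partial>lborel) = (\<integral>\<^sup>+x. (\<Sum>\<^sup>+m. f x * indicator unit_cube (x - lattice m)) \<partial>lborel)"
    by (simp add: 1)
  also have "\<dots> = (\<Sum>\<^sup>+m. (\<integral>\<^sup>+x. f x * indicator unit_cube (x - lattice m) \<partial>lborel))"
    by (rule nn_integral_count_space_nn_integral) auto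
  also have "\<dots> = (\<Sum>\<^sup>+m. (\<integral>\<^sup>+x. f (x + lattice m) * indicator unit_cube x \<partial>lborel))"
  proof (rule nn_integral_cong)
    fix m :: "int^2"
    show "(\<integral>\<^sup>+x. f x * indicator unit_cube (x - lattice m) \<partial>lborel)
        = (\<integral>\<^sup>+x. f (x + lattice m) * indicator unit_cube x \<partial>lborel)"
      using nn_integral_translate[of "\<lambda>x. f x * indicator unit_cube (x - lattice m)" "lattice m"] by simp
  qed
  also have "\<dots> = (\<Sum>\<^sup>+m. (\<integral>\<^sup>+x. f (x + lattice m) \<partial>torus))"
    by (simp add: nn_integral_torus)
  also have "\<dots> = (\<integral>\<^sup>+x. (\<Sum>\<^sup>+m. f (x + lattice m)) \<partial>torus)"
    by (rule nn_integral_count_space_nn_integral[symmetric]) auto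
  finally show ?thesis .
qed

section \<open>Iterated integration in the two coordinates\<close>

definition vec2 :: "real \<times> real \<Rightarrow> real^2" where "vec2 p = vector [fst p, snd p]"

lemma vec2_nth [simp]: "vec2 p $ 1 = fst p" "vec2 p $ 2 = snd p"
  by (simp_all add: vec2_def)

lemma inner_2: "(x::real^2) \<bullet> y = x$1 * y$1 + x$2 * y$2"
  by (simp add: inner_vec_def sum_2)

lemma vec2_eq: "vec2 p = fst p *\<^sub>R axis 1 1 + snd p *\<^sub>R axis 2 1"
  by (simp add: vec_eq_iff forall_2 axis_def)

lemma vec2_measurable [measurable]: "vec2 \<in> borel_measurable borel"
  unfolding vec2_eq[abs_def] by (intro borel_measurable_continuous_onI continuous_intros)

lemma lborel_vec2: "(lborel :: (real^2) measure) = distr (lborel \<Otimes>\<^sub>M lborel) borel vec2"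
proof (rule lborel_eqI)
  fix l u :: "real^2" assume le: "\<And>b. b \<in> Basis \<Longrightarrow> l \<bullet> b \<le> u \<bullet> b"
  have le': "l$1 \<le> u$1" "l$2 \<le> u$2"
    using le[of "axis 1 1"] le[of "axis 2 1"] by (auto simp: inner_axis axis_in_Basis_iff)
  have B: "(Basis :: (real^2) set) = {axis 1 1, axis 2 1}"
    by (auto simp: Basis_vec_def UNIV_2)
  have ne: "axis 1 1 \<noteq> (axis 2 1 :: real^2)"
    by (simp add: axis_eq_axis)
  have "vec2 -` box l u = {l$1<..<u$1} \<times> {l$2<..<u$2}"
    by (auto simp: mem_box B inner_axis)
  then have "emeasure (distr (lborel \<Otimes>\<^sub>M lborel) borel vec2) (box l u) = emeasure (lborel \<Otimes>\<^sub>M lborel) ({l$1<..<u$1} \<times> {l$2<..<u$2})"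
    by (simp add: emeasure_distr borel_prod lborel_prod)
  also have "\<dots> = ennreal (u$1 - l$1) * ennreal (u$2 - l$2)"
    using le' by (subst lborel.emeasure_pair_measure_Times) auto
  also have "\<dots> = ennreal (\<Prod>b\<in>Basis. (u - l) \<bullet> b)"
    using le' ne by (simp add: B inner_axis ennreal_mult)
  finally show "emeasure (distr (lborel \<Otimes>\<^sub>M lborel) borel vec2) (box l u) = ennreal (\<Prod>b\<in>Basis. (u - l) \<bullet> b)" .
qed simp

lemma nn_integral_vec2:
  assumes [measurable]: "f \<in> borel_measurable (borel :: (real^2) measure)"
  shows "(\<integral>\<^sup>+x. f x \<partial>lborel) = (\<integral>\<^sup>+x. (\<integral>\<^sup>+y. f (vec2 (x, y)) \<partial>lborel) \<partial>lborel)"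
proof -
  have "(\<integral>\<^sup>+x. f x \<partial>lborel) = (\<integral>\<^sup>+p. f (vec2 p) \<partial>(lborel \<Otimes>\<^sub>M lborel))"
    by (subst lborel_vec2, subst nn_integral_distr) (auto simp: lborel_prod)
  also have "\<dots> = (\<integral>\<^sup>+x. (\<integral>\<^sup>+y. f (vec2 (x, y)) \<partial>lborel) \<partial>lborel)"
    by (subst lborel.nn_integral_fst[symmetric]) (auto simp: lborel_prod)
  finally show ?thesis .
qed

lemma nn_integral_tensor:
  fixes f g :: "real \<Rightarrow> ennreal"
  assumes [measurable]: "f \<in> borel_measurable borel" "g \<in> borel_measurable borel"
  shows "(\<integral>\<^sup>+x. f (x$1) * g (x$2) \<partial>(lborel :: (real^2) measure)) = (\<integral>\<^sup>+x. f x \<partial>lborel) * (\<integral>\<^sup>+x. g x \<partial>lborel)"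
  by (subst nn_integral_vec2) (auto simp: nn_integral_cmult nn_integral_multc)

lemma integral_tensor:
  fixes f g :: "real \<Rightarrow> complex"
  assumes f: "integrable lborel f" and g: "integrable lborel g"
  shows "(\<integral>x. f (x$1) * g (x$2) \<partial>(lborel :: (real^2) measure)) = (\<integral>x. f x \<partial>lborel) * (\<integral>x. g x \<partial>lborel)"
proof -
  have [measurable]: "f \<in> borel_measurable borel" "g \<in> borel_measurable borel" using f g by auto
  have "integrable lborel (\<lambda>x::real^2. f (x$1) * g (x$2))"
    using f g by (intro integrableI_bounded)
       (use nn_integral_tensor[of "\<lambda>x. ennreal (cmod (f x))" "\<lambda>x. ennreal (cmod (g x))"] in
         \<open>auto simp: norm_mult ennreal_mult integrable_iff_bounded ennreal_mult_less_top\<close>)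
  then have i: "integrable (lborel \<Otimes>\<^sub>M lborel) (\<lambda>p. f (fst p) * g (snd p))"
    by (subst (asm) lborel_vec2, subst (asm) integrable_distr_eq) (auto simp: lborel_prod)
  have "(\<integral>x. f (x$1) * g (x$2) \<partial>(lborel :: (real^2) measure)) = (\<integral>p. f (fst p) * g (snd p) \<partial>(lborel \<Otimes>\<^sub>M lborel))"
    by (subst lborel_vec2, subst integral_distr) (auto simp: lborel_prod)
  also have "\<dots> = (\<integral>x. (\<integral>y. f x * g y \<partial>lborel) \<partial>lborel)"
    using lborel_pair.integral_fst[of "\<lambda>x y. f x * g y"] i by (simp add: case_prod_beta')
  finally show ?thesis by simp
qed

subsection \<open>Fourier series on the torus\<close>

lemma lattice_add: "lattice (m + n) = lattice m + lattice n"
  by (simp add: lattice_def vec_eq_iff)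

lemma lattice_minus: "lattice (- m) = - lattice m"
  by (simp add: lattice_def vec_eq_iff)

lemma lattice_0 [simp]: "lattice 0 = 0"
  by (simp add: lattice_def vec_eq_iff)

lemma lattice_nth [simp]: "lattice m $ i = real_of_int (m $ i)"
  by (simp add: lattice_def)

lemma chr_0 [simp]: "chr 0 x = 1"
  by (simp add: chr_def)

lemma chr_add: "chr (m + n) x = chr m x * chr n x"
  by (simp add: chr_def lattice_add inner_add_left distrib_left cis_mult)

lemma chr_minus: "chr (- m) x = cnj (chr m x)"
  by (simp add: chr_def lattice_minus cis_cnj)

lemma cmod_chr [simp]: "cmod (chr m x) = 1"
  by (simp add: chr_def)

lemma chr_translate: "chr m (x + lattice n) = chr m x"
proof -
  have "lattice m \<bullet> lattice n = of_int (m$1 * n$1 + m$2 * n$2)"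
    by (simp add: inner_2)
  then have "cis (2 * pi * (lattice m \<bullet> lattice n)) = 1"
    by (metis cis_multiple_2pi Ints_of_int)
  then show ?thesis
    by (simp add: chr_def inner_add_right distrib_left cis_mult[symmetric])
qed

lemma chr_measurable [measurable]: "chr m \<in> borel_measurable borel"
  unfolding chr_def[abs_def]
  by (intro borel_measurable_continuous_onI continuous_intros)

section \<open>Density of trigonometric polynomials in L2 of the torus\<close>

inductive trigp :: "(real^2 \<Rightarrow> complex) \<Rightarrow> bool" where
  monomial: "trigp (\<lambda>x. a * chr m x)"
| add: "trigp p \<Longrightarrow> trigp q \<Longrightarrow> trigp (\<lambda>x. p x + q x)"

lemma trigp_const: "trigp (\<lambda>x. a)"
  using trigp.monomial[of a 0] by simp

text \<open>The inductive form of \<open>trigp\<close> makes this a double induction over monomials.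
  Closure under products is what lets an arbitrary polynomial in the circle coordinates be read as a
  trigonometric polynomial.\<close>

lemma trigp_mult:
  assumes "trigp p" "trigp q" shows "trigp (\<lambda>x. p x * q x)"
  using assms(1)
proof induction
  case (monomial a m)
  show ?case using assms(2)
  proof induction
    case (monomial b n)
    have "(\<lambda>x. (a * chr m x) * (b * chr n x)) = (\<lambda>x. (a * b) * chr (m + n) x)"
      by (simp add: chr_add ac_simps)
    then show ?case by (metis trigp.monomial)
  qed (simp add: distrib_left trigp.add)
qed (simp add: distrib_right trigp.add)

lemma trigp_measurable [measurable_dest]: "trigp p \<Longrightarrow> p \<in> borel_measurable borel"
  by (induction rule: trigp.induct) auto

lemma trigp_repr:
  assumes "trigp p"
  obtains N a where "finite N" "p = (\<lambda>x. \<Sum>m\<in>N. a m * chr m x)"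
proof -
  have "\<exists>N a. finite N \<and> p = (\<lambda>x. \<Sum>m\<in>N. a m * chr m x)"
    using assms
  proof induction
    case (monomial a m)
    show ?case by (rule exI[of _ "{m}"], rule exI[of _ "\<lambda>_. a"]) simp
  next
    case (add p q)
    then obtain N a N' a' where *: "finite N" "p = (\<lambda>x. \<Sum>m\<in>N. a m * chr m x)"
      "finite N'" "q = (\<lambda>x. \<Sum>m\<in>N'. a' m * chr m x)" by blast
    have "p x + q x = (\<Sum>m\<in>N \<union> N'. ((if m \<in> N then a m else 0) + (if m \<in> N' then a' m else 0)) * chr m x)" for x
      using * by (simp add: distrib_right sum.distrib if_distrib[of "\<lambda>u. u * _"] sum.If_cases Int_absorb1
          sum.inter_restrict[symmetric] cong: if_cong)
    then show ?case
      by (intro exI[of _ "N \<union> N'"] exI[of _ "\<lambda>m. (if m \<in> N then a m else 0) + (if m \<in> N' then a' m else 0)"] conjI ext)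
         (use * in auto)
  qed
  then show thesis using that by blast
qed

text \<open>The torus as a product of two unit circles: a compact set on which Stone-Weierstrass
  applies to polynomials in the four real coordinates.\<close>

definition circ :: "real^2 \<Rightarrow> complex \<times> complex"
  where "circ x = (cis (2 * pi * x$1), cis (2 * pi * x$2))"

lemma circ_measurable [measurable]: "circ \<in> borel_measurable borel"
  unfolding circ_def[abs_def]
  by (intro borel_measurable_continuous_onI continuous_intros)

lemma trigp_Re_Im:
  "trigp (\<lambda>x. complex_of_real (Re (fst (circ x))))" "trigp (\<lambda>x. complex_of_real (Im (fst (circ x))))"
  "trigp (\<lambda>x. complex_of_real (Re (snd (circ x))))" "trigp (\<lambda>x. complex_of_real (Im (snd (circ x))))"
proof -
  have c: "fst (circ x) = chr (axis 1 1) x" "snd (circ x) = chr (axis 2 1) x" for x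
    by (simp_all add: circ_def chr_def inner_2 axis_def)
  have re: "trigp (\<lambda>x. complex_of_real (Re (chr m x)))" for m
  proof -
    have "(\<lambda>x. complex_of_real (Re (chr m x))) = (\<lambda>x. (1/2) * chr m x + (1/2) * chr (- m) x)"
      by (simp add: chr_minus complex_eq_iff fun_eq_iff)
    then show ?thesis by (metis trigp.intros)
  qed
  have im: "trigp (\<lambda>x. complex_of_real (Im (chr m x)))" for m
  proof -
    have "(\<lambda>x. complex_of_real (Im (chr m x))) = (\<lambda>x. (-\<i>/2) * chr m x + (\<i>/2) * chr (- m) x)"
      by (simp add: chr_minus complex_eq_iff fun_eq_iff)
    then show ?thesis by (metis trigp.intros)
  qed
  show "trigp (\<lambda>x. complex_of_real (Re (fst (circ x))))" "trigp (\<lambda>x. complex_of_real (Im (fst (circ x))))"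
  "trigp (\<lambda>x. complex_of_real (Re (snd (circ x))))" "trigp (\<lambda>x. complex_of_real (Im (snd (circ x))))"
    by (simp_all only: c re im)
qed

lemma trigp_polynomial:
  assumes "real_polynomial_function q"
  shows "trigp (\<lambda>x. complex_of_real (q (circ x)))"
  using assms
proof induction
  case (linear f)
  interpret bounded_linear f by fact
  \<comment> \<open>A real-linear functional is determined by its values on the four real basis
    vectors, so only real and imaginary parts of the two basic characters occur.\<close>
  have f: "f (z, w) = Re z * f (1, 0) + Im z * f (\<i>, 0) + Re w * f (0, 1) + Im w * f (0, \<i>)" for z w
  proof -
    have "(z, w) = Re z *\<^sub>R (1, 0) + Im z *\<^sub>R (\<i>, 0) + Re w *\<^sub>R (0, 1) + Im w *\<^sub>R (0, \<i>)"
      by (simp add: complex_eq_iff)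
    then show ?thesis by (simp only: add scaleR) simp
  qed
  have "(\<lambda>x. complex_of_real (f (circ x))) = (\<lambda>x. complex_of_real (Re (fst (circ x))) * f (1, 0)
    + complex_of_real (Im (fst (circ x))) * f (\<i>, 0) + complex_of_real (Re (snd (circ x))) * f (0, 1)
    + complex_of_real (Im (snd (circ x))) * f (0, \<i>))"
  proof
    fix x show "complex_of_real (f (circ x)) = complex_of_real (Re (fst (circ x))) * f (1, 0)
    + complex_of_real (Im (fst (circ x))) * f (\<i>, 0) + complex_of_real (Re (snd (circ x))) * f (0, 1)
    + complex_of_real (Im (snd (circ x))) * f (0, \<i>)"
      using f[of "fst (circ x)" "snd (circ x)"] by (simp only: prod.collapse of_real_add of_real_mult)
  qed
  then show ?case
    by (simp only:) (intro trigp.add trigp_mult[OF trigp_Re_Im(1) trigp_const] trigp_mult[OF trigp_Re_Im(2) trigp_const]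
        trigp_mult[OF trigp_Re_Im(3) trigp_const] trigp_mult[OF trigp_Re_Im(4) trigp_const])
qed (simp_all add: trigp_const trigp.add trigp_mult)

text \<open>The distance stays squared and in \<open>ennreal\<close>, so it makes sense without
  integrability; the price is a factor 2 on each term of the triangle inequality, harmless for
  limits.\<close>

definition sqdist :: "'a measure \<Rightarrow> ('a \<Rightarrow> complex) \<Rightarrow> ('a \<Rightarrow> complex) \<Rightarrow> ennreal"
  where "sqdist M u v = (\<integral>\<^sup>+x. nsq (u x - v x) \<partial>M)"

lemma cmod_add_sq_le: "(cmod (a + b))\<^sup>2 \<le> 2 * (cmod a)\<^sup>2 + 2 * (cmod b)\<^sup>2"
proof -
  have "(cmod (a + b))\<^sup>2 \<le> (cmod a + cmod b)\<^sup>2"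
    by (intro power_mono norm_triangle_ineq) simp
  also have "\<dots> \<le> 2 * (cmod a)\<^sup>2 + 2 * (cmod b)\<^sup>2"
    using sum_squares_bound[of "cmod a" "cmod b"] by (simp add: power2_sum)
  finally show ?thesis .
qed

lemma sqdist_triangle:
  assumes [measurable]: "u \<in> borel_measurable M" "v \<in> borel_measurable M" "w \<in> borel_measurable M"
  shows "sqdist M u w \<le> 2 * sqdist M u v + 2 * sqdist M v w"
proof -
  have "sqdist M u w \<le> (\<integral>\<^sup>+x. 2 * nsq (u x - v x) + 2 * nsq (v x - w x) \<partial>M)"
    unfolding sqdist_def
  proof (rule nn_integral_mono)
    fix x
    have "nsq (u x - w x) \<le> ennreal (2 * (cmod (u x - v x))\<^sup>2 + 2 * (cmod (v x - w x))\<^sup>2)"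
      using cmod_add_sq_le[of "u x - v x" "v x - w x"] by (intro ennreal_leI) simp
    then show "nsq (u x - w x) \<le> 2 * nsq (u x - v x) + 2 * nsq (v x - w x)"
      by (simp add: ennreal_mult)
  qed
  also have "\<dots> = 2 * sqdist M u v + 2 * sqdist M v w"
    by (simp add: sqdist_def nn_integral_add nn_integral_cmult)
  finally show ?thesis .
qed

lemma sqdist_add_le:
  assumes [measurable]: "u \<in> borel_measurable M" "v \<in> borel_measurable M" "p \<in> borel_measurable M" "q \<in> borel_measurable M"
  shows "sqdist M (\<lambda>x. u x + v x) (\<lambda>x. p x + q x) \<le> 2 * sqdist M u p + 2 * sqdist M v q"
proof -
  have "sqdist M (\<lambda>x. u x + v x) (\<lambda>x. p x + q x) \<le> 2 * sqdist M (\<lambda>x. u x + v x) (\<lambda>x. p x + v x) + 2 * sqdist M (\<lambda>x. p x + v x) (\<lambda>x. p x + q x)"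
    by (rule sqdist_triangle) auto
  then show ?thesis by (simp add: sqdist_def)
qed

lemma sqdist_cmult:
  assumes [measurable]: "u \<in> borel_measurable M" "p \<in> borel_measurable M"
  shows "sqdist M (\<lambda>x. a * u x) (\<lambda>x. a * p x) = nsq a * sqdist M u p"
  by (simp add: sqdist_def right_diff_distrib[symmetric] norm_mult power_mult_distrib ennreal_mult nn_integral_cmult)

lemma sqdist_tendsto:
  assumes [measurable]: "\<And>n. s n \<in> borel_measurable M" "u \<in> borel_measurable M" "w \<in> borel_measurable M"
    and lim: "AE x in M. (\<lambda>n. s n x) \<longlonglongrightarrow> u x"
    and bd: "\<And>n. AE x in M. cmod (s n x) \<le> w x"
    and fin: "(\<integral>\<^sup>+x. ennreal ((w x)\<^sup>2) \<partial>M) < \<infinity>"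
  shows "(\<lambda>n. sqdist M u (s n)) \<longlonglongrightarrow> 0"
proof -
  have "(\<lambda>n. sqdist M u (s n)) \<longlonglongrightarrow> (\<integral>\<^sup>+x. 0 \<partial>M)"
    unfolding sqdist_def
  proof (rule nn_integral_dominated_convergence[where w="\<lambda>x. ennreal (4 * (w x)\<^sup>2)"])
    have "(\<integral>\<^sup>+x. ennreal (4 * (w x)\<^sup>2) \<partial>M) = 4 * (\<integral>\<^sup>+x. ennreal ((w x)\<^sup>2) \<partial>M)"
      by (simp add: ennreal_mult nn_integral_cmult)
    then show "(\<integral>\<^sup>+x. ennreal (4 * (w x)\<^sup>2) \<partial>M) < \<infinity>"
      using fin by (simp add: ennreal_mult_less_top)
    show "AE x in M. (\<lambda>n. nsq (u x - s n x)) \<longlonglongrightarrow> 0"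
      using lim
    proof eventually_elim
      case (elim x)
      have "(\<lambda>n. (cmod (u x - s n x))\<^sup>2) \<longlonglongrightarrow> (cmod (u x - u x))\<^sup>2"
        by (intro tendsto_intros elim)
      then show ?case by (simp add: tendsto_ennrealI[where x=0, simplified])
    qed
    fix n
    have "AE x in M. \<forall>n. cmod (s n x) \<le> w x" using bd by (simp add: AE_all_countable)
    with lim show "AE x in M. nsq (u x - s n x) \<le> ennreal (4 * (w x)\<^sup>2)"
    proof eventually_elim
      case (elim x)
      \<comment> \<open>The limit inherits the bound of the sequence, so the difference is at most
        \<open>2 * w\<close> and its square at most \<open>4 * w ^ 2\<close>.\<close>
      have "cmod (u x) \<le> w x"
        by (rule tendsto_upperbound[OF tendsto_norm[OF elim(1)]]) (use elim in auto)
      then have "cmod (u x - s n x) \<le> 2 * w x"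
        using norm_triangle_ineq4[of "u x" "s n x"] elim(2)[rule_format, of n] by linarith
      then have "(cmod (u x - s n x))\<^sup>2 \<le> (2 * w x)\<^sup>2" by (rule power_mono) simp
      then show ?case by (intro ennreal_leI) (simp add: power_mult_distrib)
    qed
  qed auto
  then show ?thesis by simp
qed

text \<open>Membership in the L2 closure of the trigonometric polynomials, for Borel
  representatives. Stability under linear combinations and dominated limits is all that the
  measure-theoretic extension from closed sets needs.\<close>

definition trig_approx :: "(real^2 \<Rightarrow> complex) \<Rightarrow> bool"
  where "trig_approx u \<longleftrightarrow> u \<in> borel_measurable borel \<and>
    (\<forall>\<epsilon>>0. \<exists>p. trigp p \<and> sqdist torus u p \<le> ennreal \<epsilon>)"

lemma trig_approx_trigp: "trigp p \<Longrightarrow> trig_approx p"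
  unfolding trig_approx_def by (auto intro!: exI[of _ p] simp: trigp_measurable sqdist_def)

lemma trig_approx_close:
  assumes u: "u \<in> borel_measurable borel"
    and close: "\<And>\<epsilon>. \<epsilon> > 0 \<Longrightarrow> \<exists>v. trig_approx v \<and> sqdist torus u v \<le> ennreal \<epsilon>"
  shows "trig_approx u"
  unfolding trig_approx_def
proof (intro conjI allI impI u)
  fix \<epsilon> :: real assume "\<epsilon> > 0"
  then obtain v where v: "trig_approx v" "sqdist torus u v \<le> ennreal (\<epsilon>/4)"
    using close[of "\<epsilon>/4"] by auto
  then obtain p where p: "trigp p" "sqdist torus v p \<le> ennreal (\<epsilon>/4)"
    using \<open>\<epsilon> > 0\<close> unfolding trig_approx_def by (metis divide_pos_pos zero_less_numeral)
  have "sqdist torus u p \<le> 2 * sqdist torus u v + 2 * sqdist torus v p"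
    using u v(1) p(1) by (intro sqdist_triangle) (auto simp: trig_approx_def trigp_measurable measurable_cong_sets[OF sets_torus])
  also have "\<dots> \<le> 2 * ennreal (\<epsilon>/4) + 2 * ennreal (\<epsilon>/4)"
    using v p by (intro add_mono mult_left_mono) auto
  also have "\<dots> = ennreal \<epsilon>"
    using \<open>\<epsilon> > 0\<close> by (simp add: ennreal_plus[symmetric] ennreal_mult'[symmetric] ennreal_numeral[symmetric] del: ennreal_plus ennreal_numeral)
  finally show "\<exists>p. trigp p \<and> sqdist torus u p \<le> ennreal \<epsilon>" using p by blast
qed

lemma trig_approx_limit:
  assumes [measurable]: "u \<in> borel_measurable borel" and s: "\<And>n. trig_approx (s n)"
    and [measurable]: "w \<in> borel_measurable borel"
    and lim: "AE x in torus. (\<lambda>n. s n x) \<longlonglongrightarrow> u x"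
    and bd: "\<And>n. AE x in torus. cmod (s n x) \<le> w x"
    and fin: "(\<integral>\<^sup>+x. ennreal ((w x)\<^sup>2) \<partial>torus) < \<infinity>"
  shows "trig_approx u"
proof (rule trig_approx_close)
  fix \<epsilon> :: real assume "\<epsilon> > 0"
  have [measurable]: "s n \<in> borel_measurable borel" for n using s by (simp add: trig_approx_def)
  have "(\<lambda>n. sqdist torus u (s n)) \<longlonglongrightarrow> 0"
    by (rule sqdist_tendsto[OF _ _ _ lim bd fin]) auto
  then have "\<forall>\<^sub>F n in sequentially. sqdist torus u (s n) < ennreal \<epsilon>"
    using \<open>\<epsilon> > 0\<close> by (intro order_tendstoD) auto
  then obtain n where "sqdist torus u (s n) < ennreal \<epsilon>"
    by (auto dest: eventually_happens)
  then show "\<exists>v. trig_approx v \<and> sqdist torus u v \<le> ennreal \<epsilon>"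
    using s by (meson less_imp_le)
qed simp

lemma trig_approx_add:
  assumes "trig_approx u" "trig_approx v" shows "trig_approx (\<lambda>x. u x + v x)"
  unfolding trig_approx_def
proof (intro conjI allI impI)
  have [measurable]: "u \<in> borel_measurable borel" "v \<in> borel_measurable borel"
    using assms by (auto simp: trig_approx_def)
  show "(\<lambda>x. u x + v x) \<in> borel_measurable borel" by measurable
  fix \<epsilon> :: real assume "\<epsilon> > 0"
  then have "\<epsilon>/4 > 0" by simp
  then obtain p q where p: "trigp p" "sqdist torus u p \<le> ennreal (\<epsilon>/4)" and q: "trigp q" "sqdist torus v q \<le> ennreal (\<epsilon>/4)"
    using assms unfolding trig_approx_def by blast
  have [measurable]: "p \<in> borel_measurable borel" "q \<in> borel_measurable borel"
    using p q by (auto simp: trigp_measurable)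
  have "sqdist torus (\<lambda>x. u x + v x) (\<lambda>x. p x + q x) \<le> 2 * sqdist torus u p + 2 * sqdist torus v q"
    by (intro sqdist_add_le) auto
  also have "\<dots> \<le> 2 * ennreal (\<epsilon>/4) + 2 * ennreal (\<epsilon>/4)"
    using p q by (intro add_mono mult_left_mono) auto
  also have "\<dots> = ennreal \<epsilon>"
    using \<open>\<epsilon> > 0\<close> by (simp add: ennreal_plus[symmetric] ennreal_mult'[symmetric] ennreal_numeral[symmetric] del: ennreal_plus ennreal_numeral)
  finally show "\<exists>p. trigp p \<and> sqdist torus (\<lambda>x. u x + v x) p \<le> ennreal \<epsilon>"
    using p q trigp.add by blast
qed

lemma trig_approx_cmult:
  assumes "trig_approx u" shows "trig_approx (\<lambda>x. a * u x)"
  unfolding trig_approx_def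
proof (intro conjI allI impI)
  have [measurable]: "u \<in> borel_measurable borel"
    using assms by (auto simp: trig_approx_def)
  show "(\<lambda>x. a * u x) \<in> borel_measurable borel" by measurable
  fix \<epsilon> :: real assume "\<epsilon> > 0"
  define \<delta> where "\<delta> = \<epsilon> / (1 + (cmod a)\<^sup>2)"
  have "1 + (cmod a)\<^sup>2 > 0" by (simp add: add_pos_nonneg)
  then have "\<delta> > 0" using \<open>\<epsilon> > 0\<close> by (simp add: \<delta>_def)
  then obtain p where p: "trigp p" "sqdist torus u p \<le> ennreal \<delta>"
    using assms unfolding trig_approx_def by blast
  have [measurable]: "p \<in> borel_measurable borel"
    using p by (auto simp: trigp_measurable)
  have "sqdist torus (\<lambda>x. a * u x) (\<lambda>x. a * p x) = nsq a * sqdist torus u p"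
    by (intro sqdist_cmult) auto
  also have "\<dots> \<le> nsq a * ennreal \<delta>"
    using p by (intro mult_left_mono) auto
  also have "\<dots> = ennreal ((cmod a)\<^sup>2 * \<delta>)"
    using \<open>\<delta> > 0\<close> by (simp add: ennreal_mult')
  also have "\<dots> \<le> ennreal \<epsilon>"
    using \<open>\<delta> > 0\<close> \<open>\<epsilon> > 0\<close> \<open>1 + (cmod a)\<^sup>2 > 0\<close> by (intro ennreal_leI) (simp add: \<delta>_def field_simps)
  finally show "\<exists>p. trigp p \<and> sqdist torus (\<lambda>x. a * u x) p \<le> ennreal \<epsilon>"
    using p trigp_mult[OF trigp_const p(1)] by blast
qed

lemma emeasure_torus: "emeasure torus UNIV = 1"
proof -
  have eq: "indicator unit_cube x = (indicator {0..<1} (x$1) * indicator {0..<1} (x$2) :: ennreal)" for x :: "real^2"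
    by (auto simp: unit_cube_eq indicator_def)
  have "emeasure torus UNIV = (\<integral>\<^sup>+x. 1 \<partial>torus)" by simp
  also have "\<dots> = (\<integral>\<^sup>+x. indicator {0..<1} (x$1) * indicator {0..<1} (x$2) \<partial>(lborel :: (real^2) measure))"
    unfolding eq[symmetric] by (subst nn_integral_torus) auto
  also have "\<dots> = 1" by (subst nn_integral_tensor) auto
  finally show ?thesis .
qed

lemma finite_measure_torus: "finite_measure torus"
  by standard (simp add: emeasure_torus)

text \<open>Weierstrass approximation on the product of two circles handles the continuous function
  \<open>max 0 (1 - n * infdist z C)\<close>, which decreases to the indicator of the closed set \<open>C\<close>.\<close>

lemma trig_approx_closed:
  assumes C: "closed C"
  shows "trig_approx (\<lambda>x. indicator C (circ x))"
proof (cases "C = {}")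
  case True then show ?thesis using trig_approx_trigp[OF trigp_const[of 0]] by simp
next
  case False
  define g where "g n z = max 0 (1 - real n * infdist z C)" for n and z :: "complex \<times> complex"
  have gcont: "continuous_on S (g n)" for S n
    unfolding g_def[abs_def] by (intro continuous_intros)
  have [measurable]: "g n \<in> borel_measurable borel" for n
    by (intro borel_measurable_continuous_onI gcont)
  have [measurable]: "C \<in> sets borel" using C by simp
  have ga: "trig_approx (\<lambda>x. complex_of_real (g n (circ x)))" for n
    unfolding trig_approx_def
  proof (intro conjI allI impI)
    fix \<epsilon> :: real assume "\<epsilon> > 0"
    have "compact (sphere (0::complex) 1 \<times> sphere (0::complex) 1)" by (intro compact_Times) auto
    then obtain q where q: "real_polynomial_function q" 
      "\<And>z. z \<in> sphere 0 1 \<times> sphere 0 1 \<Longrightarrow> \<bar>g n z - q z\<bar> < sqrt \<epsilon>"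
      using Stone_Weierstrass_real_polynomial_function[OF _ gcont, of _ "sqrt \<epsilon>"] \<open>\<epsilon> > 0\<close>
      by (metis real_sqrt_gt_0_iff)
    have "sqdist torus (\<lambda>x. complex_of_real (g n (circ x))) (\<lambda>x. complex_of_real (q (circ x))) \<le> (\<integral>\<^sup>+x. ennreal \<epsilon> \<partial>torus)"
      unfolding sqdist_def
    proof (intro nn_integral_mono ennreal_leI)
      fix x
      have "\<bar>g n (circ x) - q (circ x)\<bar> \<le> sqrt \<epsilon>"
        using q(2)[of "circ x"] by (simp add: circ_def less_imp_le)
      then have "\<bar>g n (circ x) - q (circ x)\<bar>\<^sup>2 \<le> (sqrt \<epsilon>)\<^sup>2" by (intro power_mono) auto
      then show "(cmod (complex_of_real (g n (circ x)) - complex_of_real (q (circ x))))\<^sup>2 \<le> \<epsilon>"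
        using \<open>\<epsilon> > 0\<close> by (simp flip: of_real_diff)
    qed
    also have "\<dots> = ennreal \<epsilon>" by (simp add: emeasure_torus)
    finally show "\<exists>p. trigp p \<and> sqdist torus (\<lambda>x. complex_of_real (g n (circ x))) p \<le> ennreal \<epsilon>"
      using trigp_polynomial[OF q(1)] by blast
  qed measurable
  have lim: "(\<lambda>n. g n z) \<longlonglongrightarrow> indicator C z" for z
  proof (cases "z \<in> C")
    case True
    then show ?thesis by (simp add: g_def)
  next
    case zC: False
    then have pos: "infdist z C > 0"
      using C False by (simp add: infdist_pos_not_in_closed)
    have "\<forall>\<^sub>F n in sequentially. g n z = 0"
    proof -
      obtain k :: nat where "1 / infdist z C < real k" using reals_Archimedean2 by blast
      then have "g n z = 0" if "n \<ge> k" for n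
      proof -
        have "1 / infdist z C < real n" using that \<open>1 / infdist z C < real k\<close> by linarith
        then have "1 < real n * infdist z C" using pos by (simp add: field_simps)
        then show ?thesis by (simp add: g_def)
      qed
      then show ?thesis by (auto simp: eventually_sequentially)
    qed
    then show ?thesis using zC by (simp add: tendsto_eventually)
  qed
  show ?thesis
  proof (rule trig_approx_limit[where s="\<lambda>n x. complex_of_real (g n (circ x))" and w="\<lambda>_. 1"])
    show "AE x in torus. (\<lambda>n. complex_of_real (g n (circ x))) \<longlonglongrightarrow> indicator C (circ x)"
    proof (rule AE_I2)
      fix x
      have "(\<lambda>n. complex_of_real (g n (circ x))) \<longlonglongrightarrow> complex_of_real (indicator C (circ x))"
        by (intro tendsto_of_real lim)
      then show "(\<lambda>n. complex_of_real (g n (circ x))) \<longlonglongrightarrow> indicator C (circ x)"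
        by (cases "circ x \<in> C") auto
    qed
    show "AE x in torus. cmod (complex_of_real (g n (circ x))) \<le> 1" for n
      by (auto simp: g_def infdist_nonneg)
  qed (auto simp: ga emeasure_torus)
qed

text \<open>Dynkin's argument: closed sets are stable under intersection and generate the Borel
  sets, while the sets with approximable indicator are stable under complements and countable
  disjoint unions.\<close>

lemma trig_approx_borel:
  assumes "A \<in> sets borel"
  shows "trig_approx (\<lambda>x. indicator A (circ x))"
proof -
  have "Int_stable {S :: (complex \<times> complex) set. closed S}"
    by (auto simp: Int_stable_def)
  moreover have "{S :: (complex \<times> complex) set. closed S} \<subseteq> Pow UNIV" by simp
  moreover have "A \<in> sigma_sets UNIV {S. closed S}"
    using assms by (simp add: borel_eq_closed)
  ultimately show ?thesis
  proof (induction rule: sigma_sets_induct_disjoint)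
    case empty
    then show ?case using trig_approx_trigp[OF trigp_const[of 0]] by simp
  next
    case (compl A)
    have "trig_approx (\<lambda>x. 1 + (-1) * indicator A (circ x))"
      by (intro trig_approx_add trig_approx_cmult trig_approx_trigp[OF trigp_const] compl)
    then show ?case by (simp add: indicator_diff)
  next
    case (union A)
    have A[measurable]: "A i \<in> sets borel" for i
      using union by (auto simp: borel_eq_closed)
    have [measurable]: "(\<Union>i. A i) \<in> sets borel" by (intro sets.countable_UN) auto
    have S: "trig_approx (\<lambda>x. \<Sum>i<n. indicator (A i) (circ x))" for n
    proof (induction n)
      case 0 then show ?case using trig_approx_trigp[OF trigp_const[of 0]] by simp
    next
      case (Suc n) then show ?case using union by (simp add: trig_approx_add)
    qed
    have eq: "(\<Sum>i<n. indicator (A i) z) = (indicator (\<Union>i<n. A i) z :: complex)" for n z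
      using union(1) by (subst indicator_UN_disjoint) (auto simp: disjoint_family_on_def)
    show ?case
    proof (rule trig_approx_limit[where s="\<lambda>n x. \<Sum>i<n. indicator (A i) (circ x)" and w="\<lambda>_. 1"])
      show "AE x in torus. (\<lambda>n. \<Sum>i<n. indicator (A i) (circ x)) \<longlonglongrightarrow> (indicator (\<Union>i. A i) (circ x) :: complex)"
        unfolding eq by (intro AE_I2 LIMSEQ_indicator_UN)
      show "AE x in torus. cmod (\<Sum>i<n. indicator (A i) (circ x)) \<le> 1" for n
        unfolding eq by (simp add: indicator_def)
      show "trig_approx (\<lambda>x. \<Sum>i<n. indicator (A i) (circ x))" for n by (rule S)
    qed (auto simp: emeasure_torus)
  qed (auto simp: trig_approx_closed)
qed

lemma Arg2pi_measurable [measurable]: "Arg2pi \<in> borel_measurable borel"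
  by (rule borel_measurable_iff_greater[THEN iffD2]) (simp add: open_Arg2pi2pi_gt)

text \<open>On the cube the map \<open>circ\<close> is inverted by the two normalized arguments, so
  a Borel set of the plane agrees there with the pullback of a Borel set of pairs of complex
  numbers.\<close>

lemma trig_approx_indicator:
  assumes [measurable]: "B \<in> sets borel"
  shows "trig_approx (indicator B)"
proof -
  define h :: "complex \<times> complex \<Rightarrow> real^2" where
    "h z = vec2 (Arg2pi (fst z) / (2*pi), Arg2pi (snd z) / (2*pi))" for z
  have [measurable]: "h \<in> borel_measurable borel"
    unfolding h_def[abs_def] borel_prod[symmetric] by measurable
  have hc: "h (circ x) = x" if "x \<in> unit_cube" for x
  proof -
    have "Arg2pi (cis (2 * pi * t)) = 2 * pi * t" if "0 \<le> t" "t < 1" for t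
      using that Arg2pi_exp[of "\<i> * complex_of_real (2 * pi * t)"] by (simp add: cis_conv_exp)
    then show ?thesis using that by (simp add: h_def circ_def unit_cube_eq vec_eq_iff forall_2)
  qed
  have "h -` B \<in> sets borel"
    using measurable_sets[of h borel borel B] by simp
  then have A: "trig_approx (\<lambda>x. indicator (h -` B) (circ x))"
    by (rule trig_approx_borel)
  show ?thesis
  \<comment> \<open>The sequence is constant: the limit lemma is used here to replace a function by
    one that equals it almost everywhere on the torus.\<close>
  proof (rule trig_approx_limit[where s="\<lambda>n x. indicator (h -` B) (circ x)" and w="\<lambda>_. 1"])
    show "AE x in torus. (\<lambda>n::nat. indicator (h -` B) (circ x)) \<longlonglongrightarrow> (indicator B x :: complex)"
      by (rule AE_torus) (simp add: indicator_def hc)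
  qed (use A in \<open>auto simp: emeasure_torus indicator_def\<close>)
qed

lemma trig_approx_L2:
  assumes [measurable]: "u \<in> borel_measurable borel"
    and fin: "sqint torus u < \<infinity>"
  shows "trig_approx u"
proof -
  obtain s where s: "\<And>i. simple_function borel (s i)" "\<And>x. (\<lambda>i. s i x) \<longlonglongrightarrow> u x"
    "\<And>i x. cmod (s i x) \<le> 2 * cmod (u x)"
    using borel_measurable_implies_sequence_metric[of u borel 0] by (auto simp: dist_norm)
  have S: "trig_approx (s i)" for i
  proof -
    have fin: "finite (range (s i))" and m: "\<And>y. s i -` {y} \<in> sets borel"
      using simple_functionD[OF s(1)[of i]] by auto
    have eq: "s i = (\<lambda>x. \<Sum>y\<in>range (s i). y * indicator (s i -` {y}) x)"
    proof
      fix x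
      have "(\<Sum>y\<in>range (s i). y * indicator (s i -` {y}) x) = (\<Sum>y\<in>range (s i). if y = s i x then y else 0)"
        by (intro sum.cong) (auto simp: indicator_def)
      then show "s i x = (\<Sum>y\<in>range (s i). y * indicator (s i -` {y}) x)"
        using fin by simp
    qed
    have "trig_approx (\<lambda>x. \<Sum>y\<in>Y. y * indicator (s i -` {y}) x)" if "finite Y" for Y
      using that
    proof induction
      case empty then show ?case using trig_approx_trigp[OF trigp_const[of 0]] by simp
    next
      case (insert y Y)
      show ?case
        unfolding sum.insert[OF insert.hyps]
        by (intro trig_approx_add trig_approx_cmult trig_approx_indicator m insert.IH)
    qed
    from this[OF fin] show ?thesis by (subst eq)
  qed
  show ?thesis
  proof (rule trig_approx_limit[where s=s and w="\<lambda>x. 2 * cmod (u x)"])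
    show "(\<integral>\<^sup>+ x. ennreal ((2 * cmod (u x))\<^sup>2) \<partial>torus) < \<infinity>"
      using fin by (simp add: power_mult_distrib ennreal_mult nn_integral_cmult ennreal_mult_less_top)
  qed (auto simp: S s)
qed

section \<open>Orthonormality of the characters and Parseval's identity on the torus\<close>

lemma integral_torus:
  fixes f :: "real^2 \<Rightarrow> complex"
  assumes [measurable]: "f \<in> borel_measurable borel"
  shows "(\<integral>x. f x \<partial>torus) = (\<integral>x. indicator unit_cube x *\<^sub>R f x \<partial>lborel)"
  unfolding torus_def
  by (subst integral_density[where g="indicator unit_cube", symmetric]) (auto simp: ennreal_indicator)

lemma cnj_measurable [measurable]: "cnj \<in> borel_measurable borel"
  by (intro borel_measurable_continuous_onI continuous_intros)

lemma cis_measurable [measurable]: "cis \<in> borel_measurable borel"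
  by (intro borel_measurable_continuous_onI continuous_intros)

lemma integral_cis_unit:
  "(\<integral>t. indicator {0..<1} t *\<^sub>R cis (2 * pi * (of_int k * t)) \<partial>lborel) = (if k = 0 then 1 else 0)"
proof -
  \<comment> \<open>Adding the right endpoint, a null set, makes the fundamental theorem of calculus
    on a compact interval applicable.\<close>
  have "(\<integral>t. indicator {0..<1} t *\<^sub>R cis (2 * pi * (of_int k * t)) \<partial>lborel) =
      (\<integral>t. indicator {0..1} t *\<^sub>R cis (2 * pi * (of_int k * t)) \<partial>lborel)"
  proof (rule integral_cong_AE)
    show "AE t in lborel. indicator {0..<1} t *\<^sub>R cis (2 * pi * (of_int k * t)) = indicator {0..1} t *\<^sub>R cis (2 * pi * (of_int k * t))"
      using AE_lborel_singleton[of 1] by eventually_elim (auto simp: indicator_def)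
    show "(\<lambda>t. indicator {0..<1} t *\<^sub>R cis (2 * pi * (of_int k * t))) \<in> borel_measurable lborel"
      "(\<lambda>t. indicator {0..1} t *\<^sub>R cis (2 * pi * (of_int k * t))) \<in> borel_measurable lborel"
      by measurable
  qed
  also have "\<dots> = (if k = 0 then 1 else 0)"
  proof (cases "k = 0")
    case True
    then show ?thesis by (simp add: cis_zero)
  next
    case False
    define F where "F t = cis (2 * pi * (of_int k * t)) / (\<i> * of_real (2 * pi * of_int k))" for t
    have ne: "(\<i> * of_real (2 * pi * of_int k)) \<noteq> (0::complex)" using False by simp
    have eq: "cis (2 * pi * (of_int k * t)) = exp ((\<i> * of_real (2 * pi * of_int k)) * of_real t)" for t
      by (simp add: cis_conv_exp mult_ac)
    have "(F has_vector_derivative cis (2 * pi * (of_int k * t))) (at t within {0..1})" for t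
    proof -
      have "((\<lambda>z. exp ((\<i> * of_real (2 * pi * of_int k)) * z) / (\<i> * of_real (2 * pi * of_int k))) has_field_derivative
         exp ((\<i> * of_real (2 * pi * of_int k)) * of_real t)) (at (of_real t))"
        by (rule derivative_eq_intros refl | use ne in simp)+
      from has_vector_derivative_real_field[OF this] show ?thesis
        unfolding F_def[abs_def] eq .
    qed
    then have "(\<integral>t. indicator {0..1} t *\<^sub>R cis (2 * pi * (of_int k * t)) \<partial>lborel) = F 1 - F 0"
      by (intro integral_FTC_atLeastAtMost continuous_intros) auto
    also have "cis (2 * pi * of_int k) = 1"
      by (rule cis_multiple_2pi) simp
    then have "F 1 - F 0 = 0" by (simp add: F_def)
    finally show ?thesis using False by simp
  qed
  finally show ?thesis .
qed

lemma integral_chr: "(\<integral>x. chr m x \<partial>torus) = (if m = 0 then 1 else 0)"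
proof -
  have eq: "indicator unit_cube x *\<^sub>R chr m x = (indicator {0..<1} (x$1) *\<^sub>R cis (2 * pi * (of_int (m$1) * x$1))) *
    (indicator {0..<1} (x$2) *\<^sub>R cis (2 * pi * (of_int (m$2) * x$2)))" for x
    by (auto simp: unit_cube_eq indicator_def chr_def inner_2 cis_mult distrib_left)
  have int: "integrable lborel (\<lambda>t. indicator {0..<1} t *\<^sub>R cis (2 * pi * (of_int k * t)))" for k
  proof (rule integrableI_bounded)
    have "(\<integral>\<^sup>+t. ennreal (cmod (indicator {0..<1} t *\<^sub>R cis (2 * pi * (of_int k * t)))) \<partial>lborel) = (\<integral>\<^sup>+t. indicator {0..<1::real} t \<partial>lborel)"
      by (intro nn_integral_cong) (auto simp: indicator_def)
    then show "(\<integral>\<^sup>+t. ennreal (cmod (indicator {0..<1} t *\<^sub>R cis (2 * pi * (of_int k * t)))) \<partial>lborel) < \<infinity>"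
      by simp
  qed measurable
  show ?thesis
    unfolding integral_torus[OF chr_measurable] eq
    by (subst integral_tensor[OF int int])
       (auto simp: integral_cis_unit vec_eq_iff forall_2)
qed

lemma cmod_le_1_plus_sq: "cmod z \<le> 1 + (cmod z)\<^sup>2"
proof -
  have "2 * cmod z \<le> 1 + (cmod z)\<^sup>2"
    using sum_squares_bound[of "cmod z" 1] by simp
  then show ?thesis using norm_ge_zero[of z] by linarith
qed

lemma integrable_torus_L2:
  assumes [measurable]: "u \<in> borel_measurable borel"
    and fin: "sqint torus u < \<infinity>"
  shows "integrable torus u"
proof (rule integrableI_bounded)
  have "(\<integral>\<^sup>+x. ennreal (cmod (u x)) \<partial>torus) \<le> (\<integral>\<^sup>+x. 1 + nsq (u x) \<partial>torus)"
  proof (rule nn_integral_mono)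
    fix x
    have "ennreal (cmod (u x)) \<le> ennreal (1 + (cmod (u x))\<^sup>2)"
      by (intro ennreal_leI cmod_le_1_plus_sq)
    then show "ennreal (cmod (u x)) \<le> 1 + nsq (u x)" by simp
  qed
  also have "\<dots> = 1 + sqint torus u"
    by (subst nn_integral_add) (auto simp: emeasure_torus)
  also have "\<dots> < \<infinity>" using fin by simp
  finally show "(\<integral>\<^sup>+x. ennreal (cmod (u x)) \<partial>torus) < \<infinity>" .
qed simp

definition fcoef :: "(real^2 \<Rightarrow> complex) \<Rightarrow> int^2 \<Rightarrow> complex"
  where "fcoef u m = (\<integral>x. u x * cnj (chr m x) \<partial>torus)"

lemma integrable_mult_chr:
  assumes "integrable torus u"
  shows "integrable torus (\<lambda>x. u x * cnj (chr m x))"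
proof (rule Bochner_Integration.integrable_bound[OF assms])
  show "(\<lambda>x. u x * cnj (chr m x)) \<in> borel_measurable torus"
    using borel_measurable_integrable[OF assms] by measurable
qed (simp add: norm_mult)

lemma integrable_chr: "integrable torus (chr m)"
  using finite_measure.integrable_const_bound[OF finite_measure_torus, of "chr m" 1] by simp

text \<open>Completing the square in the coefficients: the distance is the Bessel remainder plus the
  squared error of the coefficients. The choice \<open>a = fcoef u\<close> gives Bessel's
  inequality, and any good approximation bounds the remainder. Nonnegativity is recorded separately
  because \<open>ennreal\<close> would truncate a negative value to 0.\<close>

lemma sqdist_trig_poly:
  assumes [measurable]: "u \<in> borel_measurable borel"
    and fin: "sqint torus u < \<infinity>"
    and N: "finite N"
  shows "sqdist torus u (\<lambda>x. \<Sum>m\<in>N. a m * chr m x) =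
    ennreal ((\<integral>x. (cmod (u x))\<^sup>2 \<partial>torus) - (\<Sum>m\<in>N. (cmod (fcoef u m))\<^sup>2) + (\<Sum>m\<in>N. (cmod (fcoef u m - a m))\<^sup>2))" (is ?eq)
    and "0 \<le> (\<integral>x. (cmod (u x))\<^sup>2 \<partial>torus) - (\<Sum>m\<in>N. (cmod (fcoef u m))\<^sup>2) + (\<Sum>m\<in>N. (cmod (fcoef u m - a m))\<^sup>2)" (is ?nonneg)
proof -
  define p where "p x = (\<Sum>m\<in>N. a m * chr m x)" for x
  have [measurable]: "p \<in> borel_measurable borel" unfolding p_def[abs_def] by measurable
  have iu: "integrable torus u" by (rule integrable_torus_L2[OF _ fin]) simp
  have iu2: "integrable torus (\<lambda>x. (cmod (u x))\<^sup>2)"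
    using fin by (intro integrableI_bounded) auto
  have e1: "u x * cnj (p x) = (\<Sum>m\<in>N. cnj (a m) * (u x * cnj (chr m x)))" for x
    by (simp add: p_def sum_distrib_left ac_simps)
  have i1: "integrable torus (\<lambda>x. u x * cnj (p x))"
    unfolding e1 by (intro Bochner_Integration.integrable_sum integrable_mult_right integrable_mult_chr iu)
  have v1: "(\<integral>x. u x * cnj (p x) \<partial>torus) = (\<Sum>m\<in>N. cnj (a m) * fcoef u m)"
    unfolding e1 fcoef_def
    by (subst Bochner_Integration.integral_sum) (auto intro!: integrable_mult_chr iu)
  have e2: "p x * cnj (p x) = (\<Sum>m\<in>N. \<Sum>n\<in>N. a m * cnj (a n) * chr (m - n) x)" for x
    using chr_add[of _ "- _"] chr_minus
    by (simp add: p_def sum_product ac_simps diff_conv_add_uminus del: add_uminus_conv_diff)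
  have i2: "integrable torus (\<lambda>x. p x * cnj (p x))"
    unfolding e2 by (intro Bochner_Integration.integrable_sum integrable_mult_right integrable_chr)
  have v2: "(\<integral>x. p x * cnj (p x) \<partial>torus) = (\<Sum>m\<in>N. a m * cnj (a m))"
  proof -
    have "(\<integral>x. p x * cnj (p x) \<partial>torus) = (\<Sum>m\<in>N. \<Sum>n\<in>N. a m * cnj (a n) * (if m - n = 0 then 1 else 0))"
      unfolding e2
      by (subst Bochner_Integration.integral_sum, intro Bochner_Integration.integrable_sum integrable_mult_right integrable_chr,
          subst Bochner_Integration.integral_sum, intro integrable_mult_right integrable_chr)
         (simp add: integral_chr)
    also have "\<dots> = (\<Sum>m\<in>N. a m * cnj (a m))"
      using N by (intro sum.cong refl) (simp add: if_distrib cong: if_cong)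
    finally show ?thesis .
  qed
  have pt: "(cmod (u x - p x))\<^sup>2 = (cmod (u x))\<^sup>2 - 2 * Re (u x * cnj (p x)) + Re (p x * cnj (p x))" for x
    unfolding cmod_power2 by (simp add: power2_eq_square algebra_simps)
  have "integrable torus (\<lambda>x. (cmod (u x - p x))\<^sup>2)"
    unfolding pt using iu2 i1 i2
    by (intro Bochner_Integration.integrable_add Bochner_Integration.integrable_diff integrable_mult_right integrable_Re)
  then have "sqdist torus u p = ennreal (\<integral>x. (cmod (u x - p x))\<^sup>2 \<partial>torus)"
    unfolding sqdist_def by (intro nn_integral_eq_integral) auto
  moreover have val: "(\<integral>x. (cmod (u x - p x))\<^sup>2 \<partial>torus) = (\<integral>x. (cmod (u x))\<^sup>2 \<partial>torus) - (\<Sum>m\<in>N. (cmod (fcoef u m))\<^sup>2) + (\<Sum>m\<in>N. (cmod (fcoef u m - a m))\<^sup>2)"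
  proof -
    have *: "(\<integral>x. U x - 2 * Re (f x) + Re (g x) \<partial>torus) = (\<integral>x. U x \<partial>torus) - 2 * Re (\<integral>x. f x \<partial>torus) + Re (\<integral>x. g x \<partial>torus)"
      if "integrable torus U" "integrable torus f" "integrable torus g" for U and f g :: "real^2 \<Rightarrow> complex"
      using that by (simp add: integrable_Re)
    have "(\<integral>x. (cmod (u x - p x))\<^sup>2 \<partial>torus) = (\<integral>x. (cmod (u x))\<^sup>2 \<partial>torus) - 2 * Re (\<Sum>m\<in>N. cnj (a m) * fcoef u m)
       + Re (\<Sum>m\<in>N. a m * cnj (a m))"
      unfolding pt v1[symmetric] v2[symmetric] by (rule *[OF iu2 i1 i2])
    also have "\<dots> = (\<integral>x. (cmod (u x))\<^sup>2 \<partial>torus) - (\<Sum>m\<in>N. (cmod (fcoef u m))\<^sup>2) + (\<Sum>m\<in>N. (cmod (fcoef u m - a m))\<^sup>2)"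
    proof -
      have "(cmod (fcoef u m - a m))\<^sup>2 - (cmod (fcoef u m))\<^sup>2 = Re (a m * cnj (a m)) - 2 * Re (cnj (a m) * fcoef u m)" for m
        unfolding cmod_power2 by (simp add: power2_eq_square algebra_simps)
      then have "(\<Sum>m\<in>N. (cmod (fcoef u m - a m))\<^sup>2) - (\<Sum>m\<in>N. (cmod (fcoef u m))\<^sup>2) =
        Re (\<Sum>m\<in>N. a m * cnj (a m)) - 2 * Re (\<Sum>m\<in>N. cnj (a m) * fcoef u m)"
        by (simp add: sum_subtractf[symmetric] sum_distrib_left Re_sum del: cnj.sel times_complex.sel)
      then show ?thesis by linarith
    qed
    finally show ?thesis .
  qed
  ultimately show ?eq unfolding p_def by simp
  show ?nonneg unfolding val[symmetric] by simp
qed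

text \<open>A bridge through absolute summability: the estimates live in \<open>ennreal\<close>, the
  definition of a frame in real infinite sums.\<close>

lemma nn_integral_count_space_infsum:
  assumes "r summable_on A" "\<And>i. i \<in> A \<Longrightarrow> r i \<ge> 0"
  shows "(\<integral>\<^sup>+i. ennreal (r i) \<partial>count_space A) = ennreal (infsum r A)"
proof -
  have "Infinite_Set_Sum.abs_summable_on r A"
    using assms summable_on_iff_abs_summable_on_real abs_summable_equivalent by blast
  then show ?thesis
    using nn_integral_conv_infsetsum[of r A] assms by (simp add: infsetsum_infsum)
qed

lemma summable_on_nn_integral_count_space:
  assumes "(\<integral>\<^sup>+i. ennreal (r i) \<partial>count_space A) < \<infinity>" "\<And>i. i \<in> A \<Longrightarrow> r i \<ge> (0::real)"
  shows "r summable_on A"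
proof -
  have "Infinite_Set_Sum.abs_summable_on r A"
    unfolding Infinite_Set_Sum.abs_summable_on_def
    using assms by (intro integrableI_bounded) (auto cong: nn_integral_cong_simp)
  then show ?thesis
    using assms summable_on_iff_abs_summable_on_real abs_summable_equivalent by blast
qed

text \<open>Bessel's inequality gives one direction. For the other, density supplies a trigonometric
  polynomial within \<open>\<epsilon>\<close>, and dropping its nonnegative coefficient error leaves
  a bound for the remainder.\<close>

theorem parseval_torus:
  assumes [measurable]: "u \<in> borel_measurable borel"
    and fin: "sqint torus u < \<infinity>"
  shows "(\<Sum>\<^sup>+m. nsq (fcoef u m)) = sqint torus u"
proof -
  define I where "I = (\<integral>x. (cmod (u x))\<^sup>2 \<partial>torus)"
  define r where "r m = (cmod (fcoef u m))\<^sup>2" for m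
  have "integrable torus (\<lambda>x. (cmod (u x))\<^sup>2)"
    using fin by (intro integrableI_bounded) auto
  then have I: "sqint torus u = ennreal I"
    unfolding I_def by (intro nn_integral_eq_integral) auto
  have bessel: "sum r N \<le> I" if N: "finite N" for N
    using sqdist_trig_poly(2)[OF assms N, of "fcoef u"] by (simp add: I_def r_def)
  have sm: "r summable_on UNIV"
    using bessel by (intro nonneg_bdd_above_summable_on bdd_aboveI[of _ I]) (auto simp: r_def)
  have "infsum r UNIV = I"
  proof (rule antisym)
    show "infsum r UNIV \<le> I"
      using bessel by (intro infsum_le_finite_sums sm)
    show "I \<le> infsum r UNIV"
    proof (rule field_le_epsilon)
      fix \<epsilon> :: real assume "\<epsilon> > 0"
      then obtain p where p: "trigp p" "sqdist torus u p \<le> ennreal \<epsilon>"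
        using trig_approx_L2[OF assms] by (auto simp: trig_approx_def)
      obtain N a where N: "finite N" "p = (\<lambda>x. \<Sum>m\<in>N. a m * chr m x)"
        using trigp_repr[OF p(1)] .
      have "I - sum r N \<le> \<epsilon>"
      proof -
        have "ennreal (I - sum r N + (\<Sum>m\<in>N. (cmod (fcoef u m - a m))\<^sup>2)) \<le> ennreal \<epsilon>"
          using p(2) unfolding N(2) sqdist_trig_poly[OF assms N(1)] by (simp add: I_def r_def)
        then have "I - sum r N + (\<Sum>m\<in>N. (cmod (fcoef u m - a m))\<^sup>2) \<le> \<epsilon>"
          using \<open>\<epsilon> > 0\<close> by (simp add: ennreal_le_iff)
        moreover have "0 \<le> (\<Sum>m\<in>N. (cmod (fcoef u m - a m))\<^sup>2)" by (intro sum_nonneg) auto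
        ultimately show ?thesis by linarith
      qed
      moreover have "sum r N \<le> infsum r UNIV"
        using N(1) sm by (intro finite_sum_le_infsum) (auto simp: r_def)
      ultimately show "I \<le> infsum r UNIV + \<epsilon>" by linarith
    qed
  qed
  then show ?thesis
    unfolding I using nn_integral_count_space_infsum[OF sm] by (simp add: r_def)
qed

subsection \<open>Periodization and the Plancherel theorem\<close>

lemma ennreal_cmod_integral_le:
  fixes f :: "'a \<Rightarrow> complex"
  shows "ennreal (cmod (\<integral>x. f x \<partial>M)) \<le> (\<integral>\<^sup>+x. ennreal (cmod (f x)) \<partial>M)"
proof (cases "integrable M f")
  case True
  then show ?thesis using integral_norm_bound_ennreal by blast
qed (simp add: not_integrable_integral_eq)

text \<open>Being a Bochner integral over counting measure, the lattice sum takes the value 0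
  wherever it fails to converge absolutely; for integrable \<open>F\<close> such points form a null
  set.\<close>

definition periodization :: "(real^2 \<Rightarrow> complex) \<Rightarrow> real^2 \<Rightarrow> complex"
  where "periodization F x = (\<integral>n. F (x + lattice n) \<partial>count_space UNIV)"

lemma sigma_finite_count_int2: "sigma_finite_measure (count_space (UNIV :: (int^2) set))"
  by (rule sigma_finite_measure_count_space_countable) simp

lemma shift_measurable [measurable]:
  "(\<lambda>p. fst p + lattice (snd p)) \<in> torus \<Otimes>\<^sub>M count_space UNIV \<rightarrow>\<^sub>M borel"
  by measurable

text \<open>The tiling as an identity of measures; complex integrals thereby unfold by Fubini, where
  the version for nonnegative integrals does not suffice.\<close>

lemma lborel_tiling:
  "lborel = distr (torus \<Otimes>\<^sub>M count_space UNIV) borel (\<lambda>p. fst p + lattice (snd p))"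
proof (rule measure_eqI)
  interpret C: sigma_finite_measure "count_space (UNIV :: (int^2) set)" by (rule sigma_finite_count_int2)
  fix A :: "(real^2) set" assume "A \<in> sets lborel"
  then have [measurable]: "A \<in> sets borel" by simp
  have "emeasure lborel A = (\<integral>\<^sup>+x. indicator A x \<partial>lborel)" by simp
  also have "\<dots> = (\<integral>\<^sup>+x. (\<Sum>\<^sup>+m. indicator A (x + lattice m)) \<partial>torus)"
    by (rule nn_integral_tiling) simp
  also have "\<dots> = (\<integral>\<^sup>+p. indicator A (fst p + lattice (snd p)) \<partial>(torus \<Otimes>\<^sub>M count_space UNIV))"
    by (subst C.nn_integral_fst[symmetric]) auto
  also have "\<dots> = (\<integral>\<^sup>+x. indicator A x \<partial>distr (torus \<Otimes>\<^sub>M count_space UNIV) borel (\<lambda>p. fst p + lattice (snd p)))"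
    by (subst nn_integral_distr) auto
  finally show "emeasure lborel A = emeasure (distr (torus \<Otimes>\<^sub>M count_space UNIV) borel (\<lambda>p. fst p + lattice (snd p))) A"
    by simp
qed simp

lemma periodization_measurable [measurable]:
  assumes [measurable]: "F \<in> borel_measurable borel"
  shows "periodization F \<in> borel_measurable borel"
proof -
  interpret C: sigma_finite_measure "count_space (UNIV :: (int^2) set)" by (rule sigma_finite_count_int2)
  show ?thesis unfolding periodization_def[abs_def]
    by (intro C.borel_measurable_lebesgue_integral) measurable
qed

lemma integral_tiling:
  assumes F: "integrable lborel F"
  shows "(\<integral>x. F x \<partial>lborel) = (\<integral>x. periodization F x \<partial>torus)"
proof -
  interpret T: sigma_finite_measure torus
    using finite_measure_torus by (rule finite_measure.axioms)
  interpret C: sigma_finite_measure "count_space (UNIV :: (int^2) set)" by (rule sigma_finite_count_int2)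
  interpret P: pair_sigma_finite torus "count_space (UNIV :: (int^2) set)" ..
  have [measurable]: "F \<in> borel_measurable borel" using borel_measurable_integrable[OF F] by simp
  have i: "integrable (torus \<Otimes>\<^sub>M count_space UNIV) (\<lambda>p. F (fst p + lattice (snd p)))"
    using F by (subst (asm) lborel_tiling, subst (asm) integrable_distr_eq) auto
  have "(\<integral>x. F x \<partial>lborel) = (\<integral>p. F (fst p + lattice (snd p)) \<partial>(torus \<Otimes>\<^sub>M count_space UNIV))"
    by (subst lborel_tiling, subst integral_distr) auto
  also have "\<dots> = (\<integral>x. periodization F x \<partial>torus)"
    using P.integral_fst[of "\<lambda>x n. F (x + lattice n)"] i by (simp add: periodization_def case_prod_beta')
  finally show ?thesis .
qed

text \<open>Characters are invariant under integer translations, so they pass inside the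
  periodization and the integral over the cell unfolds to the plane.\<close>

lemma fcoef_periodization:
  assumes F: "integrable lborel F"
  shows "fcoef (periodization F) m = (\<integral>x. F x * cnj (chr m x) \<partial>lborel)"
proof -
  have [measurable]: "F \<in> borel_measurable borel" using borel_measurable_integrable[OF F] by simp
  have "integrable lborel (\<lambda>x. F x * cnj (chr m x))"
    by (rule Bochner_Integration.integrable_bound[OF F]) (auto simp: norm_mult)
  from integral_tiling[OF this] show ?thesis
    by (simp add: fcoef_def periodization_def chr_translate)
qed

theorem parseval_periodization:
  assumes F: "integrable lborel F"
    and fin: "(\<integral>\<^sup>+x. nsq (periodization F x) \<partial>torus) < \<infinity>"
  shows "(\<Sum>\<^sup>+m. nsq (\<integral>x. F x * cnj (chr m x) \<partial>lborel)) =
    (\<integral>\<^sup>+x. nsq (periodization F x) \<partial>torus)"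
proof -
  have [measurable]: "F \<in> borel_measurable borel" using borel_measurable_integrable[OF F] by simp
  show ?thesis
    using parseval_torus[OF _ fin] by (simp add: fcoef_periodization[OF F])
qed

section \<open>L2 functions on the plane and the Fourier transform for bounded support\<close>

lemma nn_integral_scale:
  fixes f :: "real^2 \<Rightarrow> ennreal"
  assumes "T > 0" and [measurable]: "f \<in> borel_measurable borel"
  shows "(\<integral>\<^sup>+x. f x \<partial>lborel) = ennreal (T\<^sup>2) * (\<integral>\<^sup>+x. f (T *\<^sub>R x) \<partial>lborel)"
  using assms(1)
  by (subst lborel_affine[of T 0]) (simp_all add: nn_integral_density nn_integral_distr nn_integral_cmult)

lemma integral_scale:
  fixes f :: "real^2 \<Rightarrow> complex"
  assumes "T > 0" and [measurable]: "f \<in> borel_measurable borel"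
  shows "(\<integral>x. f x \<partial>lborel) = T\<^sup>2 *\<^sub>R (\<integral>x. f (T *\<^sub>R x) \<partial>lborel)"
  using assms(1)
  by (subst lborel_affine[of T 0]) (simp_all add: integral_density integral_distr)

lemma L2_iff: "f \<in> L2 \<longleftrightarrow> f \<in> borel_measurable borel \<and> sqint lborel f < \<infinity>"
  by (auto simp: L2_def integrable_iff_bounded)

lemma L2_measurable: "f \<in> L2 \<Longrightarrow> f \<in> borel_measurable borel"
  by (simp add: L2_iff)

lemma sqint_add_le:
  assumes [measurable]: "f \<in> borel_measurable M" "g \<in> borel_measurable M"
  shows "(\<integral>\<^sup>+x. nsq (f x + g x) \<partial>M) \<le>
    2 * sqint M f + 2 * sqint M g"
  using sqdist_add_le[of f M g "\<lambda>_. 0" "\<lambda>_. 0"] by (simp add: sqdist_def)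

lemma L2_add: "f \<in> L2 \<Longrightarrow> g \<in> L2 \<Longrightarrow> (\<lambda>x. f x + g x) \<in> L2"
  unfolding L2_iff using sqint_add_le[of f lborel g]
  by (auto simp: ennreal_mult_less_top intro: le_less_trans)

lemma L2_cmult: "f \<in> L2 \<Longrightarrow> (\<lambda>x. a * f x) \<in> L2"
  unfolding L2_iff by (auto simp: norm_mult power_mult_distrib ennreal_mult nn_integral_cmult ennreal_mult_less_top)

lemma L2_diff: "f \<in> L2 \<Longrightarrow> g \<in> L2 \<Longrightarrow> (\<lambda>x. f x - g x) \<in> L2"
  using L2_add[OF _ L2_cmult[of g "-1"], of f] by simp

lemma L2_bound:
  assumes "g \<in> L2" "f \<in> borel_measurable borel" "\<And>x. cmod (f x) \<le> cmod (g x)"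
  shows "f \<in> L2"
proof -
  have "sqint lborel f \<le> sqint lborel g"
    using assms(3) by (intro nn_integral_mono ennreal_leI power_mono) auto
  then show ?thesis using assms by (auto simp: L2_iff)
qed

lemma cauchy_schwarz_L2:
  assumes [measurable]: "f \<in> borel_measurable M" "g \<in> borel_measurable M"
  shows "(\<integral>\<^sup>+x. ennreal (cmod (f x * cnj (g x))) \<partial>M)\<^sup>2 \<le>
    sqint M f * sqint M g"
  using Cauchy_Schwarz_nn_integral[of "\<lambda>x. ennreal (cmod (f x))" M "\<lambda>x. ennreal (cmod (g x))"]
  by (simp add: norm_mult ennreal_mult ennreal_power)

lemma integrable_L2_mult:
  assumes "f \<in> L2" "g \<in> L2"
  shows "integrable lborel (\<lambda>x. f x * cnj (g x))"
proof (rule integrableI_bounded)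
  have [measurable]: "f \<in> borel_measurable borel" "g \<in> borel_measurable borel"
    using assms by (auto simp: L2_iff)
  show "(\<lambda>x. f x * cnj (g x)) \<in> borel_measurable lborel" by measurable
  have "(\<integral>\<^sup>+x. ennreal (cmod (f x * cnj (g x))) \<partial>lborel)\<^sup>2 < \<infinity>"
    using le_less_trans[OF cauchy_schwarz_L2[of f lborel g]] assms by (auto simp: L2_iff ennreal_mult_less_top)
  then show "(\<integral>\<^sup>+x. ennreal (cmod (f x * cnj (g x))) \<partial>lborel) < \<infinity>"
    by (auto simp: power2_eq_square ennreal_mult_less_top)
qed

text \<open>Recovers inner products from norms, so that Plancherel's identity upgrades to
  Parseval's.\<close>

lemma integral_polarization:
  assumes "f \<in> L2" "g \<in> L2"
  shows "4 * (\<integral>x. f x * cnj (g x) \<partial>lborel) = of_real (\<integral>x. (cmod (f x + g x))\<^sup>2 \<partial>lborel) - of_real (\<integral>x. (cmod (f x - g x))\<^sup>2 \<partial>lborel)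
    + \<i> * of_real (\<integral>x. (cmod (f x + \<i> * g x))\<^sup>2 \<partial>lborel) - \<i> * of_real (\<integral>x. (cmod (f x - \<i> * g x))\<^sup>2 \<partial>lborel)"
proof -
  have i: "integrable lborel (\<lambda>x. (cmod (f x + g x))\<^sup>2)" "integrable lborel (\<lambda>x. (cmod (f x - g x))\<^sup>2)"
    "integrable lborel (\<lambda>x. (cmod (f x + \<i> * g x))\<^sup>2)" "integrable lborel (\<lambda>x. (cmod (f x - \<i> * g x))\<^sup>2)"
    using L2_add[OF assms] L2_diff[OF assms] L2_add[OF assms(1) L2_cmult[OF assms(2), of \<i>]]
      L2_diff[OF assms(1) L2_cmult[OF assms(2), of \<i>]] by (auto simp: L2_def)
  have pt: "f x * cnj (g x) = (of_real ((cmod (f x + g x))\<^sup>2) - of_real ((cmod (f x - g x))\<^sup>2)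
    + \<i> * of_real ((cmod (f x + \<i> * g x))\<^sup>2) - \<i> * of_real ((cmod (f x - \<i> * g x))\<^sup>2)) / 4" for x
    by (simp add: complex_eq_iff cmod_power2) (simp add: power2_eq_square algebra_simps)
  show ?thesis
    unfolding pt using i by (simp add: integrable_of_real del: of_real_power)
qed

text \<open>A dense class, stable under affine maps, whose members are integrable: on it the
  transform is an honest integral, and no smoothness is asked for.\<close>

definition compact_L2 :: "(real^2 \<Rightarrow> complex) \<Rightarrow> bool"
  where "compact_L2 f \<longleftrightarrow> f \<in> L2 \<and> (\<exists>R\<ge>0. \<forall>x. f x \<noteq> 0 \<longrightarrow> norm x \<le> R)"

lemma compact_L2_add: "compact_L2 f \<Longrightarrow> compact_L2 g \<Longrightarrow> compact_L2 (\<lambda>x. f x + g x)"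
  unfolding compact_L2_def
proof (elim conjE exE, intro conjI L2_add)
  fix R S assume "R \<ge> 0" "\<forall>x. f x \<noteq> 0 \<longrightarrow> norm x \<le> R" "S \<ge> 0" "\<forall>x. g x \<noteq> 0 \<longrightarrow> norm x \<le> S"
  then show "\<exists>R\<ge>0. \<forall>x. f x + g x \<noteq> 0 \<longrightarrow> norm x \<le> R"
    by (intro exI[of _ "max R S"]) (metis add_0 le_max_iff_disj)
qed auto

lemma compact_L2_cmult: "compact_L2 f \<Longrightarrow> compact_L2 (\<lambda>x. a * f x)"
  unfolding compact_L2_def using L2_cmult by auto

lemma integrable_L2_bounded_support:
  fixes f :: "'a::euclidean_space \<Rightarrow> complex"
  assumes f: "f \<in> L2" and R: "\<And>x. f x \<noteq> 0 \<Longrightarrow> norm x \<le> R"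
  shows "integrable lborel f"
proof -
  have "integrable lborel (\<lambda>x. indicator (cball 0 R) x + (cmod (f x))\<^sup>2)"
    using f by (intro Bochner_Integration.integrable_add integrable_real_indicator emeasure_bounded_finite)
      (auto simp: L2_def)
  then show ?thesis
  proof (rule Bochner_Integration.integrable_bound)
    show "AE x in lborel. cmod (f x) \<le> norm (indicator (cball 0 R) x + (cmod (f x))\<^sup>2)"
    proof (rule AE_I2)
      fix x
      show "cmod (f x) \<le> norm (indicator (cball 0 R) x + (cmod (f x))\<^sup>2)"
        using R[of x] cmod_le_1_plus_sq[of "f x"] by (cases "f x = 0") (auto simp: indicator_def)
    qed
  qed (use f in \<open>simp add: L2_iff\<close>)
qed

lemma compact_L2_integrable: "compact_L2 f \<Longrightarrow> integrable lborel f"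
  unfolding compact_L2_def using integrable_L2_bounded_support by blast

definition ft :: "(real^2 \<Rightarrow> complex) \<Rightarrow> real^2 \<Rightarrow> complex"
  where "ft f \<xi> = (\<integral>x. f x * cis (- (2 * pi * (x \<bullet> \<xi>))) \<partial>lborel)"

lemma ft_measurable [measurable]:
  assumes [measurable]: "f \<in> borel_measurable borel"
  shows "ft f \<in> borel_measurable borel"
  unfolding ft_def[abs_def] by (intro lborel.borel_measurable_lebesgue_integral) measurable

lemma integrable_mult_cis:
  assumes "integrable lborel f" and [measurable]: "h \<in> borel_measurable borel"
  shows "integrable lborel (\<lambda>x. f x * cis (h x))"
proof (rule Bochner_Integration.integrable_bound[OF assms(1)])
  have [measurable]: "f \<in> borel_measurable lborel" using assms by auto
  show "(\<lambda>x. f x * cis (h x)) \<in> borel_measurable lborel" by measurable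
qed (simp add: norm_mult)

lemma ft_add:
  assumes "integrable lborel f" "integrable lborel g"
  shows "ft (\<lambda>x. f x + g x) \<xi> = ft f \<xi> + ft g \<xi>"
  using integrable_mult_cis[OF assms(1)] integrable_mult_cis[OF assms(2)]
  by (simp add: ft_def distrib_right)

lemma ft_cmult: "ft (\<lambda>x. a * f x) \<xi> = a * ft f \<xi>"
  by (simp add: ft_def mult.assoc)

text \<open>At most one term of the lattice sum is nonzero at any point, so the square of the sum is
  the sum of the squares.\<close>

lemma nn_integral_periodization_disjoint:
  assumes [measurable]: "F \<in> borel_measurable borel"
    and disj: "\<And>x n n'. F (x + lattice n) \<noteq> 0 \<Longrightarrow> F (x + lattice n') \<noteq> 0 \<Longrightarrow> n = n'"
  shows "(\<integral>\<^sup>+x. nsq (periodization F x) \<partial>torus) = sqint lborel F"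
proof -
  have "nsq (periodization F x) = (\<Sum>\<^sup>+n. nsq (F (x + lattice n)))" for x
  proof (cases "\<exists>n. F (x + lattice n) \<noteq> 0")
    case True
    then obtain n0 where n0: "F (x + lattice n0) \<noteq> 0" by blast
    have z: "F (x + lattice n) = 0" if "n \<noteq> n0" for n using disj[OF n0, of n] that by blast
    have "periodization F x = F (x + lattice n0)"
    proof -
      have s: "{n. F (x + lattice n) \<noteq> 0} = {n0}" using n0 z by blast
      show ?thesis unfolding periodization_def
        by (subst lebesgue_integral_count_space_finite_support) (auto simp: s)
    qed
    moreover have "(\<Sum>\<^sup>+n. nsq (F (x + lattice n))) = nsq (F (x + lattice n0))"
      by (subst nn_integral_count_space'[of "{n0}"]) (auto simp: z)
    ultimately show ?thesis by simp
  qed (simp add: periodization_def)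
  then show ?thesis
    by (simp add: nn_integral_tiling[of "\<lambda>x. nsq (F x)"])
qed

lemma norm_lattice_ge_1:
  assumes "m \<noteq> 0" shows "1 \<le> norm (lattice m)"
proof -
  obtain i where "m $ i \<noteq> 0" using assms by (auto simp: vec_eq_iff)
  then have "1 \<le> \<bar>lattice m $ i\<bar>" by simp
  also have "\<dots> \<le> norm (lattice m)" by (rule component_le_norm_cart)
  finally show ?thesis .
qed

text \<open>Plancherel is deduced from Fourier series. After dilation the integer translates of the
  support are disjoint, and the Fourier coefficients of \<open>f\<close> modulated by the offset
  \<open>\<theta>\<close> are samples of \<open>ft f\<close> on a shifted lattice. Parseval on the
  torus gives the same square sum for every offset; integrating over the offsets tiles the frequency
  plane.\<close>

theorem plancherel_compact:
  assumes f: "compact_L2 f"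
  shows "(\<integral>\<^sup>+\<xi>. nsq (ft f \<xi>) \<partial>lborel) = sqint lborel f"
proof -
  have [measurable]: "f \<in> borel_measurable borel" and fL: "f \<in> L2" using f by (auto simp: compact_L2_def L2_iff)
  have fin: "sqint lborel f < \<infinity>" using fL by (simp add: L2_iff)
  obtain R where R: "R \<ge> 0" "\<And>x. f x \<noteq> 0 \<Longrightarrow> norm x \<le> R" using f by (auto simp: compact_L2_def)
  \<comment> \<open>Larger than the diameter \<open>2 * R\<close> of the ball containing the
    support, so distinct integer translates of the rescaled support cannot meet.\<close>
  define T where "T = 2 * R + 1"
  have T: "T > 0" "2 * R < T" using R by (auto simp: T_def)
  define F where "F \<theta> y = of_real (T\<^sup>2) * (f (T *\<^sub>R y) * cis (- (2 * pi * (y \<bullet> \<theta>))))" for \<theta> y :: "real^2"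
  have [measurable]: "F \<theta> \<in> borel_measurable borel" for \<theta>
    unfolding F_def[abs_def] by measurable
  have disj: "n = n'" if "F \<theta> (x + lattice n) \<noteq> 0" "F \<theta> (x + lattice n') \<noteq> 0" for \<theta> x n n'
  proof (rule ccontr)
    assume "n \<noteq> n'"
    have *: "norm y \<le> R / T" if "F \<theta> y \<noteq> 0" for y
    proof -
      have "f (T *\<^sub>R y) \<noteq> 0" using that by (auto simp: F_def)
      then have "T * norm y \<le> R" using R(2) T by fastforce
      then show ?thesis using T by (simp add: field_simps)
    qed
    have "norm (lattice (n - n')) = norm ((x + lattice n) - (x + lattice n'))"
      by (intro arg_cong[where f=norm]) (simp add: vec_eq_iff)
    also have "\<dots> \<le> R / T + R / T"
      using norm_triangle_ineq4[of "x + lattice n" "x + lattice n'"] *[OF that(1)] *[OF that(2)] by linarith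
    also have "\<dots> < 1" using T by (simp add: field_simps)
    finally show False using norm_lattice_ge_1[of "n - n'"] \<open>n \<noteq> n'\<close> by simp
  qed
  have "integrable lborel f" by (rule compact_L2_integrable[OF f])
  then have if1: "integrable lborel (\<lambda>y. f (T *\<^sub>R y))"
    using nn_integral_scale[OF T(1), of "\<lambda>x. ennreal (cmod (f x))"] T
    by (auto simp: integrable_iff_bounded ennreal_mult_less_top ennreal_mult_eq_top_iff)
  have iF: "integrable lborel (F \<theta>)" for \<theta>
    unfolding F_def[abs_def] by (intro integrable_mult_right integrable_mult_cis if1) measurable
  have F2: "(\<integral>\<^sup>+y. nsq (F \<theta> y) \<partial>lborel) = ennreal (T\<^sup>2) * sqint lborel f" for \<theta>
  proof -
    have "(\<integral>\<^sup>+y. nsq (F \<theta> y) \<partial>lborel) = (\<integral>\<^sup>+y. ennreal (T\<^sup>2) * (ennreal (T\<^sup>2) * nsq (f (T *\<^sub>R y))) \<partial>lborel)"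
      unfolding F_def by (intro nn_integral_cong) (use T(1) in \<open>simp add: norm_mult norm_power power_mult_distrib ennreal_mult'[symmetric] power2_eq_square mult_ac\<close>)
    also have "\<dots> = ennreal (T\<^sup>2) * sqint lborel f"
      using nn_integral_scale[OF T(1), of "\<lambda>x. nsq (f x)"] by (simp add: nn_integral_cmult)
    finally show ?thesis .
  qed
  have coef: "(\<integral>y. F \<theta> y * cnj (chr m y) \<partial>lborel) = ft f ((1/T) *\<^sub>R (\<theta> + lattice m))" for \<theta> m
  proof -
    have "ft f ((1/T) *\<^sub>R (\<theta> + lattice m)) = T\<^sup>2 *\<^sub>R (\<integral>y. f (T *\<^sub>R y) * cis (- (2 * pi * ((T *\<^sub>R y) \<bullet> ((1/T) *\<^sub>R (\<theta> + lattice m))))) \<partial>lborel)"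
      unfolding ft_def by (rule integral_scale[OF T(1)]) measurable
    also have "(\<lambda>y. f (T *\<^sub>R y) * cis (- (2 * pi * ((T *\<^sub>R y) \<bullet> ((1/T) *\<^sub>R (\<theta> + lattice m)))))) =
       (\<lambda>y. f (T *\<^sub>R y) * (cis (- (2 * pi * (y \<bullet> \<theta>))) * cnj (chr m y)))"
      using T by (auto simp: chr_def cis_cnj cis_mult inner_add_right inner_commute[of "lattice m"] algebra_simps)
    also have "T\<^sup>2 *\<^sub>R integral\<^sup>L lborel \<dots> = (\<integral>y. F \<theta> y * cnj (chr m y) \<partial>lborel)"
      by (simp add: F_def scaleR_conv_of_real mult.assoc)
    finally show ?thesis by simp
  qed
  have key: "(\<Sum>\<^sup>+m. nsq (ft f ((1/T) *\<^sub>R (\<theta> + lattice m)))) =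
     ennreal (T\<^sup>2) * sqint lborel f" for \<theta>
  proof -
    have "(\<integral>\<^sup>+x. nsq (periodization (F \<theta>) x) \<partial>torus) = ennreal (T\<^sup>2) * sqint lborel f"
      using disj by (subst nn_integral_periodization_disjoint) (auto simp: F2)
    then show ?thesis
      using parseval_periodization[OF iF, of \<theta>] fin by (simp add: coef ennreal_mult_less_top)
  qed
  have "(\<integral>\<^sup>+\<xi>. nsq (ft f \<xi>) \<partial>lborel) = ennreal ((1/T)\<^sup>2) * (\<integral>\<^sup>+\<xi>. nsq (ft f ((1/T) *\<^sub>R \<xi>)) \<partial>lborel)"
    using T by (intro nn_integral_scale) auto
  also have "(\<integral>\<^sup>+\<xi>. nsq (ft f ((1/T) *\<^sub>R \<xi>)) \<partial>lborel) = (\<integral>\<^sup>+\<theta>. ennreal (T\<^sup>2) * sqint lborel f \<partial>torus)"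
    by (subst nn_integral_tiling) (auto simp: key)
  also have "\<dots> = ennreal (T\<^sup>2) * sqint lborel f"
    by (simp add: emeasure_torus)
  also have "ennreal ((1/T)\<^sup>2) * (ennreal (T\<^sup>2) * sqint lborel f) = sqint lborel f"
    using T by (simp add: mult.assoc[symmetric] ennreal_mult[symmetric] power_mult_distrib[symmetric])
  finally show ?thesis .
qed

lemma ft_L2: "compact_L2 f \<Longrightarrow> ft f \<in> L2"
  using plancherel_compact[of f] by (auto simp: L2_iff compact_L2_def)

lemma plancherel_compact_integral:
  assumes "compact_L2 f"
  shows "(\<integral>\<xi>. (cmod (ft f \<xi>))\<^sup>2 \<partial>lborel) = (\<integral>x. (cmod (f x))\<^sup>2 \<partial>lborel)"
  using plancherel_compact[OF assms] assms ft_L2[OF assms]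
  by (subst (1 2) integral_eq_nn_integral) (auto simp: L2_def compact_L2_def)

text \<open>Linearity of \<open>ft\<close> turns Plancherel for \<open>f + a * g\<close>, with
  \<open>a\<close> a fourth root of unity, into the four terms of the polarization identity.\<close>

lemma parseval_compact:
  assumes f: "compact_L2 f" and g: "compact_L2 g"
  shows "(\<integral>x. f x * cnj (g x) \<partial>lborel) = (\<integral>\<xi>. ft f \<xi> * cnj (ft g \<xi>) \<partial>lborel)"
proof -
  have *: "(\<integral>\<xi>. (cmod (ft f \<xi> + a * ft g \<xi>))\<^sup>2 \<partial>lborel) = (\<integral>x. (cmod (f x + a * g x))\<^sup>2 \<partial>lborel)" for a
    using plancherel_compact_integral[OF compact_L2_add[OF f compact_L2_cmult[OF g]], of a]
      compact_L2_integrable[OF f] compact_L2_integrable[OF compact_L2_cmult[OF g]]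
    by (simp add: ft_add ft_cmult)
  have "f \<in> L2" "g \<in> L2" using f g by (auto simp: compact_L2_def)
  then have "4 * (\<integral>x. f x * cnj (g x) \<partial>lborel) = 4 * (\<integral>\<xi>. ft f \<xi> * cnj (ft g \<xi>) \<partial>lborel)"
    unfolding integral_polarization[OF \<open>f \<in> L2\<close> \<open>g \<in> L2\<close>] integral_polarization[OF ft_L2[OF f] ft_L2[OF g]]
    using *[of 1] *[of "-1"] *[of \<i>] *[of "-\<i>"] by simp
  then show ?thesis by simp
qed

text \<open>The transform on L2 as a limit along some sequence of functions with bounded support,
  with no prescribed truncation. The freedom is needed for tensor products: products of functions
  truncated to intervals are truncated to squares, not balls.\<close>

definition fourier_pair :: "(real^2 \<Rightarrow> complex) \<Rightarrow> (real^2 \<Rightarrow> complex) \<Rightarrow> bool"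
  where "fourier_pair \<sigma> s \<longleftrightarrow> \<sigma> \<in> L2 \<and> s \<in> L2 \<and> (\<exists>a. (\<forall>n::nat. compact_L2 (a n)) \<and>
    (\<lambda>n. sqdist lborel \<sigma> (a n)) \<longlonglongrightarrow> 0 \<and> (\<lambda>n. sqdist lborel s (ft (a n))) \<longlonglongrightarrow> 0)"

lemma integral_L2_tendsto:
  assumes f: "f \<in> L2" and g: "g \<in> L2" "\<And>n. a n \<in> L2"
    and lim: "(\<lambda>n. sqdist lborel g (a n)) \<longlonglongrightarrow> 0"
  shows "(\<lambda>n. \<integral>x. f x * cnj (a n x) \<partial>lborel) \<longlonglongrightarrow> (\<integral>x. f x * cnj (g x) \<partial>lborel)"
proof -
  have [measurable]: "f \<in> borel_measurable borel" "g \<in> borel_measurable borel" "a n \<in> borel_measurable borel" for n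
    using f g by (auto simp: L2_iff)
  let ?d = "\<lambda>n. (\<integral>x. f x * cnj (a n x) \<partial>lborel) - (\<integral>x. f x * cnj (g x) \<partial>lborel)"
  have b: "nsq (?d n) \<le> sqint lborel f * sqdist lborel g (a n)" for n
  proof -
    have "?d n = (\<integral>x. f x * cnj (a n x - g x) \<partial>lborel)"
      using integrable_L2_mult[OF f g(1)] integrable_L2_mult[OF f g(2)] by (simp add: right_diff_distrib)
    then have "ennreal (cmod (?d n)) \<le> (\<integral>\<^sup>+x. ennreal (cmod (f x * cnj (a n x - g x))) \<partial>lborel)"
      using ennreal_cmod_integral_le[of lborel "\<lambda>x. f x * cnj (a n x - g x)"] by simp
    then have "(ennreal (cmod (?d n)))\<^sup>2 \<le> (\<integral>\<^sup>+x. ennreal (cmod (f x * cnj (a n x - g x))) \<partial>lborel)\<^sup>2"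
      by (rule power_mono) simp
    also have "\<dots> \<le> sqint lborel f * (\<integral>\<^sup>+x. nsq (a n x - g x) \<partial>lborel)"
      by (rule cauchy_schwarz_L2) auto
    finally show ?thesis
      by (simp add: sqdist_def norm_minus_commute ennreal_power)
  qed
  have "(\<lambda>n. sqint lborel f * sqdist lborel g (a n)) \<longlonglongrightarrow> sqint lborel f * 0"
    by (intro ennreal_tendsto_cmult lim) (use f in \<open>simp add: L2_iff\<close>)
  then have "(\<lambda>n. nsq (?d n)) \<longlonglongrightarrow> 0"
    unfolding mult_zero_right
    by (rule tendsto_sandwich[OF always_eventually[OF allI] always_eventually[OF allI] tendsto_const, rotated 2]) (rule zero_le, rule b)
  then have "(\<lambda>n. (cmod (?d n))\<^sup>2) \<longlonglongrightarrow> 0"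
    by (rule ennreal_tendsto_0_iff[THEN iffD1, rotated]) (rule zero_le_power2)
  then have "(\<lambda>n. sqrt ((cmod (?d n))\<^sup>2)) \<longlonglongrightarrow> sqrt 0" by (rule tendsto_real_sqrt)
  then have "(\<lambda>n. cmod (?d n)) \<longlonglongrightarrow> 0" by (simp only: real_sqrt_abs abs_norm_cancel real_sqrt_zero)
  then have "?d \<longlonglongrightarrow> 0" by (rule tendsto_norm_zero_cancel)
  then show ?thesis by (rule LIM_zero_cancel)
qed

text \<open>Only the second argument is approximated; the first keeps bounded support, which is
  enough because the frame inequalities are first proved for such functions.\<close>

lemma fourier_pair_parseval:
  assumes h: "compact_L2 h" and p: "fourier_pair \<sigma> s"
  shows "(\<integral>x. h x * cnj (\<sigma> x) \<partial>lborel) = (\<integral>\<xi>. ft h \<xi> * cnj (s \<xi>) \<partial>lborel)"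
proof -
  obtain a where a: "\<And>n. compact_L2 (a n)" "(\<lambda>n::nat. sqdist lborel \<sigma> (a n)) \<longlonglongrightarrow> 0"
     "(\<lambda>n. sqdist lborel s (ft (a n))) \<longlonglongrightarrow> 0" and L: "\<sigma> \<in> L2" "s \<in> L2"
    using p by (auto simp: fourier_pair_def)
  have "(\<lambda>n. \<integral>x. h x * cnj (a n x) \<partial>lborel) \<longlonglongrightarrow> (\<integral>x. h x * cnj (\<sigma> x) \<partial>lborel)"
    by (rule integral_L2_tendsto) (use h a L in \<open>auto simp: compact_L2_def\<close>)
  moreover have "(\<lambda>n. \<integral>\<xi>. ft h \<xi> * cnj (ft (a n) \<xi>) \<partial>lborel) \<longlonglongrightarrow> (\<integral>\<xi>. ft h \<xi> * cnj (s \<xi>) \<partial>lborel)"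
    by (rule integral_L2_tendsto) (use h a L ft_L2 in auto)
  ultimately show ?thesis
    unfolding parseval_compact[OF h a(1)] by (rule LIMSEQ_unique)
qed

lemma fourier_integral_on_eq_ft:
  fixes f :: "real^2 \<Rightarrow> complex"
  shows   "fourier_integral_on S f \<xi> = ft (\<lambda>x. indicator S x *\<^sub>R f x) \<xi>"
proof -
  have "exp (- 2 * complex_of_real pi * \<i> * complex_of_real t) = cis (- (2 * pi * t))" for t
    by (simp add: cis_conv_exp mult_ac)
  then show ?thesis
    by (simp add: fourier_integral_on_def set_lebesgue_integral_def ft_def)
qed

lemma cball_measurable [measurable]: "cball (c::'a::euclidean_space) R \<in> sets borel"
  by simp

lemma truncation_tendsto:
  fixes f :: "'a::euclidean_space \<Rightarrow> complex"
  assumes f: "f \<in> L2"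
  shows "(\<lambda>n. sqdist lborel f (\<lambda>x. indicator (cball 0 (real n)) x *\<^sub>R f x)) \<longlonglongrightarrow> 0"
proof -
  have [measurable]: "f \<in> borel_measurable borel" using f by (simp add: L2_iff)
  show ?thesis
  proof (rule sqdist_tendsto[where w="\<lambda>x. cmod (f x)"])
    show "AE x in lborel. (\<lambda>n. indicator (cball 0 (real n)) x *\<^sub>R f x) \<longlonglongrightarrow> f x"
    proof (rule AE_I2)
      fix x :: 'a
      obtain k :: nat where "norm x \<le> real k" using real_arch_simple by blast
      then have "\<forall>\<^sub>F n in sequentially. indicator (cball 0 (real n)) x *\<^sub>R f x = f x"
        by (intro eventually_sequentiallyI[of k]) (auto simp: indicator_def)
      then show "(\<lambda>n. indicator (cball 0 (real n)) x *\<^sub>R f x) \<longlonglongrightarrow> f x"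
        by (rule tendsto_eventually)
    qed
  qed (use f in \<open>auto simp: L2_iff indicator_def\<close>)
qed

lemma truncation_L2:
  fixes f :: "'a::euclidean_space \<Rightarrow> complex"
  assumes f: "f \<in> L2" shows "(\<lambda>x. indicator (cball 0 R) x *\<^sub>R f x) \<in> L2"
proof (rule L2_bound[OF f])
  have [measurable]: "f \<in> borel_measurable borel" using f by (simp add: L2_iff)
  show "(\<lambda>x. indicator (cball 0 R) x *\<^sub>R f x) \<in> borel_measurable borel" by measurable
qed (auto simp: indicator_def)

lemma compact_L2_truncation:
  assumes f: "f \<in> L2" shows "compact_L2 (\<lambda>x. indicator (cball 0 (real n)) x *\<^sub>R f x)"
  unfolding compact_L2_def using truncation_L2[OF f]
  by (auto simp: indicator_def intro!: exI[of _ "real n"])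

lemma has_L2_fourier_transform_seq:
  fixes f :: "'a::euclidean_space \<Rightarrow> complex"
  assumes "has_L2_fourier_transform f g"
  shows "(\<lambda>n. sqdist lborel g (fourier_integral_on (cball 0 (real n)) f)) \<longlonglongrightarrow> 0"
  using filterlim_compose[OF _ filterlim_real_sequentially] assms
  unfolding has_L2_fourier_transform_def sqdist_def by blast

lemma fourier_pair_has_L2:
  assumes "has_L2_fourier_transform f g"
  shows "fourier_pair f g"
proof -
  have L: "f \<in> L2" "g \<in> L2" using assms by (auto simp: has_L2_fourier_transform_def)
  have "fourier_integral_on (cball 0 (real n)) f = ft (\<lambda>x. indicator (cball 0 (real n)) x *\<^sub>R f x)" for n
    by (rule ext) (rule fourier_integral_on_eq_ft)
  then show ?thesis unfolding fourier_pair_def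
    using L compact_L2_truncation[OF L(1)] truncation_tendsto[OF L(1)] has_L2_fourier_transform_seq[OF assms]
    by (intro conjI exI[of _ "\<lambda>n x. indicator (cball 0 (real n)) x *\<^sub>R f x"]) auto
qed

section \<open>Tensor products of one-dimensional functions\<close>

definition tensor :: "(real \<Rightarrow> complex) \<Rightarrow> real^2 \<Rightarrow> complex"
  where "tensor f x = f (x$1) * f (x$2)"

lemma tensor_measurable [measurable]:
  assumes [measurable]: "f \<in> borel_measurable borel" shows "tensor f \<in> borel_measurable borel"
  unfolding tensor_def[abs_def] by measurable

lemma tensor_L2:
  assumes "f \<in> L2" shows "tensor f \<in> L2"
proof -
  have [measurable]: "f \<in> borel_measurable borel" using assms by (simp add: L2_iff)
  have "(\<integral>\<^sup>+x. nsq (tensor f x) \<partial>lborel) = sqint lborel f * sqint lborel f"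
    by (subst nn_integral_tensor[symmetric]) (auto simp: tensor_def norm_mult power_mult_distrib ennreal_mult)
  then show ?thesis using assms by (auto simp: L2_iff ennreal_mult_less_top)
qed

text \<open>One factor is replaced at a time. The two errors carry the norm of \<open>f\<close> and
  the norm of \<open>a n\<close>, and the latter is controlled by
  \<open>2 * F + 2 * d n\<close>.\<close>

lemma sqdist_tensor_tendsto:
  fixes f :: "real \<Rightarrow> complex"
  assumes f: "f \<in> L2" and [measurable]: "\<And>n. a n \<in> borel_measurable borel"
    and lim: "(\<lambda>n. sqdist lborel f (a n)) \<longlonglongrightarrow> 0"
  shows "(\<lambda>n. sqdist lborel (tensor f) (tensor (a n))) \<longlonglongrightarrow> 0"
proof -
  have [measurable]: "f \<in> borel_measurable borel" using f by (simp add: L2_iff)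
  define F where "F = sqint lborel f"
  have F: "F < \<infinity>" using f by (simp add: F_def L2_iff)
  define d where "d n = sqdist lborel f (a n)" for n
  have an: "(\<integral>\<^sup>+x. nsq (a n x) \<partial>lborel) \<le> 2 * F + 2 * d n" for n
    using sqdist_triangle[of "\<lambda>_. 0" lborel f "a n"] by (simp add: sqdist_def F_def d_def)
  have b: "sqdist lborel (tensor f) (tensor (a n)) \<le> 2 * (d n * F) + 2 * ((2 * F + 2 * d n) * d n)" for n
  proof -
    have "sqdist lborel (tensor f) (tensor (a n)) \<le> 2 * sqdist lborel (tensor f) (\<lambda>x. a n (x$1) * f (x$2)) + 2 * sqdist lborel (\<lambda>x. a n (x$1) * f (x$2)) (tensor (a n))"
      by (rule sqdist_triangle) measurable
    also have "sqdist lborel (tensor f) (\<lambda>x. a n (x$1) * f (x$2)) = d n * F"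
      unfolding sqdist_def d_def F_def
      by (subst nn_integral_tensor[symmetric]) (auto simp: tensor_def norm_mult power_mult_distrib ennreal_mult left_diff_distrib[symmetric])
    also have "sqdist lborel (\<lambda>x. a n (x$1) * f (x$2)) (tensor (a n)) = (\<integral>\<^sup>+x. nsq (a n x) \<partial>lborel) * d n"
      unfolding sqdist_def d_def
      by (subst nn_integral_tensor[symmetric]) (auto simp: tensor_def norm_mult power_mult_distrib ennreal_mult right_diff_distrib[symmetric])
    also have "\<dots> \<le> (2 * F + 2 * d n) * d n" by (intro mult_right_mono an) simp
    finally show ?thesis by (simp add: mult_left_mono)
  qed
  have "d \<longlonglongrightarrow> 0" using lim by (simp add: d_def[abs_def])
  then have "(\<lambda>n. 2 * (d n * F) + 2 * ((2 * F + 2 * d n) * d n)) \<longlonglongrightarrow> 2 * (0 * F) + 2 * ((2 * F + 2 * 0) * 0)"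
    using F by (intro tendsto_add tendsto_mult_ennreal tendsto_const) (auto simp: ennreal_mult_less_top ennreal_mult_eq_top_iff)
  then have "(\<lambda>n. 2 * (d n * F) + 2 * ((2 * F + 2 * d n) * d n)) \<longlonglongrightarrow> 0" by simp
  then show ?thesis
    by (rule tendsto_sandwich[OF always_eventually[OF allI] always_eventually[OF allI] tendsto_const, rotated 2]) (rule zero_le, rule b)
qed

text \<open>The approximating functions are tensor products of truncations to intervals; their plane
  transform factors by Fubini into one-dimensional Fourier integrals, for which convergence is the
  hypothesis.\<close>

lemma fourier_pair_tensor:
  fixes f g :: "real \<Rightarrow> complex"
  assumes "has_L2_fourier_transform f g"
  shows "fourier_pair (tensor f) (tensor g)"
proof -
  have L: "f \<in> L2" "g \<in> L2" using assms by (auto simp: has_L2_fourier_transform_def)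
  have [measurable]: "f \<in> borel_measurable borel" using L by (simp add: L2_iff)
  define a where "a n x = indicator (cball 0 (real n)) x *\<^sub>R f x" for n x
  have [measurable]: "a n \<in> borel_measurable borel" for n unfolding a_def[abs_def] by measurable
  have aL: "a n \<in> L2" for n unfolding a_def[abs_def] by (rule truncation_L2[OF L(1)])
  have ai: "integrable lborel (a n)" for n
    by (rule integrable_L2_bounded_support[OF aL, of _ "real n"]) (auto simp: a_def indicator_def split: if_splits)
  define F where "F n = fourier_integral_on (cball 0 (real n)) f" for n
  have F: "F n \<xi> = (\<integral>x. a n x * cis (- (2 * pi * (x * \<xi>))) \<partial>lborel)" for n \<xi>
  proof -
    have "exp (- 2 * complex_of_real pi * \<i> * complex_of_real t) = cis (- (2 * pi * t))" for t
      by (simp add: cis_conv_exp mult_ac)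
    then show ?thesis
      by (simp add: F_def fourier_integral_on_def set_lebesgue_integral_def a_def del: of_real_mult)
  qed
  have [measurable]: "F n \<in> borel_measurable borel" for n
    unfolding F[abs_def] by (intro lborel.borel_measurable_lebesgue_integral) measurable
  have ftt: "ft (tensor (a n)) = tensor (F n)" for n
  proof
    fix \<xi>
    have i: "integrable lborel (\<lambda>x. a n x * cis (- (2 * pi * (x * t))))" for t
      using ai[of n] by (rule Bochner_Integration.integrable_bound) (auto simp: norm_mult)
    have "ft (tensor (a n)) \<xi> = (\<integral>x. (a n (x$1) * cis (- (2 * pi * (x$1 * \<xi>$1)))) * (a n (x$2) * cis (- (2 * pi * (x$2 * \<xi>$2)))) \<partial>(lborel :: (real^2) measure))"
      unfolding ft_def tensor_def inner_2 distrib_left minus_add_distrib cis_mult[symmetric] by (simp add: mult_ac)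
    also have "\<dots> = tensor (F n) \<xi>"
      by (subst integral_tensor[OF i i]) (simp add: tensor_def F)
    finally show "ft (tensor (a n)) \<xi> = tensor (F n) \<xi>" .
  qed
  show ?thesis unfolding fourier_pair_def
  proof (intro conjI exI[of _ "\<lambda>n. tensor (a n)"] allI)
    show "compact_L2 (tensor (a n))" for n
      unfolding compact_L2_def
    proof (intro conjI tensor_L2 aL exI[of _ "2 * real n"] allI impI)
      fix x assume "tensor (a n) x \<noteq> 0"
      then have "\<bar>x$1\<bar> \<le> n" "\<bar>x$2\<bar> \<le> n" by (auto simp: tensor_def a_def indicator_def split: if_splits)
      then show "norm x \<le> 2 * real n" using norm_le_l1_cart[of x] by (simp add: sum_2)
    qed auto
    show "(\<lambda>n. sqdist lborel (tensor f) (tensor (a n))) \<longlonglongrightarrow> 0"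
      by (rule sqdist_tensor_tendsto[OF L(1)]) (use truncation_tendsto[OF L(1)] in \<open>simp_all add: a_def[abs_def]\<close>)
    show "(\<lambda>n. sqdist lborel (tensor g) (ft (tensor (a n)))) \<longlonglongrightarrow> 0"
      unfolding ftt
    proof (rule sqdist_tensor_tendsto[OF L(2)])
      show "(\<lambda>n. sqdist lborel g (F n)) \<longlonglongrightarrow> 0"
        unfolding F_def[abs_def] by (rule has_L2_fourier_transform_seq[OF assms])
    qed measurable
  qed (auto intro: tensor_L2 L)
qed

subsection \<open>Lattice systems of translates\<close>

text \<open>Expanding the square of the sum as a double series, the diagonal differs from it by at
  most the off-diagonal absolute values. Working row by row with \<open>F n * cnj S\<close> replaces
  the rearrangement of a double series by linearity of a single one.\<close>

lemma sum_cmod_sq_le: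
  fixes F :: "'i \<Rightarrow> complex"
  assumes fin: "(\<Sum>\<^sup>+n. ennreal (cmod (F n))) < \<infinity>"
  shows "(\<Sum>\<^sup>+n. nsq (F n)) \<le>
    nsq (\<integral>n. F n \<partial>count_space UNIV) +
    (\<Sum>\<^sup>+n. (\<Sum>\<^sup>+m. ennreal (cmod (F n)) * ennreal (cmod (F m)) * of_bool (m \<noteq> n)))"
proof -
  let ?C = "count_space (UNIV :: 'i set)"
  define S where "S = (\<integral>n. F n \<partial>?C)"
  have iF: "integrable ?C F" using fin by (intro integrableI_bounded) auto
  define T where "T = (\<integral>n. cmod (F n) \<partial>?C)"
  have iN: "integrable ?C (\<lambda>n. cmod (F n))" using iF by simp
  \<comment> \<open>The absolute sum with the \<open>n\<close>-th term removed; it dominates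
    \<open>S - F n\<close>, the off-diagonal part of row \<open>n\<close>.\<close>
  define D where "D n = (\<integral>m. cmod (F m) * of_bool (m \<noteq> n) \<partial>?C)" for n
  have iD: "integrable ?C (\<lambda>m. cmod (F m) * of_bool (m \<noteq> n))" for n
    by (rule Bochner_Integration.integrable_bound[OF iN]) auto
  have D0: "0 \<le> D n" for n unfolding D_def by (rule integral_nonneg_AE) auto
  have DT: "D n \<le> T" for n unfolding D_def T_def by (intro integral_mono iD iN) auto
  have SD: "cmod (S - F n) \<le> D n" for n
  proof -
    have i1: "integrable ?C (\<lambda>m. F m * of_bool (m \<noteq> n))"
      by (rule Bochner_Integration.integrable_bound[OF iF]) auto
    have i2: "integrable ?C (\<lambda>m. F m * of_bool (m = n))"
      by (rule Bochner_Integration.integrable_bound[OF iF]) auto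
    have "S = (\<integral>m. F m * of_bool (m \<noteq> n) + F m * of_bool (m = n) \<partial>?C)"
      unfolding S_def by (intro Bochner_Integration.integral_cong) auto
    also have "\<dots> = (\<integral>m. F m * of_bool (m \<noteq> n) \<partial>?C) + (\<integral>m. F m * of_bool (m = n) \<partial>?C)"
      using i1 i2 by simp
    also have "(\<integral>m. F m * of_bool (m = n) \<partial>?C) = F n"
    proof (cases "F n = 0")
      case True
      have "(\<lambda>m. F m * of_bool (m = n)) = (\<lambda>m. 0)" using True by (auto simp: fun_eq_iff)
      then show ?thesis using True by simp
    next
      case False
      have "{m. F m * of_bool (m = n) \<noteq> 0} = {n}" using False by auto
      then show ?thesis by (subst lebesgue_integral_count_space_finite_support) auto
    qed
    finally have "S - F n = (\<integral>m. F m * of_bool (m \<noteq> n) \<partial>?C)" by simp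
    also have "cmod \<dots> \<le> (\<integral>m. cmod (F m * of_bool (m \<noteq> n)) \<partial>?C)" by (rule integral_norm_bound)
    also have "\<dots> = D n" unfolding D_def by (intro Bochner_Integration.integral_cong) auto
    finally show ?thesis .
  qed
  have pt: "(cmod (F n))\<^sup>2 \<le> Re (F n * cnj S) + cmod (F n) * D n" for n
  proof -
    have "F n * cnj S = F n * cnj (F n) + F n * cnj (S - F n)" by (simp add: algebra_simps)
    moreover have "F n * cnj (F n) = of_real ((cmod (F n))\<^sup>2)" by (simp add: complex_norm_square[symmetric])
    ultimately have "Re (F n * cnj S) = (cmod (F n))\<^sup>2 + Re (F n * cnj (S - F n))" by simp
    moreover have "\<bar>Re (F n * cnj (S - F n))\<bar> \<le> cmod (F n) * D n"
      using abs_Re_le_cmod[of "F n * cnj (S - F n)"] mult_left_mono[OF SD[of n], of "cmod (F n)"]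
      unfolding norm_mult complex_mod_cnj by (meson norm_ge_zero order_trans)
    ultimately show ?thesis by linarith
  qed
  have iFS: "integrable ?C (\<lambda>n. F n * cnj S)" using iF by simp
  have iFD: "integrable ?C (\<lambda>n. cmod (F n) * D n)"
    by (rule Bochner_Integration.integrable_bound[OF integrable_mult_left[OF iN, of T]])
       (use D0 order_trans[OF DT abs_ge_self] in \<open>auto intro!: AE_I2 mult_left_mono simp: abs_mult\<close>)
  have i2: "integrable ?C (\<lambda>n. (cmod (F n))\<^sup>2)"
  proof (rule Bochner_Integration.integrable_bound)
    show "integrable ?C (\<lambda>n. Re (F n * cnj S) + cmod (F n) * D n)"
      by (intro Bochner_Integration.integrable_add integrable_Re iFS iFD)
  qed (use pt in \<open>auto simp: abs_of_nonneg intro: order_trans[OF _ abs_ge_self]\<close>)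
  have "(\<integral>n. (cmod (F n))\<^sup>2 \<partial>?C) \<le> (\<integral>n. Re (F n * cnj S) + cmod (F n) * D n \<partial>?C)"
    by (intro integral_mono i2 Bochner_Integration.integrable_add integrable_Re iFS iFD pt)
  also have "\<dots> = (\<integral>n. Re (F n * cnj S) \<partial>?C) + (\<integral>n. cmod (F n) * D n \<partial>?C)"
    by (intro Bochner_Integration.integral_add integrable_Re iFS iFD)
  also have "(\<integral>n. Re (F n * cnj S) \<partial>?C) = Re (S * cnj S)"
    using integral_Re[OF iFS] by (simp add: S_def)
  also have "Re (S * cnj S) = (cmod S)\<^sup>2" by (simp add: complex_norm_square[symmetric] flip: of_real_power)
  finally have le: "(\<integral>n. (cmod (F n))\<^sup>2 \<partial>?C) \<le> (cmod S)\<^sup>2 + (\<integral>n. cmod (F n) * D n \<partial>?C)" .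
  have "(\<integral>\<^sup>+n. nsq (F n) \<partial>?C) = ennreal (\<integral>n. (cmod (F n))\<^sup>2 \<partial>?C)"
    by (intro nn_integral_eq_integral i2) auto
  also have "\<dots> \<le> nsq S + ennreal (\<integral>n. cmod (F n) * D n \<partial>?C)"
  proof -
    have "0 \<le> (\<integral>n. cmod (F n) * D n \<partial>?C)" using D0 by (intro integral_nonneg_AE) auto
    then show ?thesis using ennreal_leI[OF le] by (simp add: ennreal_plus)
  qed
  also have "ennreal (\<integral>n. cmod (F n) * D n \<partial>?C) = (\<integral>\<^sup>+n. ennreal (cmod (F n) * D n) \<partial>?C)"
    by (intro nn_integral_eq_integral[symmetric] iFD) (use D0 in auto)
  also have "\<dots> = (\<integral>\<^sup>+n. (\<integral>\<^sup>+m. ennreal (cmod (F n)) * ennreal (cmod (F m)) * of_bool (m \<noteq> n) \<partial>?C) \<partial>?C)"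
  proof (intro nn_integral_cong)
    fix n
    have "(\<integral>\<^sup>+m. ennreal (cmod (F n)) * ennreal (cmod (F m)) * of_bool (m \<noteq> n) \<partial>?C) =
      ennreal (cmod (F n)) * (\<integral>\<^sup>+m. ennreal (cmod (F m) * of_bool (m \<noteq> n)) \<partial>?C)"
      by (subst nn_integral_cmult[symmetric]) (auto intro!: nn_integral_cong)
    also have "\<dots> = ennreal (cmod (F n)) * ennreal (D n)"
      unfolding D_def by (subst nn_integral_eq_integral[OF iD]) auto
    finally show "ennreal (cmod (F n) * D n) = (\<integral>\<^sup>+m. ennreal (cmod (F n)) * ennreal (cmod (F m)) * of_bool (m \<noteq> n) \<partial>?C)"
      using D0 by (simp add: ennreal_mult)
  qed
  finally show ?thesis unfolding S_def .
qed

text \<open>The bound \<open>2 * a n * a m \<le> a n ^ 2 + a m ^ 2\<close> separates the unknown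
  function \<open>a\<close> from the kernel, and the symmetry of the kernel makes both halves equal.
  This is a Schur test with constant weight.\<close>

lemma double_sum_am_gm:
  fixes a b :: "'i::countable \<Rightarrow> real"
  assumes "\<And>n. 0 \<le> a n" "\<And>n. 0 \<le> b n"
  shows "(\<Sum>\<^sup>+n. (\<Sum>\<^sup>+m. ennreal (a n * b n) * ennreal (a m * b m) * of_bool (m \<noteq> n))) \<le>
    (\<Sum>\<^sup>+n. (\<Sum>\<^sup>+m. ennreal ((a n)\<^sup>2) * (ennreal (b n) * ennreal (b m) * of_bool (m \<noteq> n))))"
    (is "?L \<le> ?R")
proof -
  let ?C = "count_space (UNIV :: 'i set)"
  let ?P = "\<lambda>n m. ennreal ((a n)\<^sup>2) * (ennreal (b n) * ennreal (b m) * of_bool (m \<noteq> n))"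
  have "2 * ?L = (\<integral>\<^sup>+n. (\<integral>\<^sup>+m. 2 * (ennreal (a n * b n) * ennreal (a m * b m) * of_bool (m \<noteq> n)) \<partial>?C) \<partial>?C)"
    by (simp add: nn_integral_cmult)
  also have "\<dots> \<le> (\<integral>\<^sup>+n. (\<integral>\<^sup>+m. ?P n m + ?P m n \<partial>?C) \<partial>?C)"
  proof (intro nn_integral_mono)
    fix n m
    have "2 * (a n * a m) * (b n * b m) \<le> ((a n)\<^sup>2 + (a m)\<^sup>2) * (b n * b m)"
      using sum_squares_bound[of "a n" "a m"] assms by (intro mult_right_mono) auto
    then have "ennreal (2 * (a n * a m) * (b n * b m)) \<le> ennreal ((a n)\<^sup>2 * (b n * b m) + (a m)\<^sup>2 * (b m * b n))"
      by (intro ennreal_leI) (simp add: algebra_simps)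
    then show "2 * (ennreal (a n * b n) * ennreal (a m * b m) * of_bool (m \<noteq> n)) \<le> ?P n m + ?P m n"
      using assms by (cases "m = n") (auto simp: ennreal_mult mult_ac)
  qed
  also have "\<dots> = ?R + (\<integral>\<^sup>+n. (\<integral>\<^sup>+m. ?P m n \<partial>?C) \<partial>?C)"
    by (simp add: nn_integral_add)
  also have "(\<integral>\<^sup>+n. (\<integral>\<^sup>+m. ?P m n \<partial>?C) \<partial>?C) = ?R"
    by (rule nn_integral_count_space_nn_integral) auto
  finally have "2 * ?L \<le> 2 * ?R" by (simp add: mult_2)
  then show ?thesis by (subst (asm) ennreal_mult_le_mult_iff) auto
qed

text \<open>Cauchy-Schwarz after splitting \<open>a n * b n\<close> as
  \<open>a n * sqrt (b n)\<close> times \<open>sqrt (b n)\<close>; the weight on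
  \<open>a n ^ 2\<close> becomes a row sum of the kernel \<open>b n * b m\<close>.\<close>

lemma sum_mult_sq_le:
  fixes a b :: "'i \<Rightarrow> real"
  assumes "\<And>n. 0 \<le> a n" "\<And>n. 0 \<le> b n"
  shows "(\<Sum>\<^sup>+n. ennreal (a n * b n))\<^sup>2 \<le>
    (\<Sum>\<^sup>+n. ennreal ((a n)\<^sup>2) * (\<Sum>\<^sup>+m. ennreal (b n) * ennreal (b m)))"
proof -
  let ?C = "count_space (UNIV :: 'i set)"
  have "(\<integral>\<^sup>+n. ennreal (a n * b n) \<partial>?C)\<^sup>2 = (\<integral>\<^sup>+n. ennreal (a n * sqrt (b n)) * ennreal (sqrt (b n)) \<partial>?C)\<^sup>2"
    using assms by (simp add: ennreal_mult'[symmetric] mult.assoc)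
  also have "\<dots> \<le> (\<integral>\<^sup>+n. (ennreal (a n * sqrt (b n)))\<^sup>2 \<partial>?C) * (\<integral>\<^sup>+n. (ennreal (sqrt (b n)))\<^sup>2 \<partial>?C)"
    by (rule Cauchy_Schwarz_nn_integral) auto
  also have "\<dots> = (\<integral>\<^sup>+n. ennreal ((a n)\<^sup>2) * ennreal (b n) \<partial>?C) * (\<integral>\<^sup>+n. ennreal (b n) \<partial>?C)"
    using assms by (simp add: ennreal_power power_mult_distrib ennreal_mult)
  also have "\<dots> = (\<integral>\<^sup>+n. ennreal ((a n)\<^sup>2) * ennreal (b n) * (\<integral>\<^sup>+m. ennreal (b m) \<partial>?C) \<partial>?C)"
    by (rule nn_integral_multc[symmetric]) auto
  also have "\<dots> = (\<integral>\<^sup>+n. ennreal ((a n)\<^sup>2) * (\<integral>\<^sup>+m. ennreal (b n) * ennreal (b m) \<partial>?C) \<partial>?C)"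
    by (simp add: nn_integral_cmult mult.assoc)
  finally show ?thesis .
qed

section \<open>Coefficients of one generator along the integer lattice\<close>

lemma nn_integral_lattice_shift:
  "(\<Sum>\<^sup>+m. f (m - n)) = (\<integral>\<^sup>+m. f m \<partial>count_space (UNIV :: (int^2) set))"
proof -
  have "bij_betw (\<lambda>m. m - n) (UNIV :: (int^2) set) UNIV"
    by (rule bij_betwI[where g="\<lambda>m. m + n"]) auto
  then show ?thesis by (rule nn_integral_bij_count_space)
qed

lemma nn_integral_lattice_uminus:
  "(\<Sum>\<^sup>+m. f (- m)) = (\<integral>\<^sup>+m. f m \<partial>count_space (UNIV :: (int^2) set))"
proof -
  have "bij_betw uminus (UNIV :: (int^2) set) UNIV"
    by (rule bij_betwI[where g=uminus]) auto
  then show ?thesis by (rule nn_integral_bij_count_space)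
qed

text \<open>The row sum at \<open>x\<close> of the kernel formed by \<open>s\<close> and its integer
  translates: the weight that \<open>cmod g ^ 2\<close> receives in the upper bound. Its part
  \<open>off_overlap\<close> away from the diagonal measures aliasing.\<close>

definition overlap :: "(real^2 \<Rightarrow> complex) \<Rightarrow> real^2 \<Rightarrow> ennreal"
  where "overlap s x = (\<Sum>\<^sup>+m. ennreal (cmod (s x)) * ennreal (cmod (s (x + lattice m))))"

definition off_overlap :: "(real^2 \<Rightarrow> complex) \<Rightarrow> real^2 \<Rightarrow> ennreal"
  where "off_overlap s x = (\<Sum>\<^sup>+m. ennreal (cmod (s x)) * ennreal (cmod (s (x + lattice m))) * of_bool (m \<noteq> 0))"

lemma overlap_measurable [measurable]:
  assumes [measurable]: "s \<in> borel_measurable borel"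
  shows "overlap s \<in> borel_measurable borel"
proof -
  interpret C: sigma_finite_measure "count_space (UNIV :: (int^2) set)" by (rule sigma_finite_count_int2)
  show ?thesis unfolding overlap_def[abs_def] by measurable
qed

lemma off_overlap_measurable [measurable]:
  assumes [measurable]: "s \<in> borel_measurable borel"
  shows "off_overlap s \<in> borel_measurable borel"
proof -
  interpret C: sigma_finite_measure "count_space (UNIV :: (int^2) set)" by (rule sigma_finite_count_int2)
  show ?thesis unfolding off_overlap_def[abs_def] by measurable
qed

lemma overlap_lattice:
  "(\<Sum>\<^sup>+m. ennreal (cmod (s (x + lattice n))) * ennreal (cmod (s (x + lattice m)))) = overlap s (x + lattice n)"
  "(\<Sum>\<^sup>+m. ennreal (cmod (s (x + lattice n))) * ennreal (cmod (s (x + lattice m))) * of_bool (m \<noteq> n)) = off_overlap s (x + lattice n)"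
proof -
  have *: "x + lattice n + lattice (m - n) = x + lattice m" for m
    using lattice_add[of "m - n" n] by (simp add: algebra_simps)
  show "(\<Sum>\<^sup>+m. ennreal (cmod (s (x + lattice n))) * ennreal (cmod (s (x + lattice m)))) = overlap s (x + lattice n)"
    unfolding overlap_def
    by (subst nn_integral_lattice_shift[symmetric, where n=n]) (simp only: *)
  show "(\<Sum>\<^sup>+m. ennreal (cmod (s (x + lattice n))) * ennreal (cmod (s (x + lattice m))) * of_bool (m \<noteq> n)) = off_overlap s (x + lattice n)"
    unfolding off_overlap_def
    by (subst nn_integral_lattice_shift[symmetric, where n=n]) (simp only: * right_minus_eq)
qed

text \<open>The uniform bound on the overlap makes the periodization of \<open>g * cnj s\<close>
  square integrable over the cell, which is what Parseval requires; the value of \<open>C\<close>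
  does not enter the resulting inequalities.\<close>

locale lattice_generator =
  fixes g s :: "real^2 \<Rightarrow> complex" and C :: real
  assumes g: "g \<in> L2" and s: "s \<in> L2" and overlap_le: "\<And>x. overlap s x \<le> ennreal C"
begin

lemma measurable_g_s [measurable]: "g \<in> borel_measurable borel" "s \<in> borel_measurable borel"
  using g s by (auto simp: L2_iff)

definition F where "F x = g x * cnj (s x)"

lemma F_measurable [measurable]: "F \<in> borel_measurable borel"
  unfolding F_def[abs_def] by measurable

lemma F_integrable: "integrable lborel F"
  unfolding F_def[abs_def] by (rule integrable_L2_mult[OF g s])

lemma periodization_sq_le:
  "nsq (periodization F x) \<le> (\<Sum>\<^sup>+n. ennreal (cmod (F (x + lattice n))))\<^sup>2"
  "(\<Sum>\<^sup>+n. ennreal (cmod (F (x + lattice n))))\<^sup>2 \<le>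
    (\<Sum>\<^sup>+n. nsq (g (x + lattice n)) * overlap s (x + lattice n))"
proof -
  have "(ennreal (cmod (periodization F x)))\<^sup>2 \<le> (\<Sum>\<^sup>+n. ennreal (cmod (F (x + lattice n))))\<^sup>2"
    unfolding periodization_def by (intro power_mono ennreal_cmod_integral_le) simp
  then show "nsq (periodization F x) \<le> (\<Sum>\<^sup>+n. ennreal (cmod (F (x + lattice n))))\<^sup>2"
    by (simp add: ennreal_power)
  show "(\<Sum>\<^sup>+n. ennreal (cmod (F (x + lattice n))))\<^sup>2 \<le>
    (\<Sum>\<^sup>+n. nsq (g (x + lattice n)) * overlap s (x + lattice n))"
    using sum_mult_sq_le[of "\<lambda>n. cmod (g (x + lattice n))" "\<lambda>n. cmod (s (x + lattice n))"]
    by (simp add: F_def norm_mult overlap_lattice)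
qed

lemma weighted_finite: "(\<integral>\<^sup>+x. nsq (g x) * overlap s x \<partial>lborel) < \<infinity>"
proof -
  have "(\<integral>\<^sup>+x. nsq (g x) * overlap s x \<partial>lborel) \<le> (\<integral>\<^sup>+x. nsq (g x) * ennreal C \<partial>lborel)"
    by (intro nn_integral_mono mult_left_mono overlap_le) auto
  also have "\<dots> = sqint lborel g * ennreal C"
    by (rule nn_integral_multc) auto
  also have "\<dots> < \<infinity>" using g by (auto simp: L2_iff ennreal_mult_less_top)
  finally show ?thesis .
qed

lemma periodization_sq_integral_le:
  "(\<integral>\<^sup>+x. (\<Sum>\<^sup>+n. ennreal (cmod (F (x + lattice n))))\<^sup>2 \<partial>torus) \<le>
    (\<integral>\<^sup>+x. nsq (g x) * overlap s x \<partial>lborel)"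
  by (subst nn_integral_tiling) (auto intro!: nn_integral_mono periodization_sq_le)

lemma periodization_integral_le:
  "(\<integral>\<^sup>+x. nsq (periodization F x) \<partial>torus) \<le>
    (\<integral>\<^sup>+x. nsq (g x) * overlap s x \<partial>lborel)"
  by (rule order_trans[OF nn_integral_mono[OF periodization_sq_le(1)] periodization_sq_integral_le])

lemma coefficients_eq:
  "(\<Sum>\<^sup>+m. nsq (\<integral>x. g x * cnj (s x) * chr m x \<partial>lborel)) =
    (\<integral>\<^sup>+x. nsq (periodization F x) \<partial>torus)"
proof -
  have "(\<Sum>\<^sup>+m. nsq (\<integral>x. g x * cnj (s x) * chr m x \<partial>lborel)) =
    (\<Sum>\<^sup>+m. nsq (\<integral>x. F x * cnj (chr m x) \<partial>lborel))"
    by (subst nn_integral_lattice_uminus[symmetric]) (simp add: chr_minus F_def)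
  also have "\<dots> = (\<integral>\<^sup>+x. nsq (periodization F x) \<partial>torus)"
    using le_less_trans[OF periodization_integral_le weighted_finite]
    by (intro parseval_periodization F_integrable)
  finally show ?thesis .
qed

lemma coefficients_upper:
  "(\<Sum>\<^sup>+m. nsq (\<integral>x. g x * cnj (s x) * chr m x \<partial>lborel)) \<le>
    (\<integral>\<^sup>+x. nsq (g x) * overlap s x \<partial>lborel)"
  unfolding coefficients_eq by (rule periodization_integral_le)

text \<open>The error stands on the right-hand side because subtraction in \<open>ennreal\<close>
  truncates. Unfolding the diagonal gives the main term; the off-diagonal part is symmetrized into a
  weight on \<open>cmod g ^ 2\<close>.\<close>

lemma coefficients_lower:
  "(\<integral>\<^sup>+x. nsq (g x) * nsq (s x) \<partial>lborel) \<le>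
    (\<Sum>\<^sup>+m. nsq (\<integral>x. g x * cnj (s x) * chr m x \<partial>lborel)) +
    (\<integral>\<^sup>+x. nsq (g x) * off_overlap s x \<partial>lborel)"
proof -
  interpret C: sigma_finite_measure "count_space (UNIV :: (int^2) set)" by (rule sigma_finite_count_int2)
  have m1[measurable]: "(\<lambda>x. \<Sum>\<^sup>+n. ennreal (cmod (F (x + lattice n)))) \<in> borel_measurable borel"
    by measurable
  have m2[measurable]: "(\<lambda>x. \<Sum>\<^sup>+n. nsq (g (x + lattice n)) * off_overlap s (x + lattice n)) \<in> borel_measurable borel"
    by measurable
  have "(\<integral>\<^sup>+x. (\<Sum>\<^sup>+n. ennreal (cmod (F (x + lattice n))))\<^sup>2 \<partial>torus) \<noteq> \<infinity>"
    using le_less_trans[OF periodization_sq_integral_le weighted_finite] by simp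
  \<comment> \<open>The comparison of diagonal and full sum needs absolute convergence at the point,
    and finiteness of the integral provides this almost everywhere.\<close>
  then have fin: "AE x in torus. (\<Sum>\<^sup>+n. ennreal (cmod (F (x + lattice n))))\<^sup>2 \<noteq> \<infinity>"
    by (rule nn_integral_PInf_AE[rotated]) measurable
  have "(\<integral>\<^sup>+x. nsq (g x) * nsq (s x) \<partial>lborel) = sqint lborel F"
    by (simp add: F_def norm_mult power_mult_distrib ennreal_mult)
  also have "\<dots> = (\<integral>\<^sup>+x. (\<Sum>\<^sup>+n. nsq (F (x + lattice n))) \<partial>torus)"
    by (rule nn_integral_tiling) measurable
  also have "\<dots> \<le> (\<integral>\<^sup>+x. nsq (periodization F x) +
      (\<Sum>\<^sup>+n. nsq (g (x + lattice n)) * off_overlap s (x + lattice n)) \<partial>torus)"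
  proof (rule nn_integral_mono_AE)
    show "AE x in torus. (\<Sum>\<^sup>+n. nsq (F (x + lattice n))) \<le> nsq (periodization F x) +
      (\<Sum>\<^sup>+n. nsq (g (x + lattice n)) * off_overlap s (x + lattice n))"
      using fin
    proof eventually_elim
      case (elim x)
      then have f: "(\<Sum>\<^sup>+n. ennreal (cmod (F (x + lattice n)))) < \<infinity>"
        by (auto simp: power2_eq_square ennreal_mult_eq_top_iff less_top)
      have "(\<Sum>\<^sup>+n. (\<Sum>\<^sup>+m. ennreal (cmod (F (x + lattice n))) * ennreal (cmod (F (x + lattice m))) * of_bool (m \<noteq> n)))
        \<le> (\<Sum>\<^sup>+n. nsq (g (x + lattice n)) * off_overlap s (x + lattice n))"
        using double_sum_am_gm[of "\<lambda>n. cmod (g (x + lattice n))" "\<lambda>n. cmod (s (x + lattice n))"]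
        by (simp add: nn_integral_cmult overlap_lattice F_def norm_mult)
      with sum_cmod_sq_le[OF f] show ?case
        unfolding periodization_def by (meson add_left_mono order_trans)
    qed
  qed
  also have "\<dots> = (\<integral>\<^sup>+x. nsq (periodization F x) \<partial>torus) +
     (\<integral>\<^sup>+x. (\<Sum>\<^sup>+n. nsq (g (x + lattice n)) * off_overlap s (x + lattice n)) \<partial>torus)"
    by (rule nn_integral_add) auto
  also have "(\<integral>\<^sup>+x. (\<Sum>\<^sup>+n. nsq (g (x + lattice n)) * off_overlap s (x + lattice n)) \<partial>torus)
     = (\<integral>\<^sup>+x. nsq (g x) * off_overlap s x \<partial>lborel)"
    by (rule nn_integral_tiling[symmetric]) measurable
  finally show ?thesis unfolding coefficients_eq .
qed

end

section \<open>Affine systems reduced to the integer lattice\<close>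

lemma diag2_nth [simp]: "(diag2 a b *v x) $ 1 = a * x $ 1" "(diag2 a b *v x) $ 2 = b * x $ 2"
  by (simp_all add: diag2_def matrix_vector_mult_def sum_2)

lemma det_diag2 [simp]: "det (diag2 a b) = a * b"
  by (simp add: diag2_def det_2)

lemma chr_diag2:
  assumes "a > 0" "b > 0"
  shows "cis (2 * pi * ((diag2 a b *v lattice m) \<bullet> (diag2 (1/a) (1/b) *v x))) = chr m x"
  using assms by (simp add: chr_def inner_2 field_simps)

lemma inner_transpose: "(A *v x) \<bullet> y = x \<bullet> (transpose A *v (y::real^2))" for A :: "real^2^2"
  by (metis dot_lmul_matrix vector_transpose_matrix transpose_matrix_vector inner_commute)

lemma affine_L2:
  assumes "f \<in> L2" and d: "det A \<noteq> 0"
  shows "(\<lambda>x::real^2. f (A *v x + w)) \<in> L2"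
proof -
  have [measurable]: "f \<in> borel_measurable borel" using assms by (simp add: L2_iff)
  have "sqint lborel f = (\<integral>\<^sup>+x. nsq (f (x + w)) \<partial>lborel)"
    by (rule nn_integral_translate[symmetric]) measurable
  also have "\<dots> = ennreal \<bar>det A\<bar> * (\<integral>\<^sup>+x. nsq (f (A *v x + w)) \<partial>lborel)"
    by (rule nn_integral_linear[OF d]) measurable
  finally show ?thesis using assms by (auto simp: L2_iff ennreal_mult_less_top)
qed

lemma linear_L2: "f \<in> L2 \<Longrightarrow> det A \<noteq> 0 \<Longrightarrow> (\<lambda>x::real^2. f (A *v x)) \<in> L2"
  using affine_L2[of f A 0] by simp

lemma inverse_matrix:
  fixes B :: "real^2^2"
  assumes "det B \<noteq> 0"
  obtains Bi where "B ** Bi = mat 1" "Bi ** B = mat 1" "det Bi = 1 / det B"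
proof -
  obtain Bi where Bi: "B ** Bi = mat 1" "Bi ** B = mat 1"
    using assms invertible_det_nz[of B] by (auto simp: invertible_def)
  have "det B * det Bi = 1" using det_mul[of B Bi] Bi by simp
  then show thesis using that Bi assms by (simp add: field_simps)
qed

lemma ft_affine:
  fixes B Bi :: "real^2^2"
  assumes [measurable]: "f \<in> borel_measurable borel" and B: "B ** Bi = mat 1" and d: "det Bi \<noteq> 0"
  shows "\<bar>det Bi\<bar> *\<^sub>R ft (\<lambda>y. f (Bi *v (y + w))) \<eta> = cis (2 * pi * (w \<bullet> \<eta>)) * ft f (transpose B *v \<eta>)"
proof -
  have "ft (\<lambda>y. f (Bi *v (y + w))) \<eta> = (\<integral>y. f (Bi *v (y + w)) * cis (- (2 * pi * ((y + w - w) \<bullet> \<eta>))) \<partial>lborel)"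
    by (simp add: ft_def)
  also have "\<dots> = (\<integral>y. f (Bi *v y) * cis (- (2 * pi * ((y - w) \<bullet> \<eta>))) \<partial>lborel)"
    by (rule integral_translate) measurable
  also have "\<dots> = (\<integral>y. cis (2 * pi * (w \<bullet> \<eta>)) * (f (Bi *v y) * cis (- (2 * pi * (y \<bullet> \<eta>)))) \<partial>lborel)"
    by (intro Bochner_Integration.integral_cong refl) (simp add: inner_diff_left cis_mult algebra_simps)
  also have "\<dots> = cis (2 * pi * (w \<bullet> \<eta>)) * (\<integral>y. f (Bi *v y) * cis (- (2 * pi * (y \<bullet> \<eta>))) \<partial>lborel)"
    by simp
  finally have 1: "ft (\<lambda>y. f (Bi *v (y + w))) \<eta> = cis (2 * pi * (w \<bullet> \<eta>)) * (\<integral>y. f (Bi *v y) * cis (- (2 * pi * (y \<bullet> \<eta>))) \<partial>lborel)" .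
  have "ft f (transpose B *v \<eta>) = \<bar>det Bi\<bar> *\<^sub>R (\<integral>y. f (Bi *v y) * cis (- (2 * pi * ((Bi *v y) \<bullet> (transpose B *v \<eta>)))) \<partial>lborel)"
    unfolding ft_def by (rule integral_linear[OF d]) measurable
  also have "(\<lambda>y. (Bi *v y) \<bullet> (transpose B *v \<eta>)) = (\<lambda>y. y \<bullet> \<eta>)"
    using B by (simp add: inner_transpose[symmetric] matrix_vector_mul_assoc del: transpose_matrix_vector)
  finally show ?thesis unfolding 1 by (simp add: fun_eq_iff)
qed

lemma compact_L2_affine:
  assumes f: "compact_L2 f" and B: "B ** Bi = mat 1" and d: "det Bi \<noteq> 0"
  shows "compact_L2 (\<lambda>y. f (Bi *v (y + w)))"
proof -
  have "(\<lambda>y. f (Bi *v y + Bi *v w)) \<in> L2" using f d by (intro affine_L2) (auto simp: compact_L2_def)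
  then have L: "(\<lambda>y. f (Bi *v (y + w))) \<in> L2" by (simp add: matrix_vector_right_distrib)
  obtain R where R: "R \<ge> 0" "\<And>x. f x \<noteq> 0 \<Longrightarrow> norm x \<le> R" using f by (auto simp: compact_L2_def)
  have "bounded_linear ((*v) B)" by (simp add: matrix_vector_mul_bounded_linear)
  then obtain K where K: "K > 0" "\<And>x. norm (B *v x) \<le> norm x * K" using bounded_linear.pos_bounded by blast
  have "norm y \<le> R * K + norm w" if "f (Bi *v (y + w)) \<noteq> 0" for y
  proof -
    have "y + w = B *v (Bi *v (y + w))" using B by (simp add: matrix_vector_mul_assoc)
    then have "norm (y + w) \<le> norm (Bi *v (y + w)) * K" using K(2)[of "Bi *v (y + w)"] by simp
    also have "\<dots> \<le> R * K" using R(2)[OF that] K(1) by simp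
    finally show ?thesis using norm_triangle_ineq4[of "y + w" w] by simp
  qed
  then show ?thesis using L R K unfolding compact_L2_def
    by (intro conjI exI[of _ "R * K + norm w"]) auto
qed

text \<open>The inner product with \<open>\<rho> * \<psi> (B x - diag2 a b m)\<close> seen in
  frequency, in the variable for which the sampling characters are the integer ones;
  \<open>a * b\<close> is the Jacobian of that rescaling.\<close>

definition lat_coef :: "real^2^2 \<Rightarrow> real \<Rightarrow> real \<Rightarrow> real \<Rightarrow> (real^2 \<Rightarrow> complex) \<Rightarrow> (real^2 \<Rightarrow> complex) \<Rightarrow> int^2 \<Rightarrow> complex"
  where "lat_coef B a b \<rho> s g m = of_real (\<rho> / (a * b)) *
    (\<integral>\<zeta>. g (transpose B *v (diag2 (1/a) (1/b) *v \<zeta>)) * cnj (s (diag2 (1/a) (1/b) *v \<zeta>)) * chr m \<zeta> \<partial>lborel)"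

definition lat_energy :: "real^2^2 \<Rightarrow> real \<Rightarrow> real \<Rightarrow> real \<Rightarrow> (real^2 \<Rightarrow> complex) \<Rightarrow> (real^2 \<Rightarrow> complex) \<Rightarrow> ennreal"
  where "lat_energy B a b \<rho> s g = (\<Sum>\<^sup>+m. nsq (lat_coef B a b \<rho> s g m))"

text \<open>The affine map is moved onto \<open>f\<close>, where bounded support survives, so that
  Parseval is needed for the unmodified generator only. Translation becomes a character, and the
  rescaling by \<open>diag2 (1/a) (1/b)\<close> makes that character \<open>chr m\<close>.\<close>

lemma L2_inner_lat_coef:
  assumes f: "compact_L2 f" and p: "fourier_pair \<psi> s" and d: "det B \<noteq> 0" and ab: "a > 0" "b > 0"
  shows "L2_inner f (\<lambda>x. of_real \<rho> * \<psi> (B *v x - diag2 a b *v lattice m)) = lat_coef B a b \<rho> s (ft f) m"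
proof -
  obtain Bi where Bi: "B ** Bi = mat 1" "Bi ** B = mat 1" "det Bi = 1 / det B" using inverse_matrix[OF d] .
  have dB: "det Bi \<noteq> 0" using Bi d by simp
  have [measurable]: "f \<in> borel_measurable borel" "\<psi> \<in> borel_measurable borel" "s \<in> borel_measurable borel"
    using f p by (auto simp: compact_L2_def fourier_pair_def L2_iff)
  define w where "w = diag2 a b *v lattice m"
  define h where "h y = f (Bi *v (y + w))" for y
  have h: "compact_L2 h" unfolding h_def[abs_def] by (rule compact_L2_affine[OF f Bi(1) dB])
  have "(\<integral>x. f x * cnj (\<psi> (B *v x - w)) \<partial>lborel) = \<bar>det Bi\<bar> *\<^sub>R (\<integral>y. f (Bi *v y) * cnj (\<psi> (B *v (Bi *v y) - w)) \<partial>lborel)"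
    by (rule integral_linear[OF dB]) measurable
  also have "\<dots> = \<bar>det Bi\<bar> *\<^sub>R (\<integral>y. f (Bi *v y) * cnj (\<psi> (y - w)) \<partial>lborel)"
    using Bi by (simp add: matrix_vector_mul_assoc)
  also have "(\<integral>y. f (Bi *v y) * cnj (\<psi> (y - w)) \<partial>lborel) = (\<integral>y. f (Bi *v (y + w)) * cnj (\<psi> (y + w - w)) \<partial>lborel)"
    by (rule integral_translate[symmetric]) measurable
  also have "\<dots> = (\<integral>y. h y * cnj (\<psi> y) \<partial>lborel)" by (simp add: h_def)
  also have "\<dots> = (\<integral>\<eta>. ft h \<eta> * cnj (s \<eta>) \<partial>lborel)"
    by (rule fourier_pair_parseval[OF h p])
  also have "\<bar>det Bi\<bar> *\<^sub>R \<dots> = (\<integral>\<eta>. (\<bar>det Bi\<bar> *\<^sub>R ft h \<eta>) * cnj (s \<eta>) \<partial>lborel)"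
    by (simp add: scaleR_conv_of_real mult.assoc)
  also have "\<dots> = (\<integral>\<eta>. cis (2 * pi * (w \<bullet> \<eta>)) * ft f (transpose B *v \<eta>) * cnj (s \<eta>) \<partial>lborel)"
    unfolding h_def[abs_def] by (simp only: ft_affine[OF \<open>f \<in> borel_measurable borel\<close> Bi(1) dB])
  also have "\<dots> = \<bar>det (diag2 (1/a) (1/b))\<bar> *\<^sub>R (\<integral>\<zeta>. cis (2 * pi * (w \<bullet> (diag2 (1/a) (1/b) *v \<zeta>))) *
     ft f (transpose B *v (diag2 (1/a) (1/b) *v \<zeta>)) * cnj (s (diag2 (1/a) (1/b) *v \<zeta>)) \<partial>lborel)"
  proof (rule integral_linear)
    show "(\<lambda>\<eta>. cis (2 * pi * (w \<bullet> \<eta>)) * ft f (transpose B *v \<eta>) * cnj (s \<eta>)) \<in> borel_measurable borel"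
      by measurable
  qed (use ab in simp)
  also have "\<dots> = of_real (1 / (a * b)) * (\<integral>\<zeta>. ft f (transpose B *v (diag2 (1/a) (1/b) *v \<zeta>)) * cnj (s (diag2 (1/a) (1/b) *v \<zeta>)) * chr m \<zeta> \<partial>lborel)"
    unfolding w_def chr_diag2[OF ab] using ab by (simp add: scaleR_conv_of_real mult_ac)
  finally show ?thesis
    unfolding L2_inner_def lat_coef_def w_def[symmetric] by (simp add: mult_ac)
qed

text \<open>The overlap in the original frequency variable: the translates run over the lattice dual
  to the sampling lattice, which spreads out as \<open>a\<close> and \<open>b\<close>
  shrink.\<close>

definition lat_overlap :: "real \<Rightarrow> real \<Rightarrow> (real^2 \<Rightarrow> complex) \<Rightarrow> real^2 \<Rightarrow> ennreal"
  where "lat_overlap a b s \<eta> = (\<Sum>\<^sup>+m. ennreal (cmod (s \<eta>)) * ennreal (cmod (s (\<eta> + diag2 (1/a) (1/b) *v lattice m))))"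

definition lat_off_overlap :: "real \<Rightarrow> real \<Rightarrow> (real^2 \<Rightarrow> complex) \<Rightarrow> real^2 \<Rightarrow> ennreal"
  where "lat_off_overlap a b s \<eta> = (\<Sum>\<^sup>+m. ennreal (cmod (s \<eta>)) * ennreal (cmod (s (\<eta> + diag2 (1/a) (1/b) *v lattice m))) * of_bool (m \<noteq> 0))"

lemma nn_integral_change:
  fixes A :: "real^2^2"
  assumes [measurable]: "w \<in> borel_measurable borel" "h \<in> borel_measurable borel" "T \<in> borel_measurable borel"
    and d: "det A \<noteq> 0" and T: "\<And>x. T (A *v x) = x"
  shows "ennreal \<bar>det A\<bar> * (\<integral>\<^sup>+x. h (A *v x) * w x \<partial>lborel) = (\<integral>\<^sup>+\<xi>. h \<xi> * w (T \<xi>) \<partial>lborel)"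
  by (subst (2) nn_integral_linear[OF d]) (auto simp: T)

text \<open>The condition on \<open>\<rho>\<close> is L2 normalization of the dilated generator. The
  map \<open>T\<close> undoes the action of \<open>transpose B\<close> on frequencies and is a
  parameter, so that each system can supply an explicit formula.\<close>

locale lattice_system =
  fixes B :: "real^2^2" and a b \<rho> :: real and s :: "real^2 \<Rightarrow> complex" and C :: real and T :: "real^2 \<Rightarrow> real^2"
  assumes s: "s \<in> L2" and ab: "a > 0" "b > 0" and dB: "det B > 0" and \<rho>: "\<rho>\<^sup>2 = det B"
    and overlap_le: "\<And>\<eta>. lat_overlap a b s \<eta> \<le> ennreal C"
    and T[measurable]: "T \<in> borel_measurable borel" and T_eq: "\<And>\<eta>. T (transpose B *v \<eta>) = \<eta>"
begin

lemma s_measurable [measurable]: "s \<in> borel_measurable borel"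
  using s by (simp add: L2_iff)

definition D where "D = diag2 (1/a) (1/b)"
definition A where "A = transpose B ** D"
definition s' where "s' x = s (D *v x)"

lemma A_mult: "A *v x = transpose B *v (D *v x)"
  by (simp add: A_def matrix_vector_mul_assoc)

lemma det_A: "det A = det B / (a * b)"
  by (simp add: A_def D_def det_mul)

lemma det_A_pos: "det A > 0"
  using ab dB by (simp add: det_A)

lemma s'_measurable [measurable]: "s' \<in> borel_measurable borel"
  unfolding s'_def[abs_def] by measurable

lemma overlap_s': "overlap s' x = lat_overlap a b s (D *v x)" "off_overlap s' x = lat_off_overlap a b s (D *v x)"
  by (simp_all add: overlap_def off_overlap_def lat_overlap_def lat_off_overlap_def s'_def D_def matrix_vector_right_distrib)

lemma lattice_generator:
  assumes "g \<in> L2"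
  shows "lattice_generator (\<lambda>x. g (A *v x)) s' C"
proof
  show "(\<lambda>x. g (A *v x)) \<in> L2" using assms det_A_pos by (intro linear_L2) auto
  show "s' \<in> L2" unfolding s'_def[abs_def] using ab s by (intro linear_L2) (auto simp: D_def)
  show "overlap s' x \<le> ennreal C" for x unfolding overlap_s' by (rule overlap_le)
qed

definition M where "M = diag2 a b"

lemma MD: "D *v (M *v x) = x" "M *v (D *v x) = x"
  using ab by (simp_all add: M_def D_def vec_eq_iff forall_2)

lemma inverse_A: "M *v T (A *v x) = x"
  by (simp add: A_mult T_eq MD del: transpose_matrix_vector)

lemma lat_coef_eq: "lat_coef B a b \<rho> s g m = of_real (\<rho> / (a * b)) * (\<integral>x. g (A *v x) * cnj (s' x) * chr m x \<partial>lborel)"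
  by (simp add: lat_coef_def A_mult s'_def D_def)

text \<open>Of the squared amplitude, one factor is the Jacobian of \<open>A\<close>, to be consumed
  by the substitution back to \<open>\<xi>\<close>. What remains is \<open>1 / (a * b)\<close>, the
  same for every scale and shear.\<close>

lemma lat_energy_eq: "lat_energy B a b \<rho> s g = ennreal (1 / (a * b)) *
   (ennreal \<bar>det A\<bar> * (\<Sum>\<^sup>+m. nsq (\<integral>x. g (A *v x) * cnj (s' x) * chr m x \<partial>lborel)))"
proof -
  have "(\<rho> / (a * b))\<^sup>2 = 1 / (a * b) * \<bar>det A\<bar>"
    using det_A_pos dB \<rho> ab by (simp add: det_A power_divide power2_eq_square)
  then have "(cmod (lat_coef B a b \<rho> s g m))\<^sup>2 = 1 / (a * b) * \<bar>det A\<bar> *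
    (cmod (\<integral>x. g (A *v x) * cnj (s' x) * chr m x \<partial>lborel))\<^sup>2" for m
    unfolding lat_coef_eq norm_mult power_mult_distrib norm_of_real power2_abs by simp
  then have "nsq (lat_coef B a b \<rho> s g m) = ennreal (1 / (a * b)) * ennreal \<bar>det A\<bar> *
    nsq (\<integral>x. g (A *v x) * cnj (s' x) * chr m x \<partial>lborel)" for m
    using ab by (simp only: ennreal_mult[symmetric] zero_le_power2 abs_ge_zero mult_nonneg_nonneg divide_nonneg_nonneg
        zero_le_one mult_pos_pos less_imp_le)
  then show ?thesis unfolding lat_energy_def by (simp add: nn_integral_cmult mult.assoc)
qed

lemma lat_energy_upper:
  assumes g: "g \<in> L2"
  shows "lat_energy B a b \<rho> s g \<le> ennreal (1 / (a * b)) * (\<integral>\<^sup>+\<xi>. nsq (g \<xi>) * lat_overlap a b s (T \<xi>) \<partial>lborel)"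
proof -
  have [measurable]: "g \<in> borel_measurable borel" using g by (simp add: L2_iff)
  interpret lattice_generator "\<lambda>x. g (A *v x)" s' C by (rule lattice_generator[OF g])
  have "ennreal \<bar>det A\<bar> * (\<integral>\<^sup>+x. nsq (g (A *v x)) * overlap s' x \<partial>lborel) = 
     (\<integral>\<^sup>+\<xi>. nsq (g \<xi>) * overlap s' (M *v T \<xi>) \<partial>lborel)"
    using det_A_pos inverse_A by (intro nn_integral_change[where h="\<lambda>x. nsq (g x)"]) auto
  moreover have "ennreal \<bar>det A\<bar> * (\<Sum>\<^sup>+m. nsq (\<integral>x. g (A *v x) * cnj (s' x) * chr m x \<partial>lborel))
      \<le> ennreal \<bar>det A\<bar> * (\<integral>\<^sup>+x. nsq (g (A *v x)) * overlap s' x \<partial>lborel)"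
    by (intro mult_left_mono coefficients_upper) simp
  ultimately show ?thesis
    unfolding lat_energy_eq by (intro mult_left_mono) (simp_all add: overlap_s' MD)
qed

lemma lat_energy_lower:
  assumes g: "g \<in> L2"
  shows "ennreal (1 / (a * b)) * (\<integral>\<^sup>+\<xi>. nsq (g \<xi>) * nsq (s (T \<xi>)) \<partial>lborel) \<le>
    lat_energy B a b \<rho> s g + ennreal (1 / (a * b)) * (\<integral>\<^sup>+\<xi>. nsq (g \<xi>) * lat_off_overlap a b s (T \<xi>) \<partial>lborel)"
proof -
  have [measurable]: "g \<in> borel_measurable borel" using g by (simp add: L2_iff)
  interpret lattice_generator "\<lambda>x. g (A *v x)" s' C by (rule lattice_generator[OF g])
  have 1: "ennreal \<bar>det A\<bar> * (\<integral>\<^sup>+x. nsq (g (A *v x)) * off_overlap s' x \<partial>lborel) = 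
     (\<integral>\<^sup>+\<xi>. nsq (g \<xi>) * off_overlap s' (M *v T \<xi>) \<partial>lborel)"
    using det_A_pos inverse_A by (intro nn_integral_change[where h="\<lambda>x. nsq (g x)"]) auto
  have 2: "ennreal \<bar>det A\<bar> * (\<integral>\<^sup>+x. nsq (g (A *v x)) * nsq (s' x) \<partial>lborel) = 
     (\<integral>\<^sup>+\<xi>. nsq (g \<xi>) * nsq (s' (M *v T \<xi>)) \<partial>lborel)"
    using det_A_pos inverse_A by (intro nn_integral_change[where h="\<lambda>x. nsq (g x)" and w="\<lambda>x. nsq (s' x)"]) auto
  have "ennreal (1 / (a * b)) * (ennreal \<bar>det A\<bar> * (\<integral>\<^sup>+x. nsq (g (A *v x)) * nsq (s' x) \<partial>lborel)) \<le>
     ennreal (1 / (a * b)) * (ennreal \<bar>det A\<bar> * ((\<Sum>\<^sup>+m. nsq (\<integral>x. g (A *v x) * cnj (s' x) * chr m x \<partial>lborel))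
       + (\<integral>\<^sup>+x. nsq (g (A *v x)) * off_overlap s' x \<partial>lborel)))"
    by (intro mult_left_mono coefficients_lower) auto
  then show ?thesis
    unfolding lat_energy_eq distrib_left 1 2 by (simp add: overlap_s' MD s'_def)
qed

text \<open>Used to compare the energy of the high-frequency part with that of the whole function:
  their difference is the low-frequency part.\<close>

lemma lat_energy_add_le:
  assumes g: "g \<in> L2" and h: "h \<in> L2"
  shows "lat_energy B a b \<rho> s (\<lambda>x. g x + h x) \<le> 2 * lat_energy B a b \<rho> s g + 2 * lat_energy B a b \<rho> s h"
proof -
  interpret G: lattice_generator "\<lambda>x. g (A *v x)" s' C by (rule lattice_generator[OF g])
  interpret H: lattice_generator "\<lambda>x. h (A *v x)" s' C by (rule lattice_generator[OF h])
  have add: "lat_coef B a b \<rho> s (\<lambda>x. g x + h x) m = lat_coef B a b \<rho> s g m + lat_coef B a b \<rho> s h m" for m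
  proof -
    have i: "integrable lborel (\<lambda>x. g (A *v x) * cnj (s' x) * chr m x)" "integrable lborel (\<lambda>x. h (A *v x) * cnj (s' x) * chr m x)"
      using integrable_mult_cis[OF G.F_integrable, of "\<lambda>x. 2 * pi * (lattice m \<bullet> x)"]
        integrable_mult_cis[OF H.F_integrable, of "\<lambda>x. 2 * pi * (lattice m \<bullet> x)"]
      by (simp_all add: chr_def G.F_def H.F_def)
    show ?thesis unfolding lat_coef_eq using i by (simp add: distrib_right distrib_left)
  qed
  have "lat_energy B a b \<rho> s (\<lambda>x. g x + h x) \<le> (\<Sum>\<^sup>+m. 2 * nsq (lat_coef B a b \<rho> s g m) + 2 * nsq (lat_coef B a b \<rho> s h m))"
    unfolding lat_energy_def add
  proof (rule nn_integral_mono)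
    fix m
    have "nsq (lat_coef B a b \<rho> s g m + lat_coef B a b \<rho> s h m) \<le> ennreal (2 * (cmod (lat_coef B a b \<rho> s g m))\<^sup>2 + 2 * (cmod (lat_coef B a b \<rho> s h m))\<^sup>2)"
      by (intro ennreal_leI cmod_add_sq_le)
    then show "nsq (lat_coef B a b \<rho> s g m + lat_coef B a b \<rho> s h m) \<le> 2 * nsq (lat_coef B a b \<rho> s g m) + 2 * nsq (lat_coef B a b \<rho> s h m)"
      by (simp add: ennreal_mult)
  qed
  also have "\<dots> = 2 * lat_energy B a b \<rho> s g + 2 * lat_energy B a b \<rho> s h"
    unfolding lat_energy_def by (simp add: nn_integral_add nn_integral_cmult)
  finally show ?thesis .
qed

end

subsection \<open>Weights and overlap sums\<close>

text \<open>Decay of order 2, summable over the integers. The generators decay like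
  \<open>(wt t) ^ 2\<close>; one factor goes into lattice sums and the other is kept.\<close>

definition wt :: "real \<Rightarrow> real"
  where "wt t = 1 / (1 + \<bar>t\<bar>)\<^sup>2"

lemma wt_pos [simp]: "0 < wt t"
  by (simp add: wt_def add_pos_nonneg)

lemma wt_nonneg [simp]: "0 \<le> wt t"
  using wt_pos[of t] by linarith

lemma wt_le_1: "wt t \<le> 1"
  by (simp add: wt_def divide_le_eq_1 one_le_power)

lemma wt_measurable [measurable]: "wt \<in> borel_measurable borel"
  unfolding wt_def[abs_def] by measurable

lemma wt_antimono: "\<bar>s\<bar> \<le> \<bar>t\<bar> \<Longrightarrow> wt t \<le> wt s"
  unfolding wt_def by (intro divide_left_mono power_mono mult_pos_pos zero_less_power) auto

text \<open>A Peetre-type inequality: \<open>1 + \<bar>d\<bar>\<close> is at most the product of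
  \<open>1 + \<bar>x\<bar>\<close> and \<open>1 + \<bar>x + d\<bar>\<close>, so two points at
  distance \<open>d\<close> cannot both be near the origin.\<close>

lemma wt_mult: "wt x * wt (x + d) \<le> wt d"
proof -
  have "1 + \<bar>d\<bar> \<le> (1 + \<bar>x\<bar>) * (1 + \<bar>x + d\<bar>)"
  proof -
    have "\<bar>d\<bar> \<le> \<bar>x\<bar> + \<bar>x + d\<bar>" by linarith
    moreover have "0 \<le> \<bar>x\<bar> * \<bar>x + d\<bar>" by simp
    moreover have "(1 + \<bar>x\<bar>) * (1 + \<bar>x + d\<bar>) = 1 + \<bar>x\<bar> + \<bar>x + d\<bar> + \<bar>x\<bar> * \<bar>x + d\<bar>"
      by (simp add: distrib_left distrib_right)
    ultimately show ?thesis by linarith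
  qed
  then have "(1 + \<bar>d\<bar>)\<^sup>2 \<le> ((1 + \<bar>x\<bar>) * (1 + \<bar>x + d\<bar>))\<^sup>2" by (intro power_mono) auto
  then have "1 / ((1 + \<bar>x\<bar>) * (1 + \<bar>x + d\<bar>))\<^sup>2 \<le> 1 / (1 + \<bar>d\<bar>)\<^sup>2"
    by (intro divide_left_mono mult_pos_pos zero_less_power) (auto simp: add_pos_nonneg)
  then show ?thesis by (simp add: wt_def power_mult_distrib)
qed

lemma wt_divide_le:
  assumes "0 < a" "a \<le> 1" shows "wt (t / a) \<le> wt t"
proof (rule wt_antimono)
  have "\<bar>t\<bar> * a \<le> \<bar>t\<bar> * 1" using assms by (intro mult_left_mono) auto
  then show "\<bar>t\<bar> \<le> \<bar>t / a\<bar>" using assms by (simp add: abs_divide field_simps)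
qed

text \<open>The origin of every gain \<open>c1 ^ 2\<close>: a nonzero coordinate of the dual lattice
  is at least \<open>1 / a\<close>, and \<open>1 + r \<le> 2 * (a + r)\<close> once
  \<open>r \<ge> 1\<close>.\<close>

lemma wt_divide_int:
  assumes "0 < a" "k \<noteq> 0" shows "wt (real_of_int k / a) \<le> 4 * a\<^sup>2 * wt (real_of_int k)"
proof -
  define r where "r = \<bar>real_of_int k\<bar>"
  have r: "r \<ge> 1" using assms unfolding r_def by linarith
  have 1: "a * (1 + r / a) = a + r" using assms by (simp add: field_simps)
  have "(1 + r)\<^sup>2 \<le> (2 * (a * (1 + r / a)))\<^sup>2"
    unfolding 1 using r assms by (intro power_mono) auto
  also have "\<dots> = 4 * a\<^sup>2 * (1 + r / a)\<^sup>2" by (simp add: power_mult_distrib)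
  finally have "1 / (1 + r / a)\<^sup>2 \<le> 4 * a\<^sup>2 / (1 + r)\<^sup>2"
    using r assms by (simp add: field_simps add_pos_nonneg)
  then show ?thesis using assms by (simp add: wt_def r_def abs_divide)
qed

text \<open>The term at 0 is 1, and the two terms at \<open>N + 1\<close> and
  \<open>- (N + 1)\<close> are each below \<open>1 / (N + 1) - 1 / (N + 2)\<close>; the right-hand
  side is the telescoped sum.\<close>

lemma sum_wt_int_symmetric: "(\<Sum>k\<in>{- int N..int N}. wt (real_of_int k)) \<le> 3 - 2 / (real N + 1)"
proof (induction N)
  case 0 then show ?case by (simp add: wt_def)
next
  case (Suc N)
  have eq: "{- int (Suc N)..int (Suc N)} = insert (- int (Suc N)) (insert (int (Suc N)) {- int N..int N})"
    by auto
  have w: "wt (real_of_int (int (Suc N))) \<le> 1 / (real N + 1) - 1 / (real N + 2)"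
          "wt (real_of_int (- int (Suc N))) \<le> 1 / (real N + 1) - 1 / (real N + 2)"
  proof -
    have "1 / (real N + 2)\<^sup>2 \<le> 1 / ((real N + 1) * (real N + 2))"
      unfolding power2_eq_square by (intro divide_left_mono mult_right_mono) auto
    also have "\<dots> = 1 / (real N + 1) - 1 / (real N + 2)" by (simp add: field_simps)
    finally show "wt (real_of_int (int (Suc N))) \<le> 1 / (real N + 1) - 1 / (real N + 2)"
          "wt (real_of_int (- int (Suc N))) \<le> 1 / (real N + 1) - 1 / (real N + 2)"
      by (simp_all add: wt_def add.commute)
  qed
  have "(\<Sum>k\<in>{- int (Suc N)..int (Suc N)}. wt (real_of_int k)) =
     wt (real_of_int (- int (Suc N))) + (wt (real_of_int (int (Suc N))) + (\<Sum>k\<in>{- int N..int N}. wt (real_of_int k)))"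
    unfolding eq by (subst sum.insert, simp, simp, subst sum.insert) auto
  also have "\<dots> \<le> 3 - 2 / (real (Suc N) + 1)"
    using w Suc.IH by (simp add: algebra_simps)
  finally show ?case .
qed

lemma sum_wt_int:
  assumes "finite K" shows "(\<Sum>k\<in>K. wt (real_of_int k)) \<le> 3"
proof -
  obtain N where N: "K \<subseteq> {- int N..int N}"
  proof -
    obtain M where "\<And>k. k \<in> K \<Longrightarrow> \<bar>k\<bar> \<le> M"
      using assms by (metis finite_imageI finite_set_of_finite_funs bdd_above_finite bdd_above.E imageI)
    then have "K \<subseteq> {- int (nat M)..int (nat M)}" by force
    then show thesis by (rule that)
  qed
  have "(\<Sum>k\<in>K. wt (real_of_int k)) \<le> (\<Sum>k\<in>{- int N..int N}. wt (real_of_int k))"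
    using N by (intro sum_mono2) auto
  also have "\<dots> \<le> 3" using sum_wt_int_symmetric[of N] by (smt (verit) divide_nonneg_nonneg of_nat_0_le_iff)
  finally show ?thesis .
qed

text \<open>Replacing \<open>x\<close> by its floor moves each point by less than 1 and costs a
  factor at most 4; the bound for integer points is 3.\<close>

lemma sum_wt_int_shift:
  assumes "finite K" shows "(\<Sum>k\<in>K. wt (real_of_int k + x)) \<le> 12"
proof -
  have "wt (real_of_int k + x) \<le> 4 * wt (real_of_int (k + \<lfloor>x\<rfloor>))" for k
  proof -
    define l where "l = k + \<lfloor>x\<rfloor>"
    have "1 + \<bar>real_of_int l\<bar> \<le> 2 * (1 + \<bar>real_of_int k + x\<bar>)" 
    proof -
      have *: "1 + \<bar>u\<bar> \<le> 2 * (1 + \<bar>v\<bar>)" if "u \<le> v" "v < u + 1" for u v :: real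
        using that by (auto simp: abs_if)
      show ?thesis by (rule *) (use floor_correct[of x] in \<open>auto simp: l_def\<close>)
    qed
    then have "(1 + \<bar>real_of_int l\<bar>)\<^sup>2 \<le> (2 * (1 + \<bar>real_of_int k + x\<bar>))\<^sup>2" by (intro power_mono) auto
    then have "(1 + \<bar>real_of_int l\<bar>)\<^sup>2 \<le> 4 * (1 + \<bar>real_of_int k + x\<bar>)\<^sup>2"
      unfolding power_mult_distrib by simp
    moreover have "0 < (1 + \<bar>real_of_int l\<bar>)\<^sup>2" "0 < (1 + \<bar>real_of_int k + x\<bar>)\<^sup>2" by (simp_all add: add_pos_nonneg)
    ultimately show ?thesis unfolding wt_def l_def[symmetric] by (simp add: field_simps)
  qed
  then have "(\<Sum>k\<in>K. wt (real_of_int k + x)) \<le> (\<Sum>k\<in>K. 4 * wt (real_of_int (k + \<lfloor>x\<rfloor>)))"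
    by (intro sum_mono)
  also have "\<dots> = 4 * (\<Sum>l\<in>(\<lambda>k. k + \<lfloor>x\<rfloor>) ` K. wt (real_of_int l))"
    by (subst sum.reindex) (auto simp: sum_distrib_left inj_on_def)
  also have "\<dots> \<le> 4 * 3" using assms by (intro mult_left_mono sum_wt_int) auto
  finally show ?thesis by simp
qed

lemma nn_sum_wt_int: "(\<Sum>\<^sup>+k. ennreal (wt (real_of_int k))) \<le> 3"
proof -
  have sm: "(\<lambda>k. wt (real_of_int k)) summable_on UNIV"
    by (intro nonneg_bdd_above_summable_on bdd_aboveI[of _ 3]) (auto simp: sum_wt_int)
  have "infsum (\<lambda>k. wt (real_of_int k)) UNIV \<le> 3"
    by (intro infsum_le_finite_sums sm sum_wt_int)
  then have "ennreal (infsum (\<lambda>k. wt (real_of_int k)) UNIV) \<le> ennreal 3" by (rule ennreal_leI)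
  then show ?thesis using nn_integral_count_space_infsum[OF sm] by simp
qed

lemma nn_sum_wt_int2:
  "(\<integral>\<^sup>+m. ennreal (wt (real_of_int (m$1)) * wt (real_of_int (m$2))) \<partial>count_space (UNIV :: (int^2) set)) \<le> 9"
proof -
  have bij: "bij_betw (\<lambda>p. vector [fst p, snd p] :: int^2) UNIV UNIV"
    by (rule bij_betwI[where g="\<lambda>m. (m$1, m$2)"]) (auto simp: vec_eq_iff forall_2)
  have "(\<integral>\<^sup>+m. ennreal (wt (real_of_int (m$1)) * wt (real_of_int (m$2))) \<partial>count_space (UNIV :: (int^2) set)) =
    (\<Sum>\<^sup>+p. ennreal (wt (real_of_int (fst p)) * wt (real_of_int (snd p))))"
    by (subst nn_integral_bij_count_space[OF bij, symmetric]) simp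
  also have "\<dots> = (\<Sum>\<^sup>+k. (\<Sum>\<^sup>+l. ennreal (wt (real_of_int k)) * ennreal (wt (real_of_int l))))"
    by (subst nn_integral_fst_count_space[symmetric]) (simp add: ennreal_mult)
  also have "\<dots> = (\<Sum>\<^sup>+k. ennreal (wt (real_of_int k))) * (\<Sum>\<^sup>+l. ennreal (wt (real_of_int l)))"
    by (simp add: nn_integral_cmult nn_integral_multc)
  also have "\<dots> \<le> 3 * 3" by (intro mult_mono nn_sum_wt_int) auto
  finally show ?thesis by simp
qed

section \<open>Overlap bounds for generators with decay of order 4\<close>

lemma decay_product:
  fixes s :: "real^2 \<Rightarrow> complex"
  assumes dec: "\<And>\<eta>. cmod (s \<eta>) \<le> K * p \<eta> * (wt (\<eta>$1))\<^sup>2 * (wt (\<eta>$2))\<^sup>2"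
    and p: "\<And>\<eta>. 0 \<le> p \<eta>" "\<And>\<eta>. p \<eta> \<le> 1" and K: "0 \<le> K"
  shows "cmod (s \<eta>) * cmod (s (\<eta> + d)) \<le> K\<^sup>2 * p \<eta> * wt (\<eta>$1) * wt (\<eta>$2) * (wt (d$1) * wt (d$2))"
proof -
  have sq: "(wt t)\<^sup>2 \<le> wt t" for t using wt_le_1[of t] by (simp add: power2_eq_square mult_left_le_one_le)
  have "cmod (s (\<eta> + d)) \<le> K * p (\<eta> + d) * (wt (\<eta>$1 + d$1))\<^sup>2 * (wt (\<eta>$2 + d$2))\<^sup>2"
    using dec[of "\<eta> + d"] by simp
  also have "\<dots> \<le> K * 1 * wt (\<eta>$1 + d$1) * wt (\<eta>$2 + d$2)"
    using p K sq by (intro mult_mono mult_nonneg_nonneg) auto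
  finally have 2: "cmod (s (\<eta> + d)) \<le> K * wt (\<eta>$1 + d$1) * wt (\<eta>$2 + d$2)" by simp
  have "cmod (s \<eta>) * cmod (s (\<eta> + d)) \<le> (K * p \<eta> * (wt (\<eta>$1))\<^sup>2 * (wt (\<eta>$2))\<^sup>2) * (K * wt (\<eta>$1 + d$1) * wt (\<eta>$2 + d$2))"
    using p K by (intro mult_mono dec 2) auto
  \<comment> \<open>One \<open>wt\<close> of each coordinate of \<open>\<eta>\<close> is paired with
    the translate to give decay in \<open>d\<close>; the other survives, as does
    \<open>p \<eta>\<close>, for the later sum over scales and shears.\<close>
  also have "\<dots> = K\<^sup>2 * p \<eta> * wt (\<eta>$1) * wt (\<eta>$2) * ((wt (\<eta>$1) * wt (\<eta>$1 + d$1)) * (wt (\<eta>$2) * wt (\<eta>$2 + d$2)))"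
    by (simp add: power2_eq_square mult_ac)
  also have "\<dots> \<le> K\<^sup>2 * p \<eta> * wt (\<eta>$1) * wt (\<eta>$2) * (wt (d$1) * wt (d$2))"
    using p K by (intro mult_left_mono mult_mono wt_mult) auto
  finally show ?thesis .
qed

lemma lat_overlap_le:
  fixes s :: "real^2 \<Rightarrow> complex"
  assumes dec: "\<And>\<eta>. cmod (s \<eta>) \<le> K * p \<eta> * (wt (\<eta>$1))\<^sup>2 * (wt (\<eta>$2))\<^sup>2"
    and p: "\<And>\<eta>. 0 \<le> p \<eta>" "\<And>\<eta>. p \<eta> \<le> 1" and K: "0 \<le> K"
    and ab: "0 < a" "0 < b" "a \<le> 1" "b \<le> 1"
  shows "lat_overlap a b s \<eta> \<le> ennreal (9 * K\<^sup>2 * (p \<eta> * wt (\<eta>$1) * wt (\<eta>$2)))"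
proof -
  define W where "W = K\<^sup>2 * (p \<eta> * wt (\<eta>$1) * wt (\<eta>$2))"
  have W: "0 \<le> W" using p K by (simp add: W_def)
  have "lat_overlap a b s \<eta> \<le> (\<integral>\<^sup>+m. ennreal W * ennreal (wt (real_of_int (m$1)) * wt (real_of_int (m$2))) \<partial>count_space (UNIV :: (int^2) set))"
    unfolding lat_overlap_def
  proof (rule nn_integral_mono)
    fix m :: "int^2"
    have "cmod (s \<eta>) * cmod (s (\<eta> + diag2 (1/a) (1/b) *v lattice m)) \<le> W * (wt (real_of_int (m$1) / a) * wt (real_of_int (m$2) / b))"
      using decay_product[OF dec p K, of \<eta> "diag2 (1/a) (1/b) *v lattice m"] by (simp add: W_def mult_ac)
    also have "\<dots> \<le> W * (wt (real_of_int (m$1)) * wt (real_of_int (m$2)))"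
      using W ab by (intro mult_left_mono mult_mono wt_divide_le) auto
    finally show "ennreal (cmod (s \<eta>)) * ennreal (cmod (s (\<eta> + diag2 (1/a) (1/b) *v lattice m))) \<le>
      ennreal W * ennreal (wt (real_of_int (m$1)) * wt (real_of_int (m$2)))"
      using W by (simp add: ennreal_mult[symmetric] ennreal_leI)
  qed
  also have "\<dots> \<le> ennreal W * 9"
    by (simp add: nn_integral_cmult mult_left_mono nn_sum_wt_int2)
  also have "\<dots> = ennreal (W * 9)" using W by (simp add: ennreal_mult)
  finally show ?thesis by (simp add: W_def mult_ac)
qed

text \<open>A nonzero lattice point has a nonzero coordinate, and that coordinate alone gives
  \<open>4 * c ^ 2\<close>; the other is merely bounded by its integer weight. The factor 36 is this
  4 times the 9 of the full double sum.\<close>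

lemma lat_off_overlap_le:
  fixes s :: "real^2 \<Rightarrow> complex"
  assumes dec: "\<And>\<eta>. cmod (s \<eta>) \<le> K * p \<eta> * (wt (\<eta>$1))\<^sup>2 * (wt (\<eta>$2))\<^sup>2"
    and p: "\<And>\<eta>. 0 \<le> p \<eta>" "\<And>\<eta>. p \<eta> \<le> 1" and K: "0 \<le> K"
    and ab: "0 < a" "0 < b" "a \<le> c" "b \<le> c" "c \<le> 1"
  shows "lat_off_overlap a b s \<eta> \<le> ennreal (36 * c\<^sup>2 * K\<^sup>2 * (p \<eta> * wt (\<eta>$1) * wt (\<eta>$2)))"
proof -
  define W where "W = K\<^sup>2 * (p \<eta> * wt (\<eta>$1) * wt (\<eta>$2))"
  have W: "0 \<le> W" using p K by (simp add: W_def)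
  have small: "wt (real_of_int (m$1) / a) * wt (real_of_int (m$2) / b) \<le> 4 * c\<^sup>2 * (wt (real_of_int (m$1)) * wt (real_of_int (m$2)))"
    if "m \<noteq> 0" for m :: "int^2"
  proof -
    have 1: "wt (real_of_int k / e) \<le> wt (real_of_int k)" if "0 < e" "e \<le> c" for e k
      using that ab by (intro wt_divide_le) auto
    have 2: "wt (real_of_int k / e) \<le> 4 * c\<^sup>2 * wt (real_of_int k)" if "k \<noteq> 0" "0 < e" "e \<le> c" for e k
    proof -
      have "4 * e\<^sup>2 * wt (real_of_int k) \<le> 4 * c\<^sup>2 * wt (real_of_int k)"
        using that by (intro mult_right_mono mult_left_mono power_mono) auto
      then show ?thesis using wt_divide_int[of e k] that by linarith
    qed
    have "m$1 \<noteq> 0 \<or> m$2 \<noteq> 0" using that by (simp add: vec_eq_iff forall_2)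
    then show ?thesis
    proof
      assume "m$1 \<noteq> 0"
      then have "wt (real_of_int (m$1) / a) * wt (real_of_int (m$2) / b) \<le> (4 * c\<^sup>2 * wt (real_of_int (m$1))) * wt (real_of_int (m$2))"
        using ab by (intro mult_mono 1 2) auto
      then show ?thesis by (simp add: mult_ac)
    next
      assume "m$2 \<noteq> 0"
      then have "wt (real_of_int (m$1) / a) * wt (real_of_int (m$2) / b) \<le> wt (real_of_int (m$1)) * (4 * c\<^sup>2 * wt (real_of_int (m$2)))"
        using ab by (intro mult_mono 1 2) auto
      then show ?thesis by (simp add: mult_ac)
    qed
  qed
  have "lat_off_overlap a b s \<eta> \<le> (\<integral>\<^sup>+m. ennreal (W * (4 * c\<^sup>2)) * ennreal (wt (real_of_int (m$1)) * wt (real_of_int (m$2))) \<partial>count_space (UNIV :: (int^2) set))"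
    unfolding lat_off_overlap_def
  proof (rule nn_integral_mono)
    fix m :: "int^2"
    have "cmod (s \<eta>) * cmod (s (\<eta> + diag2 (1/a) (1/b) *v lattice m)) \<le> W * (4 * c\<^sup>2) * (wt (real_of_int (m$1)) * wt (real_of_int (m$2)))" if "m \<noteq> 0"
    proof -
      have "cmod (s \<eta>) * cmod (s (\<eta> + diag2 (1/a) (1/b) *v lattice m)) \<le> W * (wt (real_of_int (m$1) / a) * wt (real_of_int (m$2) / b))"
        using decay_product[OF dec p K, of \<eta> "diag2 (1/a) (1/b) *v lattice m"] by (simp add: W_def mult_ac)
      also have "\<dots> \<le> W * (4 * c\<^sup>2 * (wt (real_of_int (m$1)) * wt (real_of_int (m$2))))"
        using W by (intro mult_left_mono small that)
      finally show ?thesis by (simp add: mult_ac)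
    qed
    then show "ennreal (cmod (s \<eta>)) * ennreal (cmod (s (\<eta> + diag2 (1/a) (1/b) *v lattice m))) * of_bool (m \<noteq> 0) \<le>
      ennreal (W * (4 * c\<^sup>2)) * ennreal (wt (real_of_int (m$1)) * wt (real_of_int (m$2)))"
      using W by (cases "m = 0") (auto simp: ennreal_mult[symmetric] intro!: ennreal_leI)
  qed
  also have "\<dots> \<le> ennreal (W * (4 * c\<^sup>2)) * 9"
    by (simp add: nn_integral_cmult mult_left_mono nn_sum_wt_int2)
  also have "\<dots> = ennreal (W * (4 * c\<^sup>2) * 9)" using W by (subst ennreal_mult) auto
  finally show ?thesis by (simp add: W_def mult_ac)
qed

section \<open>Sums over shears and dyadic scales\<close>

lemma wt_dilate: "min 1 (y\<^sup>2) * wt (y * x) \<le> wt x"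
proof (cases "\<bar>y\<bar> \<le> 1")
  case True
  then have y2: "y\<^sup>2 \<le> 1" by (simp add: abs_square_le_1)
  have "\<bar>y\<bar> * (1 + \<bar>x\<bar>) \<le> 1 + \<bar>y * x\<bar>" using True by (simp add: abs_mult algebra_simps)
  then have "(\<bar>y\<bar> * (1 + \<bar>x\<bar>))\<^sup>2 \<le> (1 + \<bar>y * x\<bar>)\<^sup>2" by (intro power_mono) auto
  then have "y\<^sup>2 * (1 + \<bar>x\<bar>)\<^sup>2 \<le> (1 + \<bar>y * x\<bar>)\<^sup>2" by (simp add: power_mult_distrib)
  moreover have "0 < (1 + \<bar>x\<bar>)\<^sup>2" "0 < (1 + \<bar>y * x\<bar>)\<^sup>2" by (simp_all add: add_pos_nonneg)
  ultimately have "y\<^sup>2 * wt (y * x) \<le> wt x" unfolding wt_def by (simp add: field_simps)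
  then show ?thesis using y2 by simp
next
  case False
  have "1 * \<bar>x\<bar> \<le> \<bar>y\<bar> * \<bar>x\<bar>" using False by (intro mult_right_mono) auto
  then have "wt (y * x) \<le> wt x" by (intro wt_antimono) (simp add: abs_mult)
  moreover have "min 1 (y\<^sup>2) * wt (y * x) \<le> 1 * wt (y * x)" by (intro mult_right_mono) auto
  ultimately show ?thesis by linarith
qed

text \<open>A progression of small step \<open>y\<close> has many terms near the origin; the factor
  \<open>min 1 (y ^ 2)\<close> compensates by comparing it with a progression of step 1. For
  \<open>y = 0\<close> that factor vanishes.\<close>

lemma sum_wt_progression:
  assumes "finite K" shows "(\<Sum>k\<in>K. min 1 (y\<^sup>2) * wt (real_of_int k * y + t)) \<le> 12"
proof (cases "y = 0")
  case False
  have "min 1 (y\<^sup>2) * wt (real_of_int k * y + t) \<le> wt (real_of_int k + t / y)" for k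
    using wt_dilate[of y "real_of_int k + t / y"] False by (simp add: algebra_simps)
  then have "(\<Sum>k\<in>K. min 1 (y\<^sup>2) * wt (real_of_int k * y + t)) \<le> (\<Sum>k\<in>K. wt (real_of_int k + t / y))"
    by (intro sum_mono)
  also have "\<dots> \<le> 12" by (rule sum_wt_int_shift[OF assms])
  finally show ?thesis .
qed simp

text \<open>The summand is dominated by a multiple of \<open>\<Theta> h - \<Theta> (h/2)\<close> for \<open>\<Theta> h = h\<^sup>2 / (1 + h\<^sup>2)\<close>,
  so that the sum over dyadic scales telescopes.\<close>

lemma sum_wt_dyadic: "(\<Sum>j<N. min 1 ((h / 2 ^ j)\<^sup>2) * wt (h / 2 ^ j)) \<le> 10 / 3"
proof -
  define \<Theta> where "\<Theta> x = x\<^sup>2 / (1 + x\<^sup>2)" for x :: real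
  have 1: "min 1 (x\<^sup>2) * wt x \<le> 10/3 * (\<Theta> x - \<Theta> (x / 2))" for x :: real
  proof -
    define q where "q = x\<^sup>2"
    have q: "q \<ge> 0" by (simp add: q_def)
    have e: "\<Theta> x - \<Theta> (x / 2) = 3 * q / ((1 + q) * (4 + q))"
      using q unfolding \<Theta>_def q_def[symmetric] power_divide by (simp add: divide_simps) (simp add: algebra_simps)
    have "wt x \<le> 1 / (1 + q)"
    proof -
      have "1 + q \<le> (1 + \<bar>x\<bar>)\<^sup>2" by (simp add: q_def power2_sum)
      then show ?thesis unfolding wt_def using q by (intro divide_left_mono mult_pos_pos zero_less_power) (auto simp: add_pos_nonneg)
    qed
    then have "min 1 q * wt x \<le> min 1 q * (1 / (1 + q))" using q by (intro mult_left_mono) auto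
    also have "\<dots> \<le> 10 * q / ((1 + q) * (4 + q))"
    proof -
      have "min 1 q * (4 + q) \<le> 10 * q"
      proof (cases "q \<le> 1")
        case True
        then have "q * (4 + q) \<le> q * 5" using q by (intro mult_left_mono) auto
        then show ?thesis using True q by simp
      qed simp
      then have "min 1 q * (4 + q) / ((1 + q) * (4 + q)) \<le> 10 * q / ((1 + q) * (4 + q))"
        using q by (intro divide_right_mono) auto
      then show ?thesis using q by (simp add: add_pos_nonneg)
    qed
    finally show ?thesis by (simp add: e q_def)
  qed
  have "(\<Sum>j<N. min 1 ((h / 2 ^ j)\<^sup>2) * wt (h / 2 ^ j)) \<le> (\<Sum>j<N. 10/3 * (\<Theta> (h / 2 ^ j) - \<Theta> (h / 2 ^ Suc j)))"
    using 1[of "h / 2 ^ _"] by (intro sum_mono) (simp add: mult.commute)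
  also have "\<dots> = 10/3 * (\<Theta> h - \<Theta> (h / 2 ^ N))"
    by (subst sum_distrib_left[symmetric], subst sum_lessThan_telescope'[where f="\<lambda>j. \<Theta> (h / 2 ^ j)"]) simp
  also have "\<dots> \<le> 10/3 * 1"
  proof -
    have "\<Theta> h \<le> 1" "0 \<le> \<Theta> (h / 2 ^ N)" by (simp_all add: \<Theta>_def divide_le_eq_1 add_pos_nonneg)
    then show ?thesis by simp
  qed
  finally show ?thesis by simp
qed

definition cut4 :: "real \<Rightarrow> real" where "cut4 t = min 1 (t ^ 4)"

lemma cut4_bounds: "0 \<le> cut4 t" "cut4 t \<le> 1"
  by (auto simp: cut4_def)

text \<open>A zero of order 4 splits into two of order 2: one pays for the sum over shears at a
  fixed scale, the other for the sum over scales.\<close>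

lemma cut4_eq: "cut4 t = min 1 (t\<^sup>2) * min 1 (t\<^sup>2)"
proof -
  have e: "t ^ 4 = t\<^sup>2 * t\<^sup>2" by (simp add: power4_eq_xxxx power2_eq_square mult.assoc)
  show ?thesis
  proof (cases "t\<^sup>2 \<le> 1")
    case True
    then have "t\<^sup>2 * t\<^sup>2 \<le> 1" by (intro mult_le_one) auto
    then have "min 1 (t\<^sup>2 * t\<^sup>2) = t\<^sup>2 * t\<^sup>2" "min 1 (t\<^sup>2) = t\<^sup>2" using True by (auto intro: min_absorb2)
    then show ?thesis unfolding cut4_def e by (simp only:)
  next
    case False
    then have "1 * 1 \<le> t\<^sup>2 * t\<^sup>2" by (intro mult_mono) auto
    then have "min 1 (t\<^sup>2 * t\<^sup>2) = 1" "min 1 (t\<^sup>2) = 1" using False by (auto intro: min_absorb1)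
    then show ?thesis unfolding cut4_def e by (simp only: mult_1)
  qed
qed

text \<open>At each scale the shears run through a progression of step \<open>x / 2 ^ j\<close>,
  contributing at most 12; the remaining dyadic sum is at most \<open>10 / 3\<close>. The offset
  \<open>t j\<close> is arbitrary, so the second frequency plays no part in the constant.\<close>

lemma sum_cone_le:
  assumes fin: "\<And>j. finite (K j)"
  shows "(\<Sum>j. \<Sum>k\<in>K j. ennreal (cut4 (x / 2 ^ j) * wt (x / 2 ^ j) * wt (real_of_int k * (x / 2 ^ j) + t j))) \<le> ennreal 40"
proof (rule suminf_le_const)
  fix N
  have "(\<Sum>j<N. \<Sum>k\<in>K j. cut4 (x / 2 ^ j) * wt (x / 2 ^ j) * wt (real_of_int k * (x / 2 ^ j) + t j)) \<le>
    (\<Sum>j<N. 12 * (min 1 ((x / 2 ^ j)\<^sup>2) * wt (x / 2 ^ j)))"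
  proof (rule sum_mono)
    fix j
    have "(\<Sum>k\<in>K j. cut4 (x / 2 ^ j) * wt (x / 2 ^ j) * wt (real_of_int k * (x / 2 ^ j) + t j)) =
      (min 1 ((x / 2 ^ j)\<^sup>2) * wt (x / 2 ^ j)) * (\<Sum>k\<in>K j. min 1 ((x / 2 ^ j)\<^sup>2) * wt (real_of_int k * (x / 2 ^ j) + t j))"
      by (simp add: cut4_eq sum_distrib_left mult_ac)
    also have "\<dots> \<le> (min 1 ((x / 2 ^ j)\<^sup>2) * wt (x / 2 ^ j)) * 12"
      by (intro mult_left_mono sum_wt_progression fin) auto
    finally show "(\<Sum>k\<in>K j. cut4 (x / 2 ^ j) * wt (x / 2 ^ j) * wt (real_of_int k * (x / 2 ^ j) + t j)) \<le> 12 * (min 1 ((x / 2 ^ j)\<^sup>2) * wt (x / 2 ^ j))"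
      by simp
  qed
  also have "\<dots> \<le> 12 * (10 / 3)"
    unfolding sum_distrib_left[symmetric] by (intro mult_left_mono sum_wt_dyadic) simp
  finally have "(\<Sum>j<N. \<Sum>k\<in>K j. cut4 (x / 2 ^ j) * wt (x / 2 ^ j) * wt (real_of_int k * (x / 2 ^ j) + t j)) \<le> 40" by simp
  then have "ennreal (\<Sum>j<N. \<Sum>k\<in>K j. cut4 (x / 2 ^ j) * wt (x / 2 ^ j) * wt (real_of_int k * (x / 2 ^ j) + t j)) \<le> ennreal 40"
    by (rule ennreal_leI)
  then show "(\<Sum>j<N. \<Sum>k\<in>K j. ennreal (cut4 (x / 2 ^ j) * wt (x / 2 ^ j) * wt (real_of_int k * (x / 2 ^ j) + t j))) \<le> ennreal 40"
    by (simp add: sum_nonneg cut4_bounds flip: sum_ennreal)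
qed simp

subsection \<open>The refinement mask\<close>

lemma binomial_step_upper:
  assumes "l \<le> k + 1" shows "(k + 1 + l) choose l \<le> 2 * ((k + l) choose l)"
proof -
  \<comment> \<open>Raising \<open>k\<close> by one multiplies the coefficient by
    \<open>(k + l + 1) / (k + 1)\<close>, at most 2 in this range.\<close>
  have "Suc k * (Suc (k + l) choose l) = Suc (k + l) * ((k + l) choose l)"
    using binomial_absorb_comp[of "Suc (k + l)" l] by (simp add: mult.commute)
  also have "\<dots> \<le> (2 * Suc k) * ((k + l) choose l)" using assms by (intro mult_right_mono) auto
  also have "\<dots> = Suc k * (2 * ((k + l) choose l))" by (simp only: mult_ac)
  finally show ?thesis unfolding Suc_mult_le_cancel1 by simp
qed

lemma binomial_step_lower:
  assumes "3 * (k + l + 1) \<le> 8 * (l + 1)" shows "3 * ((k + (l + 1)) choose (l + 1)) \<le> 8 * ((k + l) choose l)"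
proof -
  have "Suc l * (3 * (Suc (k + l) choose Suc l)) = 3 * ((Suc (k + l) choose Suc l) * Suc l)"
    by (simp only: mult_ac)
  also have "\<dots> = (3 * Suc (k + l)) * ((k + l) choose l)"
    unfolding Suc_times_binomial_eq[symmetric] by (simp only: mult_ac)
  also have "\<dots> \<le> (8 * Suc l) * ((k + l) choose l)" using assms by (intro mult_right_mono) auto
  also have "\<dots> = Suc l * (8 * ((k + l) choose l))" by (simp only: mult_ac)
  finally show ?thesis unfolding Suc_mult_le_cancel1 by simp
qed

text \<open>The step \<open>(3, 2)\<close> follows the boundary slope of the condition
  \<open>3 * (l + 1) \<le> 2 * k\<close>. Two steps in \<open>l\<close> cost at most
  \<open>(8 / 3) ^ 2\<close> and three in \<open>k\<close> cost \<open>2 ^ 3\<close>, together below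
  \<open>64 = 4 ^ 3\<close>.\<close>

lemma binomial_step:
  assumes "3 * (k + l + 2) \<le> 8 * (l + 1)" "l + 1 \<le> k"
  shows "(k + 3 + (l + 2)) choose (l + 2) \<le> 64 * ((k + l) choose l)"
proof -
  have 1: "3 * ((k + (l + 1)) choose (l + 1)) \<le> 8 * ((k + l) choose l)"
    using assms by (intro binomial_step_lower) auto
  have 2: "3 * ((k + (l + 1 + 1)) choose (l + 1 + 1)) \<le> 8 * ((k + (l + 1)) choose (l + 1))"
    using assms by (intro binomial_step_lower) auto
  have 3: "(k + 1 + (l + 2)) choose (l + 2) \<le> 2 * ((k + (l + 2)) choose (l + 2))"
    using assms by (intro binomial_step_upper) auto
  have 4: "(k + 1 + 1 + (l + 2)) choose (l + 2) \<le> 2 * ((k + 1 + (l + 2)) choose (l + 2))"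
    using assms by (intro binomial_step_upper) auto
  have 5: "(k + 1 + 1 + 1 + (l + 2)) choose (l + 2) \<le> 2 * ((k + 1 + 1 + (l + 2)) choose (l + 2))"
    using assms by (intro binomial_step_upper) auto
  have e: "k + 3 = k + 1 + 1 + 1" "l + 1 + 1 = l + 2" by simp_all
  show ?thesis using 1 2 3 4 5 unfolding e by linarith
qed

text \<open>For each \<open>l\<close> the least admissible \<open>k\<close> is reached by induction
  along the boundary, one chain for each parity of \<open>l\<close>, starting at
  \<open>(15, 9)\<close> and \<open>(17, 10)\<close>. Increasing \<open>k\<close> afterwards at most
  doubles the left side and multiplies the right side by 4.\<close>

lemma binomial_le_power4:
  assumes "9 \<le> l" "3 * (l + 1) \<le> 2 * k"
  shows "(k + l) choose l \<le> 4 ^ (k - 4)"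
proof -
  have A: "((3 * i + 15) + (2 * i + 9)) choose (2 * i + 9) \<le> 4 ^ (3 * i + 11)" for i
  proof (induction i)
    case 0
    have "(24::nat) choose 9 = 1307504" by (simp add: binomial_fact' fact_numeral)
    then show ?case by simp
  next
    case (Suc i)
    have "((3 * i + 15) + 3 + (2 * i + 9 + 2)) choose (2 * i + 9 + 2) \<le> 64 * (((3 * i + 15) + (2 * i + 9)) choose (2 * i + 9))"
      by (rule binomial_step) auto
    also have "\<dots> \<le> 64 * 4 ^ (3 * i + 11)" using Suc by simp
    also have "\<dots> = 4 ^ (3 * Suc i + 11)" by (simp add: power_add)
    finally show ?case by (simp add: algebra_simps)
  qed
  have B: "((3 * i + 17) + (2 * i + 10)) choose (2 * i + 10) \<le> 4 ^ (3 * i + 13)" for i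
  proof (induction i)
    case 0
    have "(27::nat) choose 10 = 8436285" by (simp add: binomial_fact' fact_numeral)
    then show ?case by simp
  next
    case (Suc i)
    have "((3 * i + 17) + 3 + (2 * i + 10 + 2)) choose (2 * i + 10 + 2) \<le> 64 * (((3 * i + 17) + (2 * i + 10)) choose (2 * i + 10))"
      by (rule binomial_step) auto
    also have "\<dots> \<le> 64 * 4 ^ (3 * i + 13)" using Suc by simp
    also have "\<dots> = 4 ^ (3 * Suc i + 13)" by (simp add: power_add)
    finally show ?case by (simp add: algebra_simps)
  qed
  have up: "(q + d + l) choose l \<le> 4 ^ (q + d - 4)"
    if "(q + l) choose l \<le> 4 ^ (q - 4)" "l \<le> q + 1" "4 \<le> q" for q d
  proof (induction d)
    case (Suc d)
    have "(q + d + 1 + l) choose l \<le> 2 * ((q + d + l) choose l)"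
      using that by (intro binomial_step_upper) auto
    also have "\<dots> \<le> 4 * 4 ^ (q + d - 4)" using Suc by simp
    also have "\<dots> = 4 ^ Suc (q + d - 4)" by simp
    also have "Suc (q + d - 4) = q + Suc d - 4" using that by simp
    finally show ?case by simp
  qed (use that in simp)
  show ?thesis
  proof (cases "odd l")
    case True
    then obtain i0 where "l = 2 * i0 + 1" by (auto elim: oddE)
    then obtain i where l: "l = 2 * i + 9" using assms by (intro that[of "i0 - 4"]) auto
    have "k = (3 * i + 15) + (k - (3 * i + 15))" using assms l by auto
    moreover have "(3 * i + 15) + (k - (3 * i + 15)) + l choose l \<le> 4 ^ (3 * i + 15 + (k - (3 * i + 15)) - 4)"
      using A[of i] by (intro up[where q="3 * i + 15"]) (simp_all add: l ac_simps)
    ultimately show ?thesis by metis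
  next
    case False
    then obtain i0 where "l = 2 * i0" by (auto elim: evenE)
    then obtain i where l: "l = 2 * i + 10" using assms by (intro that[of "i0 - 5"]) auto
    have "k = (3 * i + 17) + (k - (3 * i + 17))" using assms l by auto
    moreover have "(3 * i + 17) + (k - (3 * i + 17)) + l choose l \<le> 4 ^ (3 * i + 17 + (k - (3 * i + 17)) - 4)"
      using B[of i] by (intro up[where q="3 * i + 17"]) (simp_all add: l ac_simps)
    ultimately show ?thesis by metis
  qed
qed

section \<open>The polynomial factor of the mask\<close>

definition mask_poly :: "nat \<Rightarrow> nat \<Rightarrow> real \<Rightarrow> real"
  where "mask_poly K L y = (\<Sum>n=0..L - 1. real ((K - 1 + n) choose n) * y ^ n)"

lemma mask_poly_ge_1: "0 \<le> y \<Longrightarrow> 1 \<le> mask_poly K L y"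
proof -
  assume y: "0 \<le> y"
  have "(\<Sum>n\<in>{0}. real ((K - 1 + n) choose n) * y ^ n) \<le> mask_poly K L y"
    unfolding mask_poly_def using y by (intro sum_mono2) auto
  then show ?thesis by simp
qed

text \<open>The coefficients are nonnegative, so the value at 1 dominates, and that value is a
  hockey-stick sum, a single binomial coefficient.\<close>

lemma mask_poly_le:
  assumes "10 \<le> L" "3 * L \<le> 2 * K" "0 \<le> y" "y \<le> 1"
  shows "mask_poly K L y \<le> 4 ^ (K - 4)"
proof -
  have "mask_poly K L y \<le> (\<Sum>n=0..L - 1. real ((K - 1 + n) choose n) * 1)"
    unfolding mask_poly_def using assms by (intro sum_mono mult_left_mono power_le_one) auto
  also have "\<dots> = real (\<Sum>n\<le>L - 1. (K - 1 + n) choose n)" by (simp add: atLeast0AtMost)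
  also have "(\<Sum>n\<le>L - 1. (K - 1 + n) choose n) = (K + (L - 1)) choose (L - 1)"
  proof -
    have "Suc (K - 1 + (L - 1)) = K + (L - 1)" using assms by simp
    then show ?thesis using sum_choose_lower[of "K - 1" "L - 1"] by (simp only:)
  qed
  also have "real \<dots> \<le> real (4 ^ (K - 4))"
    using assms by (intro of_nat_mono binomial_le_power4) auto
  finally show ?thesis by simp
qed

text \<open>Multiplication by \<open>1 - y\<close> lowers the order of the negative binomial series
  by one; truncation leaves a boundary term with a definite sign, which the next bound
  discards.\<close>

lemma negative_binomial_partial_sum:
  "(1 - y) * (\<Sum>n\<le>M. real ((k + 1 + n) choose n) * y ^ n) =
    (\<Sum>n\<le>M. real ((k + n) choose n) * y ^ n) - real ((k + 1 + M) choose M) * y ^ (M + 1)" for y :: real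
proof (induction M)
  case (Suc M)
  have "(k + 1 + Suc M) choose Suc M = ((k + 1 + M) choose M) + ((k + Suc M) choose Suc M)"
    by simp
  then have "real ((k + 1 + Suc M) choose Suc M) = real ((k + 1 + M) choose M) + real ((k + Suc M) choose Suc M)"
    by (simp only: of_nat_add)
  with Suc show ?case by (simp add: algebra_simps del: binomial_Suc_Suc)
qed simp

text \<open>The polynomial is a truncation of the power series of \<open>(1 - y)\<close> to the
  power \<open>- K\<close>. The induction lowers the order down to a finite geometric sum, which
  avoids convergence at \<open>y = 1\<close>.\<close>

lemma mask_poly_bound_1:
  assumes "0 \<le> y" "y \<le> 1" "0 < K"
  shows "(1 - y) ^ K * mask_poly K L y \<le> 1"
proof -
  have "(1 - y) ^ Suc k * (\<Sum>n\<le>M. real ((k + n) choose n) * y ^ n) \<le> 1" for k M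
  proof (induction k)
    case 0
    have "(1 - y) * (\<Sum>n\<le>M. y ^ n) = 1 - y ^ Suc M" by (simp add: sum_gp_basic)
    then show ?case using assms by simp
  next
    case (Suc k)
    have "(1 - y) ^ Suc (Suc k) * (\<Sum>n\<le>M. real ((Suc k + n) choose n) * y ^ n) =
      (1 - y) ^ Suc k * ((1 - y) * (\<Sum>n\<le>M. real ((k + 1 + n) choose n) * y ^ n))" by (simp add: mult_ac)
    also have "\<dots> \<le> (1 - y) ^ Suc k * (\<Sum>n\<le>M. real ((k + n) choose n) * y ^ n)"
      unfolding negative_binomial_partial_sum using assms by (intro mult_left_mono) auto
    also have "\<dots> \<le> 1" by (rule Suc)
    finally show ?case .
  qed
  from this[of "K - 1" "L - 1"] show ?thesis using assms by (simp add: mask_poly_def atLeast0AtMost)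
qed

text \<open>Viete's product by repeated doubling of the sine, multiplied out so that no division by
  a vanishing sine occurs.\<close>

lemma prod_cos_dyadic: "2 ^ n * sin (x / 2 ^ n) * (\<Prod>j<n. cos (x / 2 ^ Suc j)) = sin x" for x :: real
proof (induction n)
  case (Suc n)
  have "sin (x / 2 ^ n) = 2 * sin (x / 2 ^ Suc n) * cos (x / 2 ^ Suc n)"
    using sin_double[of "x / 2 ^ Suc n"] by simp
  with Suc show ?case by (simp add: mult_ac)
qed simp

lemma sin_ge_half: "0 \<le> x \<Longrightarrow> x \<le> pi / 3 \<Longrightarrow> x / 2 \<le> sin x"
proof -
  assume x: "0 \<le> x" "x \<le> pi / 3"
  have "(\<lambda>t. sin t - t / 2) 0 \<le> (\<lambda>t. sin t - t / 2) x"
  proof (rule DERIV_nonneg_imp_nondecreasing[OF x(1)])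
    fix t assume t: "0 \<le> t" "t \<le> x"
    have "cos (pi / 3) \<le> cos t" using t x by (intro cos_monotone_0_pi_le) auto
    then have "0 \<le> cos t - 1 / 2" by (simp add: cos_60)
    moreover have "((\<lambda>t. sin t - t / 2) has_real_derivative cos t - 1 / 2) (at t)"
      by (auto intro!: derivative_eq_intros)
    ultimately show "\<exists>y. ((\<lambda>t. sin t - t / 2) has_real_derivative y) (at t) \<and> 0 \<le> y" by blast
  qed
  then show ?thesis by simp
qed

lemma sin_ge_half_mid: "pi / 6 \<le> x \<Longrightarrow> x \<le> 5 * pi / 6 \<Longrightarrow> 1 / 2 \<le> sin x"
proof (cases "x \<le> pi / 2")
  case True
  assume "pi / 6 \<le> x"
  then have "sin (pi / 6) \<le> sin x" using True by (intro sin_monotone_2pi_le) auto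
  then show ?thesis by (simp add: sin_30)
next
  case False
  assume "x \<le> 5 * pi / 6"
  then have "sin (pi / 6) \<le> sin (pi - x)" using False by (intro sin_monotone_2pi_le) auto
  then show ?thesis by (simp add: sin_30)
qed

section \<open>The mask and its infinite product\<close>

locale mask =
  fixes K L :: nat and m0 :: "real \<Rightarrow> complex"
  assumes L: "10 \<le> L" and KL: "3 * L \<le> 2 * K"
    and trig: "real_trig_polynomial m0" and m0_0: "m0 0 = 1"
    and m0_sq: "\<And>\<xi>. (cmod (m0 \<xi>))\<^sup>2 = (cos (pi * \<xi>)) ^ (2 * K) * mask_poly K L ((sin (pi * \<xi>))\<^sup>2)"
begin

lemma K: "15 \<le> K" using L KL by linarith

lemma sin_sq_01: "0 \<le> (sin x)\<^sup>2" "(sin x)\<^sup>2 \<le> 1" for x :: real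
  by (auto simp: abs_square_le_1)

lemma m0_le_1: "cmod (m0 \<xi>) \<le> 1"
proof -
  have "(cos (pi * \<xi>)) ^ (2 * K) = (1 - (sin (pi * \<xi>))\<^sup>2) ^ K" by (simp add: power_mult cos_squared_eq)
  then have "(cmod (m0 \<xi>))\<^sup>2 \<le> 1" using mask_poly_bound_1[OF sin_sq_01] K by (simp add: m0_sq)
  then show ?thesis by (simp add: abs_square_le_1)
qed

lemma m0_upper: "cmod (m0 \<xi>) \<le> \<bar>cos (pi * \<xi>)\<bar> ^ K * 2 ^ (K - 4)"
proof -
  have "(cmod (m0 \<xi>))\<^sup>2 \<le> (cos (pi * \<xi>)) ^ (2 * K) * 4 ^ (K - 4)"
    unfolding m0_sq by (intro mult_left_mono mask_poly_le L KL sin_sq_01) auto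
  also have "\<dots> = (\<bar>cos (pi * \<xi>)\<bar> ^ K * 2 ^ (K - 4))\<^sup>2"
    by (simp add: power_mult_distrib power_mult[symmetric] mult.commute[of _ 2]) (simp add: power_mult)
  finally show ?thesis by (rule power2_le_imp_le) simp
qed

lemma m0_lower: "\<bar>cos (pi * \<xi>)\<bar> ^ K \<le> cmod (m0 \<xi>)"
proof -
  have "(\<bar>cos (pi * \<xi>)\<bar> ^ K)\<^sup>2 = (cos (pi * \<xi>)) ^ (2 * K) * 1"
    by (simp add: power_mult[symmetric] mult.commute[of _ 2]) (simp add: power_mult)
  also have "\<dots> \<le> (cmod (m0 \<xi>))\<^sup>2"
    unfolding m0_sq by (intro mult_left_mono mask_poly_ge_1 sin_sq_01) auto
  finally show ?thesis by (rule power2_le_imp_le) simp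
qed

text \<open>A trigonometric polynomial is Lipschitz; with value 1 at the origin this makes the
  dyadic product converge absolutely everywhere.\<close>

lemma m0_lipschitz: "\<exists>C. \<forall>\<xi>. cmod (m0 \<xi> - 1) \<le> C * \<bar>\<xi>\<bar>"
proof -
  obtain N a where N: "finite N" and m0: "\<And>\<xi>. m0 \<xi> = (\<Sum>n\<in>N. complex_of_real (a n)
        * exp (2 * complex_of_real pi * \<i> * of_int n * complex_of_real \<xi>))"
    using trig by (auto simp: real_trig_polynomial_def)
  have e: "exp (2 * complex_of_real pi * \<i> * of_int n * complex_of_real \<xi>) = cis (2 * pi * n * \<xi>)" for n \<xi>
    by (simp add: cis_conv_exp mult_ac)
  have lip: "cmod (cis t - 1) \<le> 2 * \<bar>t\<bar>" for t
  proof -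
    have "cmod (cis t - 1) \<le> \<bar>cos t - 1\<bar> + \<bar>sin t\<bar>" using cmod_le[of "cis t - 1"] by simp
    moreover have "\<bar>cos t - 1\<bar> \<le> \<bar>t\<bar>"
    proof -
      have "\<bar>cos t - 1\<bar> = 2 * (\<bar>sin (t / 2)\<bar> * \<bar>sin (t / 2)\<bar>)"
        using cos_double_sin[of "t / 2"] by (simp add: power2_eq_square)
      also have "\<dots> \<le> 2 * (\<bar>t / 2\<bar> * 1)"
        by (intro mult_left_mono mult_mono abs_sin_x_le_abs_x) auto
      finally show ?thesis by simp
    qed
    moreover have "\<bar>sin t\<bar> \<le> \<bar>t\<bar>" by (rule abs_sin_x_le_abs_x)
    ultimately show ?thesis by simp
  qed
  define C where "C = (\<Sum>n\<in>N. \<bar>a n\<bar> * (2 * (2 * pi * \<bar>real_of_int n\<bar>)))"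
  have "cmod (m0 \<xi> - 1) \<le> C * \<bar>\<xi>\<bar>" for \<xi>
  proof -
    have "m0 \<xi> - 1 = m0 \<xi> - m0 0" by (simp add: m0_0)
    also have "\<dots> = (\<Sum>n\<in>N. complex_of_real (a n) * (cis (2 * pi * n * \<xi>) - 1))"
      unfolding m0 e by (simp add: sum_subtractf right_diff_distrib)
    also have "cmod \<dots> \<le> (\<Sum>n\<in>N. \<bar>a n\<bar> * (2 * \<bar>2 * pi * n * \<xi>\<bar>))"
      by (rule sum_norm_le) (auto simp: norm_mult intro!: mult_left_mono lip)
    also have "\<dots> = C * \<bar>\<xi>\<bar>" 
      unfolding C_def sum_distrib_right by (intro sum.cong refl) (simp add: abs_mult mult_ac)
    finally show ?thesis .
  qed
  then show ?thesis by blast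
qed

definition \<Phi> :: "real \<Rightarrow> complex" where "\<Phi> \<xi> = (\<Prod>j. m0 (\<xi> / 2 ^ j))"

lemma \<Phi>_limit: "(\<lambda>n. \<Prod>j<n. m0 (\<xi> / 2 ^ j)) \<longlonglongrightarrow> \<Phi> \<xi>"
proof -
  obtain C where C: "\<And>\<xi>. cmod (m0 \<xi> - 1) \<le> C * \<bar>\<xi>\<bar>" using m0_lipschitz by blast
  have "summable (\<lambda>j. norm (m0 (\<xi> / 2 ^ j) - 1))"
  proof (rule summable_comparison_test')
    show "summable (\<lambda>j. C * \<bar>\<xi>\<bar> * (1 / 2) ^ j)" by (intro summable_mult summable_geometric) simp
    show "norm (norm (m0 (\<xi> / 2 ^ j) - 1)) \<le> C * \<bar>\<xi>\<bar> * (1 / 2) ^ j" for j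
      using C[of "\<xi> / 2 ^ j"] by (simp add: abs_divide power_divide)
  qed
  then have "convergent_prod (\<lambda>j. m0 (\<xi> / 2 ^ j))"
    by (intro abs_convergent_prod_imp_convergent_prod) (simp add: abs_convergent_prod_conv_summable)
  then have "(\<lambda>n. \<Prod>j\<le>n. m0 (\<xi> / 2 ^ j)) \<longlonglongrightarrow> \<Phi> \<xi>"
    unfolding \<Phi>_def by (rule convergent_prod_LIMSEQ)
  then have "(\<lambda>n. \<Prod>j<Suc n. m0 (\<xi> / 2 ^ j)) \<longlonglongrightarrow> \<Phi> \<xi>" by (simp add: lessThan_Suc_atMost)
  then show ?thesis by (rule LIMSEQ_imp_Suc)
qed

lemma \<Phi>_le_1: "cmod (\<Phi> \<xi>) \<le> 1"
proof (rule LIMSEQ_le_const2[OF tendsto_norm[OF \<Phi>_limit]])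
  have "cmod (\<Prod>j<n. m0 (\<xi> / 2 ^ j)) \<le> 1" for n
    unfolding prod_norm[symmetric] by (intro prod_le_1) (auto simp: m0_le_1)
  then show "\<exists>N. \<forall>n\<ge>N. cmod (\<Prod>j<n. m0 (\<xi> / 2 ^ j)) \<le> 1" by blast
qed

lemma \<Phi>_split: "\<Phi> \<xi> = (\<Prod>j<J. m0 (\<xi> / 2 ^ j)) * \<Phi> (\<xi> / 2 ^ J)"
proof (rule LIMSEQ_unique)
  show "(\<lambda>n. \<Prod>j<n + J. m0 (\<xi> / 2 ^ j)) \<longlonglongrightarrow> \<Phi> \<xi>"
    by (rule LIMSEQ_ignore_initial_segment[OF \<Phi>_limit])
  have "(\<Prod>j<n + J. m0 (\<xi> / 2 ^ j)) = (\<Prod>j<J. m0 (\<xi> / 2 ^ j)) * (\<Prod>j<n. m0 (\<xi> / 2 ^ J / 2 ^ j))" for n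
    by (induction n) (simp_all add: mult_ac power_add)
  then show "(\<lambda>n. \<Prod>j<n + J. m0 (\<xi> / 2 ^ j)) \<longlonglongrightarrow> (\<Prod>j<J. m0 (\<xi> / 2 ^ j)) * \<Phi> (\<xi> / 2 ^ J)"
    by (simp only:) (intro tendsto_mult tendsto_const \<Phi>_limit)
qed

lemma prod_cos: "2 ^ n * sin (2 * pi * \<xi> / 2 ^ n) * (\<Prod>j<n. cos (pi * (\<xi> / 2 ^ j))) = sin (2 * pi * \<xi>)"
  using prod_cos_dyadic[of n "2 * pi * \<xi>"] by simp

text \<open>Since \<open>cmod m0\<close> dominates the \<open>K\<close>-th power of the cosine, the
  product of cosines has to be at least \<open>1 / 2\<close>. By Viete it is at least
  \<open>sin x / x\<close> with \<open>x = 2 * pi * \<bar>\<xi>\<bar>\<close>, and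
  \<open>\<bar>\<xi>\<bar> \<le> 1 / 6\<close> means \<open>x \<le> pi / 3\<close>.\<close>

lemma \<Phi>_lower:
  assumes "\<bar>\<xi>\<bar> \<le> 1 / 6" shows "(1 / 2) ^ K \<le> cmod (\<Phi> \<xi>)"
proof (rule LIMSEQ_le_const[OF tendsto_norm[OF \<Phi>_limit]])
  have "(1 / 2) ^ K \<le> cmod (\<Prod>j<n. m0 (\<xi> / 2 ^ j))" for n
  proof -
    define P where "P = (\<Prod>j<n. \<bar>cos (pi * (\<xi> / 2 ^ j))\<bar>)"
    have "1 / 2 \<le> P"
    proof (cases "\<xi> = 0")
      case False
      define x where "x = \<bar>2 * pi * \<xi>\<bar>"
      have "x \<le> pi / 3" using assms by (simp add: x_def abs_mult)
      then have "x / 2 \<le> sin x" by (intro sin_ge_half) (simp_all add: x_def)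
      also have "sin x \<le> \<bar>sin (2 * pi * \<xi>)\<bar>" by (simp add: x_def abs_if)
      also have "\<dots> = 2 ^ n * \<bar>sin (2 * pi * \<xi> / 2 ^ n)\<bar> * P"
        unfolding prod_cos[of n \<xi>, symmetric] by (simp add: abs_mult abs_prod P_def)
      also have "\<dots> \<le> x * P"
      proof (rule mult_right_mono)
        have "2 ^ n * \<bar>sin (2 * pi * \<xi> / 2 ^ n)\<bar> \<le> 2 ^ n * \<bar>2 * pi * \<xi> / 2 ^ n\<bar>"
          by (intro mult_left_mono abs_sin_x_le_abs_x) simp
        then show "2 ^ n * \<bar>sin (2 * pi * \<xi> / 2 ^ n)\<bar> \<le> x" by (simp add: x_def abs_divide)
        show "0 \<le> P" unfolding P_def by (intro prod_nonneg) auto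
      qed
      finally have "x * (1 / 2) \<le> x * P" by simp
      moreover have "0 < x" using False by (simp add: x_def)
      ultimately show ?thesis by (simp only: mult_le_cancel_left_pos)
    qed (simp add: P_def)
    then have "(1 / 2) ^ K \<le> P ^ K" by (intro power_mono) auto
    also have "\<dots> = (\<Prod>j<n. \<bar>cos (pi * (\<xi> / 2 ^ j))\<bar> ^ K)" by (simp add: P_def prod_power_distrib)
    also have "\<dots> \<le> (\<Prod>j<n. cmod (m0 (\<xi> / 2 ^ j)))" by (intro prod_mono conjI m0_lower) simp
    finally show ?thesis by (simp add: prod_norm)
  qed
  then show "\<exists>N. \<forall>n\<ge>N. (1 / 2) ^ K \<le> cmod (\<Prod>j<n. m0 (\<xi> / 2 ^ j))" by blast
qed

text \<open>The first \<open>J\<close> factors bring \<open>\<xi>\<close> into the band between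
  \<open>1 / 8\<close> and \<open>1 / 4\<close>, where the sine in Viete's identity is at least
  \<open>1 / 2\<close>; hence the product \<open>Q\<close> of cosines is at most
  \<open>2 / 2 ^ J\<close>. The mask bound then gives \<open>2 ^ K / 2 ^ (4 * J)\<close>, and
  \<open>2 ^ J\<close> is comparable with \<open>1 + \<bar>\<xi>\<bar>\<close>. The factors beyond
  \<open>J\<close> are bounded by 1.\<close>

lemma \<Phi>_decay: "cmod (\<Phi> \<xi>) \<le> 3 * 2 ^ K * (wt \<xi>)\<^sup>2"
proof (cases "\<bar>\<xi>\<bar> \<le> 1 / 4")
  case True
  \<comment> \<open>The fourth power of \<open>5 / 4\<close> is below 3; the same comparison with
    \<open>5 / 4 * 2 ^ J\<close> yields the constant 3 in the other case.\<close>
  have "(1 + \<bar>\<xi>\<bar>) ^ 4 \<le> (5 / 4) ^ 4" using True by (intro power_mono) auto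
  also have "\<dots> \<le> 3 * 1" by (simp add: power4_eq_xxxx)
  also have "\<dots> \<le> 3 * 2 ^ K" by simp
  finally have "1 \<le> 3 * 2 ^ K / (1 + \<bar>\<xi>\<bar>) ^ 4" by (simp add: add_pos_nonneg)
  then have "1 \<le> 3 * 2 ^ K * (wt \<xi>)\<^sup>2" by (simp add: wt_def power_divide power_mult[symmetric])
  then show ?thesis using \<Phi>_le_1[of \<xi>] by linarith
next
  case False
  define P where "P n \<longleftrightarrow> \<bar>\<xi>\<bar> / 2 ^ n \<le> 1 / 4" for n :: nat
  have "\<exists>n. P n"
  proof -
    obtain n where "4 * \<bar>\<xi>\<bar> < 2 ^ n" using real_arch_pow[of 2 "4 * \<bar>\<xi>\<bar>"] by auto
    then show ?thesis by (intro exI[of _ n]) (simp add: P_def field_simps)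
  qed
  define J where "J = (LEAST n. P n)"
  have PJ: "P J" unfolding J_def using \<open>\<exists>n. P n\<close> by (rule LeastI_ex)
  have "\<not> P 0" using False by (simp add: P_def)
  then obtain i where i: "J = Suc i" using PJ by (cases J) auto
  have "\<not> P i" using not_less_Least[of i P] i J_def by auto
  then have lo: "1 / 8 < \<bar>\<xi>\<bar> / 2 ^ J" using i by (simp add: P_def field_simps)
  have hi: "\<bar>\<xi>\<bar> / 2 ^ J \<le> 1 / 4" using PJ by (simp add: P_def)
  define Q where "Q = (\<Prod>j<J. \<bar>cos (pi * (\<xi> / 2 ^ j))\<bar>)"
  have Q0: "0 \<le> Q" unfolding Q_def by (intro prod_nonneg) auto
  have Q: "2 ^ J * Q \<le> 2"
  proof -
    have "1 / 2 \<le> sin (2 * pi * (\<bar>\<xi>\<bar> / 2 ^ J))"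
    proof (rule sin_ge_half_mid)
      have "2 * pi * (1 / 8) \<le> 2 * pi * (\<bar>\<xi>\<bar> / 2 ^ J)" using lo by (intro mult_left_mono) auto
      then show "pi / 6 \<le> 2 * pi * (\<bar>\<xi>\<bar> / 2 ^ J)" using pi_gt_zero by linarith
      have "2 * pi * (\<bar>\<xi>\<bar> / 2 ^ J) \<le> 2 * pi * (1 / 4)" using hi by (intro mult_left_mono) auto
      then show "2 * pi * (\<bar>\<xi>\<bar> / 2 ^ J) \<le> 5 * pi / 6" using pi_gt_zero by linarith
    qed
    also have "\<dots> \<le> \<bar>sin (2 * pi * \<xi> / 2 ^ J)\<bar>" by (cases "\<xi> \<ge> 0") (auto simp: abs_if)
    finally have "1 / 2 \<le> \<bar>sin (2 * pi * \<xi> / 2 ^ J)\<bar>" .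
    then have "(2 ^ J * Q) * (1 / 2) \<le> (2 ^ J * Q) * \<bar>sin (2 * pi * \<xi> / 2 ^ J)\<bar>"
      using Q0 by (intro mult_left_mono) auto
    also have "\<dots> = \<bar>sin (2 * pi * \<xi>)\<bar>"
      unfolding prod_cos[of J \<xi>, symmetric] by (simp add: abs_mult abs_prod Q_def)
    also have "\<dots> \<le> 1" by simp
    finally show ?thesis by simp
  qed
  have "cmod (\<Phi> \<xi>) = (\<Prod>j<J. cmod (m0 (\<xi> / 2 ^ j))) * cmod (\<Phi> (\<xi> / 2 ^ J))"
    by (subst \<Phi>_split[of _ J]) (simp add: norm_mult prod_norm)
  also have "\<dots> \<le> (\<Prod>j<J. \<bar>cos (pi * (\<xi> / 2 ^ j))\<bar> ^ K * 2 ^ (K - 4)) * 1"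
    by (intro mult_mono prod_mono conjI m0_upper \<Phi>_le_1 prod_nonneg) auto
  also have "\<dots> = Q ^ K * (2 ^ (K - 4)) ^ J" by (simp add: Q_def prod.distrib prod_power_distrib)
  finally have 1: "cmod (\<Phi> \<xi>) \<le> Q ^ K * (2 ^ (K - 4)) ^ J" .
  have "(2 ^ J) ^ 4 * (Q ^ K * (2 ^ (K - 4)) ^ J) = (2 ^ J * Q) ^ K"
  proof -
    have "(2 ^ J) ^ 4 * (2 ^ (K - 4)) ^ J = ((2::real) ^ J) ^ K"
      using K by (simp add: power_mult[symmetric] power_add[symmetric] algebra_simps)
    then show ?thesis by (simp add: power_mult_distrib mult_ac)
  qed
  also have "\<dots> \<le> 2 ^ K" using Q Q0 by (intro power_mono) auto
  finally have 2: "(2 ^ J) ^ 4 * (Q ^ K * (2 ^ (K - 4)) ^ J) \<le> 2 ^ K" .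
  have "(1 + \<bar>\<xi>\<bar>) ^ 4 \<le> (5 / 4 * 2 ^ J) ^ 4"
  proof (rule power_mono)
    have "4 * \<bar>\<xi>\<bar> \<le> 2 ^ J" using hi by (simp add: field_simps)
    then show "1 + \<bar>\<xi>\<bar> \<le> 5 / 4 * 2 ^ J" using False by linarith
  qed simp
  also have "\<dots> \<le> 3 * (2 ^ J) ^ 4"
    unfolding power_mult_distrib by (intro mult_right_mono) (simp_all add: power4_eq_xxxx)
  finally have "(1 + \<bar>\<xi>\<bar>) ^ 4 * cmod (\<Phi> \<xi>) \<le> (3 * (2 ^ J) ^ 4) * (Q ^ K * (2 ^ (K - 4)) ^ J)"
    using 1 by (intro mult_mono) auto
  also have "\<dots> \<le> 3 * 2 ^ K" using 2 by simp
  finally have "cmod (\<Phi> \<xi>) \<le> 3 * 2 ^ K / (1 + \<bar>\<xi>\<bar>) ^ 4" by (simp add: field_simps add_pos_nonneg)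
  then show ?thesis by (simp add: wt_def power_divide power_mult[symmetric])
qed

end

section \<open>Decay and lower bounds of the generators\<close>

context mask
begin

definition \<Psi> :: "(real \<Rightarrow> complex) \<Rightarrow> real^2 \<Rightarrow> complex"
  where "\<Psi> m1 \<eta> = m1 (4 * \<eta>$1) * \<Phi> (\<eta>$1) * \<Phi> (2 * \<eta>$2)"

lemma cos_shift: "\<bar>cos (pi * (4 * t + 1 / 2))\<bar> = \<bar>sin (4 * pi * t)\<bar>"
proof -
  have "cos (pi * (4 * t + 1 / 2)) = - sin (4 * pi * t)"
    using minus_sin_cos_eq[of "4 * pi * t"] by (simp add: algebra_simps)
  then show ?thesis by simp
qed

text \<open>The half shift turns the cosine into a sine, so the zero of the mask at
  \<open>1 / 2\<close> becomes a zero of order at least 4 at the origin. The base 16 bounds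
  \<open>4 * pi\<close>; away from the origin the sine is bounded by 1.\<close>

lemma m1_upper:
  assumes m1: "\<And>\<xi>. (cmod (m1 \<xi>))\<^sup>2 = (cmod (m0 (\<xi> + 1 / 2)))\<^sup>2"
  shows "cmod (m1 (4 * t)) \<le> 2 ^ K * 16 ^ 4 * cut4 t"
proof -
  have "cmod (m1 (4 * t)) = cmod (m0 (4 * t + 1 / 2))" using m1[of "4 * t"] by simp
  also have "\<dots> \<le> \<bar>sin (4 * pi * t)\<bar> ^ K * 2 ^ (K - 4)" using m0_upper[of "4 * t + 1 / 2"] by (simp only: cos_shift)
  also have "\<dots> \<le> (16 ^ 4 * cut4 t) * 2 ^ K"
  proof (rule mult_mono)
    have "\<bar>sin (4 * pi * t)\<bar> ^ K \<le> \<bar>sin (4 * pi * t)\<bar> ^ 4"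
      using K by (intro power_decreasing) auto
    also have "\<dots> \<le> (16 * \<bar>t\<bar>) ^ 4"
    proof (rule power_mono)
      have "\<bar>sin (4 * pi * t)\<bar> \<le> \<bar>4 * pi * t\<bar>" by (rule abs_sin_x_le_abs_x)
      also have "\<dots> \<le> 16 * \<bar>t\<bar>" using pi_less_4 by (simp add: abs_mult mult_right_mono)
      finally show "\<bar>sin (4 * pi * t)\<bar> \<le> 16 * \<bar>t\<bar>" .
    qed simp
    also have "\<dots> = 16 ^ 4 * t ^ 4" by (simp only: power_mult_distrib power_even_abs_numeral even_numeral)
    finally have 1: "\<bar>sin (4 * pi * t)\<bar> ^ K \<le> 16 ^ 4 * t ^ 4" .
    have 2: "\<bar>sin (4 * pi * t)\<bar> ^ K \<le> 1" by (intro power_le_one) auto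
    then have 3: "\<bar>sin (4 * pi * t)\<bar> ^ K \<le> 16 ^ 4 * 1" by (rule order_trans) simp
    from 1 3 show "\<bar>sin (4 * pi * t)\<bar> ^ K \<le> 16 ^ 4 * cut4 t" unfolding cut4_def by (cases "t ^ 4 \<le> 1") (simp_all only: min_def if_True if_False simp_thms split: if_splits)
    show "(2::real) ^ (K - 4) \<le> 2 ^ K" by (intro power_increasing) auto
  qed (auto simp: cut4_bounds)
  finally show ?thesis by (simp add: mult_ac)
qed

text \<open>On this band \<open>4 * pi * \<bar>t\<bar>\<close> lies between \<open>pi / 3\<close>
  and \<open>2 * pi / 3\<close>, so the sine stays above \<open>1 / 2\<close>. The band spans one
  octave, hence its dyadic dilates leave no gap.\<close>

lemma m1_lower:
  assumes m1: "\<And>\<xi>. (cmod (m1 \<xi>))\<^sup>2 = (cmod (m0 (\<xi> + 1 / 2)))\<^sup>2"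
    and t: "1 / 12 \<le> \<bar>t\<bar>" "\<bar>t\<bar> \<le> 1 / 6"
  shows "(1 / 2) ^ K \<le> cmod (m1 (4 * t))"
proof -
  have "1 / 2 \<le> sin (4 * pi * \<bar>t\<bar>)"
  proof (rule sin_ge_half_mid)
    have "4 * pi * (1 / 12) \<le> 4 * pi * \<bar>t\<bar>" using t by (intro mult_left_mono) auto
    then show "pi / 6 \<le> 4 * pi * \<bar>t\<bar>" using pi_gt_zero by linarith
    have "4 * pi * \<bar>t\<bar> \<le> 4 * pi * (1 / 6)" using t by (intro mult_left_mono) auto
    then show "4 * pi * \<bar>t\<bar> \<le> 5 * pi / 6" using pi_gt_zero by linarith
  qed
  also have "\<dots> \<le> \<bar>sin (4 * pi * t)\<bar>" by (cases "t \<ge> 0") (auto simp: abs_if)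
  finally have "(1 / 2) ^ K \<le> \<bar>sin (4 * pi * t)\<bar> ^ K" by (intro power_mono) auto
  also have "\<dots> \<le> cmod (m0 (4 * t + 1 / 2))" using m0_lower[of "4 * t + 1 / 2"] by (simp only: cos_shift)
  also have "\<dots> = cmod (m1 (4 * t))" using m1[of "4 * t"] by simp
  finally show ?thesis .
qed

definition C\<phi> :: real where "C\<phi> = (3 * 2 ^ K)\<^sup>2"
definition C\<psi> :: real where "C\<psi> = 2 ^ K * 16 ^ 4 * (3 * 2 ^ K)\<^sup>2"
text \<open>Three factors of \<open>\<Psi>\<close>, each at least \<open>(1 / 2) ^ K\<close>, and
  then squared. The tensor product has only two factors, so the same constant serves both
  generators.\<close>

definition low :: real where "low = ((1 / 2) ^ K) ^ 6"

lemma constants_pos: "0 < C\<phi>" "0 < C\<psi>" "0 < low"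
  by (simp_all add: C\<phi>_def C\<psi>_def low_def)

lemma \<Psi>_decay:
  assumes m1: "\<And>\<xi>. (cmod (m1 \<xi>))\<^sup>2 = (cmod (m0 (\<xi> + 1 / 2)))\<^sup>2"
  shows "cmod (\<Psi> m1 \<eta>) \<le> C\<psi> * cut4 (\<eta>$1) * (wt (\<eta>$1))\<^sup>2 * (wt (\<eta>$2))\<^sup>2"
proof -
  have "cmod (\<Phi> (2 * \<eta>$2)) \<le> 3 * 2 ^ K * (wt (2 * \<eta>$2))\<^sup>2" by (rule \<Phi>_decay)
  also have "\<dots> \<le> 3 * 2 ^ K * (wt (\<eta>$2))\<^sup>2"
    by (intro mult_left_mono power_mono wt_antimono) (auto simp: abs_mult)
  finally have 1: "cmod (\<Phi> (2 * \<eta>$2)) \<le> 3 * 2 ^ K * (wt (\<eta>$2))\<^sup>2" .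
  have "cmod (\<Psi> m1 \<eta>) \<le> (2 ^ K * 16 ^ 4 * cut4 (\<eta>$1)) * (3 * 2 ^ K * (wt (\<eta>$1))\<^sup>2) * (3 * 2 ^ K * (wt (\<eta>$2))\<^sup>2)"
    unfolding \<Psi>_def norm_mult
    by (intro mult_mono m1_upper[OF m1] \<Phi>_decay 1) (auto simp: cut4_bounds)
  then show ?thesis by (simp add: C\<psi>_def power2_eq_square mult_ac)
qed

lemma \<Psi>_lower:
  assumes m1: "\<And>\<xi>. (cmod (m1 \<xi>))\<^sup>2 = (cmod (m0 (\<xi> + 1 / 2)))\<^sup>2"
    and t: "1 / 12 \<le> \<bar>\<eta>$1\<bar>" "\<bar>\<eta>$1\<bar> \<le> 1 / 6" "\<bar>\<eta>$2\<bar> \<le> 1 / 12"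
  shows "low \<le> (cmod (\<Psi> m1 \<eta>))\<^sup>2"
proof -
  have "(1 / 2) ^ K * (1 / 2) ^ K * (1 / 2) ^ K \<le> cmod (\<Psi> m1 \<eta>)"
    unfolding \<Psi>_def norm_mult using t by (intro mult_mono m1_lower[OF m1] \<Phi>_lower) auto
  then have "((1 / 2) ^ K * (1 / 2) ^ K * (1 / 2) ^ K)\<^sup>2 \<le> (cmod (\<Psi> m1 \<eta>))\<^sup>2" by (intro power_mono) auto
  moreover have "((1 / 2) ^ K * (1 / 2) ^ K * (1 / 2) ^ K)\<^sup>2 = low"
    unfolding low_def by (simp add: power_numeral_reduce mult_ac)
  ultimately show ?thesis by simp
qed

lemma \<Phi>_tensor_decay: "cmod (tensor \<Phi> \<eta>) \<le> C\<phi> * 1 * (wt (\<eta>$1))\<^sup>2 * (wt (\<eta>$2))\<^sup>2"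
proof -
  have "cmod (tensor \<Phi> \<eta>) \<le> (3 * 2 ^ K * (wt (\<eta>$1))\<^sup>2) * (3 * 2 ^ K * (wt (\<eta>$2))\<^sup>2)"
    unfolding tensor_def norm_mult by (intro mult_mono \<Phi>_decay) auto
  then show ?thesis by (simp add: C\<phi>_def power2_eq_square mult_ac)
qed

lemma \<Phi>_tensor_lower:
  assumes "\<bar>\<eta>$1\<bar> \<le> 1 / 6" "\<bar>\<eta>$2\<bar> \<le> 1 / 6"
  shows "low \<le> (cmod (tensor \<Phi> \<eta>))\<^sup>2"
proof -
  have "(1 / 2) ^ K * (1 / 2) ^ K \<le> cmod (tensor \<Phi> \<eta>)"
    unfolding tensor_def norm_mult using assms by (intro mult_mono \<Phi>_lower) auto
  then have "((1 / 2) ^ K * (1 / 2) ^ K)\<^sup>2 \<le> (cmod (tensor \<Phi> \<eta>))\<^sup>2" by (intro power_mono) auto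
  moreover have "((1 / 2 :: real) ^ K * (1 / 2) ^ K)\<^sup>2 = ((1 / 2) ^ K) ^ 4"
    by (simp add: power_numeral_reduce mult_ac)
  moreover have "low \<le> ((1 / 2) ^ K) ^ 4"
    unfolding low_def by (intro power_decreasing power_le_one) auto
  ultimately show ?thesis by simp
qed

end

section \<open>Covering the horizontal cone by scales and shears\<close>

definition shears :: "nat \<Rightarrow> int set"
  where "shears j = {k. \<bar>k\<bar> \<le> \<lceil>2 powr (real j / 2)\<rceil>}"

lemma finite_shears [simp]: "finite (shears j)"
proof -
  have "shears j = {- \<lceil>2 powr (real j / 2)\<rceil>..\<lceil>2 powr (real j / 2)\<rceil>}" by (auto simp: shears_def)
  then show ?thesis by simp
qed

text \<open>Minimality of the scale puts \<open>x / 2 ^ j\<close> in the octave from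
  \<open>1 / 12\<close> to \<open>1 / 6\<close>. The shear is the rounding of the value that would
  cancel the second coordinate; the rounding error, at most half of
  \<open>\<bar>x / 2 ^ j\<bar>\<close>, is then at most \<open>1 / 12\<close>.\<close>

lemma horizontal_cone_cover:
  assumes "1 / 12 \<le> \<bar>x\<bar>" "\<bar>y\<bar> \<le> \<bar>x\<bar>"
  obtains j k where "k \<in> shears j" "1 / 12 \<le> \<bar>x / 2 ^ j\<bar>" "\<bar>x / 2 ^ j\<bar> \<le> 1 / 6"
    "\<bar>real_of_int k * (x / 2 ^ j) + y / 2 powr (real j / 2)\<bar> \<le> 1 / 12"
proof -
  define P where "P n \<longleftrightarrow> \<bar>x\<bar> / 2 ^ n \<le> 1 / 6" for n :: nat
  have "\<exists>n. P n"
  proof -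
    obtain n where "6 * \<bar>x\<bar> < 2 ^ n" using real_arch_pow[of 2 "6 * \<bar>x\<bar>"] by auto
    then show ?thesis by (intro exI[of _ n]) (simp add: P_def field_simps)
  qed
  define j where "j = (LEAST n. P n)"
  have Pj: "P j" unfolding j_def using \<open>\<exists>n. P n\<close> by (rule LeastI_ex)
  have lo: "1 / 12 \<le> \<bar>x / 2 ^ j\<bar>"
  proof (cases j)
    case 0 then show ?thesis using assms by simp
  next
    case (Suc i)
    then have "\<not> P i" using not_less_Least[of i P] j_def by auto
    then show ?thesis using Suc by (simp add: P_def abs_divide field_simps)
  qed
  have hi: "\<bar>x / 2 ^ j\<bar> \<le> 1 / 6" using Pj by (simp add: P_def abs_divide)
  define u where "u = x / 2 ^ j"
  define r where "r = 2 powr (real j / 2)"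
  have r: "r > 0" "r * r = 2 ^ j"
    by (simp_all add: r_def powr_add[symmetric] powr_realpow)
  have u0: "u \<noteq> 0" using lo unfolding u_def[symmetric] by auto
  \<comment> \<open>The real shear parameter that makes the second coordinate zero; the cone
    condition bounds it by \<open>2 powr (j / 2)\<close>.\<close>
  define z where "z = - (y / r) / u"
  define k where "k = round z"
  have kz: "\<bar>real_of_int k - z\<bar> \<le> 1 / 2" unfolding k_def by (rule of_int_round_abs_le)
  have "\<bar>z\<bar> \<le> r"
  proof -
    have x0: "x \<noteq> 0" using assms by auto
    have "z = - (y * r) / x"
      unfolding z_def u_def r(2)[symmetric] using r(1) x0 by (simp add: field_simps)
    then have "\<bar>z\<bar> = \<bar>y\<bar> / \<bar>x\<bar> * r" using r(1) by (simp add: abs_mult)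
    also have "\<dots> \<le> 1 * r" using assms x0 r by (intro mult_right_mono) auto
    finally show ?thesis by simp
  qed
  then have "\<bar>real_of_int k\<bar> \<le> r + 1 / 2" using kz by linarith
  \<comment> \<open>With the integer ceiling in place of \<open>r\<close>, integrality of
    \<open>k\<close> removes the excess \<open>1 / 2\<close> due to rounding.\<close>
  then have "\<bar>real_of_int k\<bar> \<le> real_of_int \<lceil>r\<rceil> + 1 / 2" using le_of_int_ceiling[of r] by linarith
  then have "\<bar>k\<bar> \<le> \<lceil>r\<rceil>" by linarith
  then have 1: "k \<in> shears j" by (simp add: shears_def r_def)
  have "\<bar>real_of_int k * u + y / r\<bar> = \<bar>u\<bar> * \<bar>real_of_int k - z\<bar>"
    using u0 by (simp add: z_def abs_mult[symmetric] algebra_simps)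
  also have "\<dots> \<le> \<bar>u\<bar> * (1 / 2)" by (intro mult_left_mono kz) simp
  also have "\<dots> \<le> 1 / 12" using hi by (simp add: u_def)
  finally show thesis using that[OF 1 lo hi] by (simp add: u_def r_def)
qed

subsection \<open>Shearlet systems in the frequency domain\<close>

definition shearlet_matrix :: "nat \<Rightarrow> int \<Rightarrow> real^2^2"
  where "shearlet_matrix j k = shear (- real_of_int k) ** scaling (2 ^ j)"

text \<open>The inverse of \<open>transpose (shearlet_matrix j k)\<close> written out: the frequency
  at which the generator is evaluated for the index \<open>(j, k)\<close>.\<close>

definition shearlet_freq :: "nat \<Rightarrow> int \<Rightarrow> real^2 \<Rightarrow> real^2"
  where "shearlet_freq j k \<xi> = vec2 (\<xi>$1 / 2 ^ j, real_of_int k * (\<xi>$1 / 2 ^ j) + \<xi>$2 / 2 powr (real j / 2))"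

lemma sqrt_2_power: "sqrt (2 ^ j) = 2 powr (real j / 2)"
  by (simp add: powr_half_sqrt[symmetric] powr_powr powr_realpow[symmetric])

lemma transpose_shearlet_matrix_mult: "transpose (shearlet_matrix j k) *v x =
    vec2 (2 ^ j * x$1, 2 powr (real j / 2) * (x$2 - real_of_int k * x$1))"
  by (simp add: shearlet_matrix_def scaling_def shear_def sqrt_2_power diag2_def vec_eq_iff forall_2
      matrix_vector_mult_def vector_matrix_mult_def matrix_matrix_mult_def transpose_def sum_2 algebra_simps)

lemma det_shear: "det (shear t) = 1"
  by (simp add: shear_def det_2)

lemma det_shearlet_matrix: "det (shearlet_matrix j k) = 2 ^ j * 2 powr (real j / 2)"
  by (simp add: shearlet_matrix_def det_mul scaling_def sqrt_2_power det_shear)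

lemma shearlet_freq_eq: "shearlet_freq j k (transpose (shearlet_matrix j k) *v \<eta>) = \<eta>"
proof -
  have "2 powr (real j / 2) \<noteq> 0" by simp
  then show ?thesis
    by (simp add: transpose_shearlet_matrix_mult shearlet_freq_def vec_eq_iff forall_2 del: transpose_matrix_vector)
qed

lemma shearlet_freq_measurable [measurable]: "shearlet_freq j k \<in> borel_measurable borel"
  unfolding shearlet_freq_def vec2_eq by measurable

text \<open>The amplitude is the square root of the determinant, which is the normalization required
  by \<open>lattice_system\<close>.\<close>

lemma shearlet_scale_sq: "(2 powr (3 * real j / 4))\<^sup>2 = 2 ^ j * 2 powr (real j / 2)"
  by (simp add: powr_powr powr_add[symmetric] powr_realpow[symmetric] powr_numeral[symmetric] power2_eq_square)

definition sq_norm :: "(real^2 \<Rightarrow> complex) \<Rightarrow> ennreal"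
  where "sq_norm f = sqint lborel f"

locale generators = mask +
  fixes m1 :: "real \<Rightarrow> complex"
  assumes m1: "\<And>\<xi>. (cmod (m1 \<xi>))\<^sup>2 = (cmod (m0 (\<xi> + 1 / 2)))\<^sup>2"
    and \<Psi>_L2: "\<Psi> m1 \<in> L2" and \<Phi>_L2: "tensor \<Phi> \<in> L2"
begin

definition E\<Phi> :: "real \<Rightarrow> (real^2 \<Rightarrow> complex) \<Rightarrow> ennreal"
  where "E\<Phi> c1 g = lat_energy (mat 1) c1 c1 1 (tensor \<Phi>) g"

definition E\<Psi> :: "real \<Rightarrow> real \<Rightarrow> (real^2 \<Rightarrow> complex) \<Rightarrow> ennreal"
  where "E\<Psi> c1 c2 g = (\<Sum>j. \<Sum>k\<in>shears j. lat_energy (shearlet_matrix j k) c1 c2 (2 powr (3 * real j / 4)) (\<Psi> m1) g)"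

lemma [measurable]: "\<Psi> m1 \<in> borel_measurable borel" "tensor \<Phi> \<in> borel_measurable borel"
  using \<Psi>_L2 \<Phi>_L2 by (auto simp: L2_iff)

lemma coarse_system:
  assumes "0 < c1" "c1 \<le> 1"
  shows "lattice_system (mat 1) c1 c1 1 (tensor \<Phi>) (9 * C\<phi>\<^sup>2) (\<lambda>x. x)"
proof
  show "lat_overlap c1 c1 (tensor \<Phi>) \<eta> \<le> ennreal (9 * C\<phi>\<^sup>2)" for \<eta>
  proof -
    have "lat_overlap c1 c1 (tensor \<Phi>) \<eta> \<le> ennreal (9 * C\<phi>\<^sup>2 * (1 * wt (\<eta>$1) * wt (\<eta>$2)))"
      using assms constants_pos by (intro lat_overlap_le[where p="\<lambda>_. 1"] \<Phi>_tensor_decay) auto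
    also have "\<dots> \<le> ennreal (9 * C\<phi>\<^sup>2 * (1 * 1 * 1))"
      by (intro ennreal_leI mult_left_mono mult_mono wt_le_1) auto
    finally show ?thesis by simp
  qed
qed (use assms \<Phi>_L2 in \<open>auto simp: matrix_vector_mul_lid\<close>)

lemma cone_system:
  assumes "0 < c1" "c1 \<le> 1" "0 < c2" "c2 \<le> 1"
  shows "lattice_system (shearlet_matrix j k) c1 c2 (2 powr (3 * real j / 4)) (\<Psi> m1) (9 * C\<psi>\<^sup>2) (shearlet_freq j k)"
proof
  show "lat_overlap c1 c2 (\<Psi> m1) \<eta> \<le> ennreal (9 * C\<psi>\<^sup>2)" for \<eta>
  proof -
    have "lat_overlap c1 c2 (\<Psi> m1) \<eta> \<le> ennreal (9 * C\<psi>\<^sup>2 * (cut4 (\<eta>$1) * wt (\<eta>$1) * wt (\<eta>$2)))"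
      using assms constants_pos by (intro lat_overlap_le[where p="\<lambda>\<eta>. cut4 (\<eta>$1)"] \<Psi>_decay[OF m1]) (auto simp: cut4_bounds)
    also have "\<dots> \<le> ennreal (9 * C\<psi>\<^sup>2 * (1 * 1 * 1))"
      by (intro ennreal_leI mult_left_mono mult_mono wt_le_1 cut4_bounds) (auto simp: cut4_bounds)
    finally show ?thesis by simp
  qed
qed (use assms \<Psi>_L2 in \<open>auto simp: det_shearlet_matrix shearlet_scale_sq shearlet_freq_eq simp del: transpose_matrix_vector\<close>)

text \<open>The decay left over from the lattice sum, evaluated at the index \<open>(j, k)\<close>;
  both overlaps of the cone generator are multiples of it.\<close>

definition cone_weight :: "real^2 \<Rightarrow> nat \<Rightarrow> int \<Rightarrow> real"
  where "cone_weight \<xi> j k = cut4 (shearlet_freq j k \<xi> $ 1) * wt (shearlet_freq j k \<xi> $ 1) * wt (shearlet_freq j k \<xi> $ 2)"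

lemma cone_weight_measurable [measurable]: "(\<lambda>\<xi>. cone_weight \<xi> j k) \<in> borel_measurable borel"
  unfolding cone_weight_def cut4_def by measurable

lemma cone_weight_nonneg: "0 \<le> cone_weight \<xi> j k"
  by (simp add: cone_weight_def cut4_bounds)

lemma sum_cone_weight: "(\<Sum>j. \<Sum>k\<in>shears j. ennreal (cone_weight \<xi> j k)) \<le> ennreal 40"
  using sum_cone_le[of shears "\<xi>$1" "\<lambda>j. \<xi>$2 / 2 powr (real j / 2)"]
  by (simp add: cone_weight_def shearlet_freq_def)

lemma sum_cone_integral:
  assumes [measurable]: "g \<in> borel_measurable borel"
    and [measurable]: "\<And>j k. (\<lambda>\<xi>. h j k \<xi>) \<in> borel_measurable borel"
  shows "(\<Sum>j. \<Sum>k\<in>shears j. a * (\<integral>\<^sup>+\<xi>. nsq (g \<xi>) * h j k \<xi> \<partial>lborel)) =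
    a * (\<integral>\<^sup>+\<xi>. nsq (g \<xi>) * (\<Sum>j. \<Sum>k\<in>shears j. h j k \<xi>) \<partial>lborel)"
proof -
  have "(\<Sum>j. \<Sum>k\<in>shears j. a * (\<integral>\<^sup>+\<xi>. nsq (g \<xi>) * h j k \<xi> \<partial>lborel)) =
    (\<Sum>j. a * (\<Sum>k\<in>shears j. (\<integral>\<^sup>+\<xi>. nsq (g \<xi>) * h j k \<xi> \<partial>lborel)))"
    by (simp add: sum_distrib_left)
  also have "\<dots> = a * (\<Sum>j. \<Sum>k\<in>shears j. (\<integral>\<^sup>+\<xi>. nsq (g \<xi>) * h j k \<xi> \<partial>lborel))"
    by (rule ennreal_suminf_cmult)
  also have "(\<Sum>j. \<Sum>k\<in>shears j. (\<integral>\<^sup>+\<xi>. nsq (g \<xi>) * h j k \<xi> \<partial>lborel)) =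
     (\<Sum>j. (\<integral>\<^sup>+\<xi>. (\<Sum>k\<in>shears j. nsq (g \<xi>) * h j k \<xi>) \<partial>lborel))"
    by (subst nn_integral_sum) auto
  also have "\<dots> = (\<integral>\<^sup>+\<xi>. (\<Sum>j. \<Sum>k\<in>shears j. nsq (g \<xi>) * h j k \<xi>) \<partial>lborel)"
    by (rule nn_integral_suminf[symmetric]) measurable
  also have "\<dots> = (\<integral>\<^sup>+\<xi>. nsq (g \<xi>) * (\<Sum>j. \<Sum>k\<in>shears j. h j k \<xi>) \<partial>lborel)"
    by (simp add: sum_distrib_left[symmetric] ennreal_suminf_cmult)
  finally show ?thesis .
qed

lemma sum_cone_weight_integral:
  assumes [measurable]: "g \<in> borel_measurable borel" and "0 \<le> b"
  shows "(\<Sum>j. \<Sum>k\<in>shears j. a * (\<integral>\<^sup>+\<xi>. nsq (g \<xi>) * ennreal (b * cone_weight \<xi> j k) \<partial>lborel)) \<le>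
    a * (ennreal (b * 40) * sq_norm g)"
proof -
  have "(\<Sum>j. \<Sum>k\<in>shears j. ennreal (b * cone_weight \<xi> j k)) \<le> ennreal (b * 40)" for \<xi>
  proof -
    have "(\<Sum>j. \<Sum>k\<in>shears j. ennreal (b * cone_weight \<xi> j k)) = ennreal b * (\<Sum>j. \<Sum>k\<in>shears j. ennreal (cone_weight \<xi> j k))"
      using assms(2) by (simp add: ennreal_mult cone_weight_nonneg sum_distrib_left[symmetric] ennreal_suminf_cmult)
    also have "\<dots> \<le> ennreal b * ennreal 40" by (intro mult_left_mono sum_cone_weight) simp
    finally show ?thesis using assms(2) by (simp add: ennreal_mult)
  qed
  then have "(\<integral>\<^sup>+\<xi>. nsq (g \<xi>) * (\<Sum>j. \<Sum>k\<in>shears j. ennreal (b * cone_weight \<xi> j k)) \<partial>lborel) \<le>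
     (\<integral>\<^sup>+\<xi>. nsq (g \<xi>) * ennreal (b * 40) \<partial>lborel)"
    by (intro nn_integral_mono mult_left_mono) auto
  also have "\<dots> = ennreal (b * 40) * sq_norm g"
    unfolding sq_norm_def by (subst nn_integral_multc) (auto simp: mult.commute)
  finally show ?thesis by (subst sum_cone_integral) (auto intro: mult_left_mono)
qed

lemma E\<Phi>_upper:
  assumes g: "g \<in> L2" and c: "0 < c1" "c1 \<le> 1"
  shows "E\<Phi> c1 g \<le> ennreal (1 / (c1 * c1)) * (ennreal (9 * C\<phi>\<^sup>2) * sq_norm g)"
proof -
  interpret S: lattice_system "mat 1" c1 c1 1 "tensor \<Phi>" "9 * C\<phi>\<^sup>2" "\<lambda>x. x" by (rule coarse_system[OF c])
  have [measurable]: "g \<in> borel_measurable borel" using g by (simp add: L2_iff)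
  have "(\<integral>\<^sup>+\<xi>. nsq (g \<xi>) * lat_overlap c1 c1 (tensor \<Phi>) \<xi> \<partial>lborel) \<le> (\<integral>\<^sup>+\<xi>. nsq (g \<xi>) * ennreal (9 * C\<phi>\<^sup>2) \<partial>lborel)"
    by (intro nn_integral_mono mult_left_mono S.overlap_le) auto
  also have "\<dots> = ennreal (9 * C\<phi>\<^sup>2) * sq_norm g"
    unfolding sq_norm_def by (subst nn_integral_multc) (auto simp: mult.commute)
  finally show ?thesis
    unfolding E\<Phi>_def by (intro order_trans[OF S.lat_energy_upper[OF g]] mult_left_mono) auto
qed

lemma E\<Phi>_lower:
  assumes g: "g \<in> L2" and c: "0 < c1" "c1 \<le> 1"
  shows "ennreal (1 / (c1 * c1)) * (\<integral>\<^sup>+\<xi>. nsq (g \<xi>) * nsq (tensor \<Phi> \<xi>) \<partial>lborel) \<le>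
    E\<Phi> c1 g + ennreal (1 / (c1 * c1)) * (ennreal (36 * c1\<^sup>2 * C\<phi>\<^sup>2) * sq_norm g)"
proof -
  interpret S: lattice_system "mat 1" c1 c1 1 "tensor \<Phi>" "9 * C\<phi>\<^sup>2" "\<lambda>x. x" by (rule coarse_system[OF c])
  have [measurable]: "g \<in> borel_measurable borel" using g by (simp add: L2_iff)
  have "lat_off_overlap c1 c1 (tensor \<Phi>) \<eta> \<le> ennreal (36 * c1\<^sup>2 * C\<phi>\<^sup>2)" for \<eta>
  proof -
    have "lat_off_overlap c1 c1 (tensor \<Phi>) \<eta> \<le> ennreal (36 * c1\<^sup>2 * C\<phi>\<^sup>2 * (1 * wt (\<eta>$1) * wt (\<eta>$2)))"
      using c constants_pos by (intro lat_off_overlap_le[where p="\<lambda>_. 1"] \<Phi>_tensor_decay) auto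
    also have "\<dots> \<le> ennreal (36 * c1\<^sup>2 * C\<phi>\<^sup>2 * (1 * 1 * 1))"
      by (intro ennreal_leI mult_left_mono mult_mono wt_le_1) auto
    finally show ?thesis by simp
  qed
  then have "(\<integral>\<^sup>+\<xi>. nsq (g \<xi>) * lat_off_overlap c1 c1 (tensor \<Phi>) \<xi> \<partial>lborel) \<le> (\<integral>\<^sup>+\<xi>. nsq (g \<xi>) * ennreal (36 * c1\<^sup>2 * C\<phi>\<^sup>2) \<partial>lborel)"
    by (intro nn_integral_mono mult_left_mono) auto
  also have "\<dots> = ennreal (36 * c1\<^sup>2 * C\<phi>\<^sup>2) * sq_norm g"
    unfolding sq_norm_def by (subst nn_integral_multc) (auto simp: mult.commute)
  finally show ?thesis
    unfolding E\<Phi>_def by (intro order_trans[OF S.lat_energy_lower[OF g]] add_left_mono mult_left_mono) auto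
qed

lemma E\<Psi>_upper:
  assumes g: "g \<in> L2" and c: "0 < c1" "c1 \<le> 1" "0 < c2" "c2 \<le> 1"
  shows "E\<Psi> c1 c2 g \<le> ennreal (1 / (c1 * c2)) * (ennreal (9 * C\<psi>\<^sup>2 * 40) * sq_norm g)"
proof -
  have [measurable]: "g \<in> borel_measurable borel" using g by (simp add: L2_iff)
  have "E\<Psi> c1 c2 g \<le> (\<Sum>j. \<Sum>k\<in>shears j. ennreal (1 / (c1 * c2)) *
     (\<integral>\<^sup>+\<xi>. nsq (g \<xi>) * ennreal (9 * C\<psi>\<^sup>2 * cone_weight \<xi> j k) \<partial>lborel))"
    unfolding E\<Psi>_def
  proof (intro suminf_le sum_mono)
    fix j k
    interpret S: lattice_system "shearlet_matrix j k" c1 c2 "2 powr (3 * real j / 4)" "\<Psi> m1" "9 * C\<psi>\<^sup>2" "shearlet_freq j k"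
      by (rule cone_system[OF c])
    have "lat_overlap c1 c2 (\<Psi> m1) (shearlet_freq j k \<xi>) \<le> ennreal (9 * C\<psi>\<^sup>2 * cone_weight \<xi> j k)" for \<xi>
      unfolding cone_weight_def using c constants_pos
      by (intro lat_overlap_le[where p="\<lambda>\<eta>. cut4 (\<eta>$1)"] \<Psi>_decay[OF m1]) (auto simp: cut4_bounds)
    then show "lat_energy (shearlet_matrix j k) c1 c2 (2 powr (3 * real j / 4)) (\<Psi> m1) g \<le> ennreal (1 / (c1 * c2)) *
     (\<integral>\<^sup>+\<xi>. nsq (g \<xi>) * ennreal (9 * C\<psi>\<^sup>2 * cone_weight \<xi> j k) \<partial>lborel)"
      by (intro order_trans[OF S.lat_energy_upper[OF g]] mult_left_mono nn_integral_mono) auto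
  qed auto
  also have "\<dots> \<le> ennreal (1 / (c1 * c2)) * (ennreal (9 * C\<psi>\<^sup>2 * 40) * sq_norm g)"
    by (rule sum_cone_weight_integral) auto
  finally show ?thesis .
qed

text \<open>The hypothesis \<open>c2 \<le> c1\<close> makes \<open>c1\<close> the larger sampling
  step, so the off-diagonal error gains \<open>c1 ^ 2\<close> at every index and the sum over
  indices preserves it.\<close>

lemma E\<Psi>_lower:
  assumes g: "g \<in> L2" and c: "0 < c1" "c1 \<le> 1" "0 < c2" "c2 \<le> c1"
  shows "ennreal (1 / (c1 * c2)) * (\<integral>\<^sup>+\<xi>. nsq (g \<xi>) *
      (\<Sum>j. \<Sum>k\<in>shears j. nsq (\<Psi> m1 (shearlet_freq j k \<xi>))) \<partial>lborel) \<le>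
    E\<Psi> c1 c2 g + ennreal (1 / (c1 * c2)) * (ennreal (36 * c1\<^sup>2 * C\<psi>\<^sup>2 * 40) * sq_norm g)"
proof -
  have [measurable]: "g \<in> borel_measurable borel" using g by (simp add: L2_iff)
  let ?off = "\<lambda>j k. ennreal (1 / (c1 * c2)) *
     (\<integral>\<^sup>+\<xi>. nsq (g \<xi>) * ennreal (36 * c1\<^sup>2 * C\<psi>\<^sup>2 * cone_weight \<xi> j k) \<partial>lborel)"
  have "ennreal (1 / (c1 * c2)) * (\<integral>\<^sup>+\<xi>. nsq (g \<xi>) *
      (\<Sum>j. \<Sum>k\<in>shears j. nsq (\<Psi> m1 (shearlet_freq j k \<xi>))) \<partial>lborel) =
    (\<Sum>j. \<Sum>k\<in>shears j. ennreal (1 / (c1 * c2)) *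
     (\<integral>\<^sup>+\<xi>. nsq (g \<xi>) * nsq (\<Psi> m1 (shearlet_freq j k \<xi>)) \<partial>lborel))"
    by (rule sum_cone_integral[symmetric]) measurable
  also have "\<dots> \<le> (\<Sum>j. \<Sum>k\<in>shears j. lat_energy (shearlet_matrix j k) c1 c2 (2 powr (3 * real j / 4)) (\<Psi> m1) g + ?off j k)"
  proof (intro suminf_le sum_mono)
    fix j k
    interpret S: lattice_system "shearlet_matrix j k" c1 c2 "2 powr (3 * real j / 4)" "\<Psi> m1" "9 * C\<psi>\<^sup>2" "shearlet_freq j k"
      using c by (intro cone_system) auto
    have "lat_off_overlap c1 c2 (\<Psi> m1) (shearlet_freq j k \<xi>) \<le> ennreal (36 * c1\<^sup>2 * C\<psi>\<^sup>2 * cone_weight \<xi> j k)" for \<xi>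
      unfolding cone_weight_def using c constants_pos
      by (intro lat_off_overlap_le[where p="\<lambda>\<eta>. cut4 (\<eta>$1)"] \<Psi>_decay[OF m1]) (auto simp: cut4_bounds)
    then show "ennreal (1 / (c1 * c2)) *
     (\<integral>\<^sup>+\<xi>. nsq (g \<xi>) * nsq (\<Psi> m1 (shearlet_freq j k \<xi>)) \<partial>lborel) \<le>
      lat_energy (shearlet_matrix j k) c1 c2 (2 powr (3 * real j / 4)) (\<Psi> m1) g + ?off j k"
      by (intro order_trans[OF S.lat_energy_lower[OF g]] add_left_mono mult_left_mono nn_integral_mono) auto
  qed auto
  also have "\<dots> = E\<Psi> c1 c2 g + (\<Sum>j. \<Sum>k\<in>shears j. ?off j k)"
    unfolding E\<Psi>_def by (simp add: sum.distrib suminf_add[symmetric])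
  also have "\<dots> \<le> E\<Psi> c1 c2 g + ennreal (1 / (c1 * c2)) * (ennreal (36 * c1\<^sup>2 * C\<psi>\<^sup>2 * 40) * sq_norm g)"
    by (intro add_left_mono sum_cone_weight_integral) auto
  finally show ?thesis .
qed

lemma E\<Psi>_add_le:
  assumes g: "g \<in> L2" "h \<in> L2" and c: "0 < c1" "c1 \<le> 1" "0 < c2" "c2 \<le> 1"
  shows "E\<Psi> c1 c2 (\<lambda>x. g x + h x) \<le> 2 * E\<Psi> c1 c2 g + 2 * E\<Psi> c1 c2 h"
proof -
  have "E\<Psi> c1 c2 (\<lambda>x. g x + h x) \<le> (\<Sum>j. \<Sum>k\<in>shears j.
     2 * lat_energy (shearlet_matrix j k) c1 c2 (2 powr (3 * real j / 4)) (\<Psi> m1) g +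
     2 * lat_energy (shearlet_matrix j k) c1 c2 (2 powr (3 * real j / 4)) (\<Psi> m1) h)"
    unfolding E\<Psi>_def
    by (intro suminf_le sum_mono lattice_system.lat_energy_add_le[OF cone_system[OF c] g]) auto
  also have "\<dots> = 2 * E\<Psi> c1 c2 g + 2 * E\<Psi> c1 c2 h"
    unfolding E\<Psi>_def by (simp add: sum.distrib suminf_add[symmetric] sum_distrib_left[symmetric] ennreal_suminf_cmult)
  finally show ?thesis .
qed

end

section \<open>The coordinate swap exchanging the two cones\<close>

definition swap2 :: "real^2 \<Rightarrow> real^2" where "swap2 x = vec2 (x$2, x$1)"

definition swap_matrix :: "real^2^2" where "swap_matrix = vector [vector [0, 1], vector [1, 0]]"

lemma swap2_nth [simp]: "swap2 x $ 1 = x$2" "swap2 x $ 2 = x$1"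
  by (simp_all add: swap2_def)

lemma swap2_swap2 [simp]: "swap2 (swap2 x) = x"
  by (simp add: vec_eq_iff forall_2)

lemma swap2_eq: "swap2 x = swap_matrix *v x"
  by (simp add: swap_matrix_def vec_eq_iff forall_2 matrix_vector_mult_def sum_2)

lemma det_swap_matrix: "det swap_matrix = -1"
  by (simp add: swap_matrix_def det_2)

lemma swap2_measurable [measurable]: "swap2 \<in> borel_measurable borel"
  unfolding swap2_eq[abs_def] by measurable

lemma nn_integral_swap2:
  assumes [measurable]: "f \<in> borel_measurable borel"
  shows "(\<integral>\<^sup>+x. f (swap2 x) \<partial>lborel) = (\<integral>\<^sup>+x. f x \<partial>lborel)"
  using nn_integral_linear[of swap_matrix f] by (simp add: det_swap_matrix swap2_eq)

lemma integral_swap2: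
  fixes f :: "real^2 \<Rightarrow> complex"
  assumes [measurable]: "f \<in> borel_measurable borel"
  shows "(\<integral>x. f (swap2 x) \<partial>lborel) = (\<integral>x. f x \<partial>lborel)"
  using integral_linear[of swap_matrix f] by (simp add: det_swap_matrix swap2_eq)

lemma swap2_L2: "f \<in> L2 \<Longrightarrow> (\<lambda>x. f (swap2 x)) \<in> L2"
  unfolding swap2_eq by (rule linear_L2) (simp_all add: det_swap_matrix)

lemma inner_swap2: "swap2 x \<bullet> y = x \<bullet> swap2 y"
  by (simp add: inner_2)

lemma norm_swap2 [simp]: "norm (swap2 x) = norm x"
  by (simp add: norm_eq_sqrt_inner inner_swap2)

lemma compact_L2_swap2: "compact_L2 f \<Longrightarrow> compact_L2 (\<lambda>x. f (swap2 x))"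
  unfolding compact_L2_def using swap2_L2[of f] by (metis norm_swap2)

lemma ft_swap2:
  assumes [measurable]: "f \<in> borel_measurable borel"
  shows "ft (\<lambda>x. f (swap2 x)) \<xi> = ft f (swap2 \<xi>)"
  using integral_swap2[of "\<lambda>x. f x * cis (- (2 * pi * (x \<bullet> swap2 \<xi>)))"]
  by (simp add: ft_def inner_swap2)

lemma sq_norm_swap2: "f \<in> borel_measurable borel \<Longrightarrow> sq_norm (\<lambda>x. f (swap2 x)) = sq_norm f"
  unfolding sq_norm_def by (rule nn_integral_swap2[of "\<lambda>x. nsq (f x)"]) measurable

lemma sq_norm_finite: "f \<in> L2 \<Longrightarrow> sq_norm f < \<infinity>"
  by (simp add: sq_norm_def L2_iff)

lemma ennreal_mult3:
  "0 \<le> a \<Longrightarrow> 0 \<le> b \<Longrightarrow> ennreal a * (ennreal b * q) = ennreal (a * b) * q"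
  "0 \<le> a \<Longrightarrow> 0 \<le> b \<Longrightarrow> 0 \<le> x \<Longrightarrow> ennreal a * (ennreal b * ennreal x) = ennreal (a * (b * x))"
  by (simp_all add: ennreal_mult mult.assoc)

lemma two_ennreal: "0 \<le> a \<Longrightarrow> 2 * ennreal a = ennreal (2 * a)"
  by (simp add: ennreal_mult)

text \<open>Here \<open>x\<close> and \<open>y\<close> are the squared norms of the low and high
  parts, \<open>p\<close> and \<open>E\<close> the coarse and cone energies, \<open>cc\<close> and
  \<open>c\<close> the products \<open>c1 * c2\<close> and \<open>c1 * c1\<close>. Absorbing
  \<open>\<epsilon>1\<close> bounds \<open>y\<close> by \<open>E\<close> and \<open>x\<close>;
  inserting this in the low estimate leaves a multiple of \<open>x\<close> that
  \<open>\<epsilon>0\<close> makes absorbable.\<close>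

lemma combine_low_high:
  fixes x y :: real
  assumes pos: "0 < \<alpha>" "0 \<le> \<beta>" "0 < cc" "0 \<le> c" "0 \<le> \<epsilon>0" "0 \<le> E" "0 \<le> p" "0 \<le> x" "0 \<le> y"
    and high: "\<alpha> * y \<le> 2 * cc * E + 4 * \<beta> * x + 2 * \<epsilon>1 * y"
    and low: "\<alpha> * x \<le> c * p + \<epsilon>0 * (x + y)"
    and small: "2 * \<epsilon>1 \<le> \<alpha> / 2" "\<epsilon>0 * (1 + 8 * \<beta> / \<alpha>) \<le> \<alpha> / 2"
  shows "x + y \<le> ((1 + 8 * \<beta> / \<alpha>) * (2 / \<alpha> * (c + \<epsilon>0 * (4 * cc / \<alpha>))) + 4 * cc / \<alpha>) * (p + E)"
proof -
  define \<kappa> where "\<kappa> = 8 * \<beta> / \<alpha>"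
  define d where "d = 4 * cc / \<alpha>"
  have \<kappa>: "0 \<le> \<kappa>" "0 \<le> d" using pos by (simp_all add: \<kappa>_def d_def)
  have "2 * \<epsilon>1 * y \<le> \<alpha> / 2 * y" using small pos by (intro mult_right_mono) auto
  then have "\<alpha> / 2 * y \<le> 2 * cc * E + 4 * \<beta> * x" using high by (simp add: field_simps)
  then have "\<alpha> * y \<le> 4 * cc * E + 8 * \<beta> * x" by simp
  then have y: "y \<le> d * E + \<kappa> * x" using pos by (simp add: d_def \<kappa>_def field_simps)
  have "\<epsilon>0 * (x + y) \<le> \<epsilon>0 * (x + (d * E + \<kappa> * x))" using y pos by (intro mult_left_mono) auto
  also have "\<dots> = \<epsilon>0 * (1 + \<kappa>) * x + \<epsilon>0 * d * E" by (simp add: algebra_simps)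
  also have "\<dots> \<le> \<alpha> / 2 * x + \<epsilon>0 * d * E"
    using small(2) pos unfolding \<kappa>_def[symmetric] by (intro add_right_mono mult_right_mono) auto
  finally have "\<alpha> / 2 * x \<le> c * p + \<epsilon>0 * d * E" using low by linarith
  also have "\<dots> \<le> (c + \<epsilon>0 * d) * (p + E)" using pos \<kappa> by (simp add: algebra_simps)
  finally have "2 / \<alpha> * (\<alpha> / 2 * x) \<le> 2 / \<alpha> * ((c + \<epsilon>0 * d) * (p + E))" using pos by (intro mult_left_mono) auto
  moreover have "2 / \<alpha> * (\<alpha> / 2 * x) = x" using pos by simp
  ultimately have x: "x \<le> 2 / \<alpha> * (c + \<epsilon>0 * d) * (p + E)" by (simp only: mult.assoc)
  have "x + y \<le> (1 + \<kappa>) * x + d * E" using y by (simp add: algebra_simps)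
  also have "\<dots> \<le> (1 + \<kappa>) * (2 / \<alpha> * (c + \<epsilon>0 * d) * (p + E)) + d * (p + E)"
    using x \<kappa> pos by (intro add_mono mult_left_mono) auto
  also have "\<dots> = ((1 + \<kappa>) * (2 / \<alpha> * (c + \<epsilon>0 * d)) + d) * (p + E)" by (simp add: distrib_right mult.assoc)
  finally show ?thesis by (simp add: \<kappa>_def d_def)
qed

section \<open>Two-sided energy bounds for all sampling parameters below a threshold\<close>

context generators
begin

text \<open>The vertical cone enters as the horizontal one applied to the swapped function, so each
  cone estimate is used twice.\<close>

definition energy :: "real \<Rightarrow> real \<Rightarrow> (real^2 \<Rightarrow> complex) \<Rightarrow> ennreal"
  where "energy c1 c2 g = E\<Phi> c1 g + E\<Psi> c1 c2 g + E\<Psi> c1 c2 (\<lambda>x. g (swap2 x))"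

lemma energy_upper:
  assumes c: "0 < c1" "c1 \<le> 1" "0 < c2" "c2 \<le> 1"
  shows "\<exists>B>0. \<forall>g\<in>L2. energy c1 c2 g \<le> ennreal B * sq_norm g"
proof -
  define B1 where "B1 = 1 / (c1 * c1) * (9 * C\<phi>\<^sup>2)"
  define B2 where "B2 = 1 / (c1 * c2) * (9 * C\<psi>\<^sup>2 * 40)"
  have pos: "0 < B1" "0 < B2" using c constants_pos by (auto simp: B1_def B2_def)
  have "energy c1 c2 g \<le> ennreal (B1 + B2 + B2) * sq_norm g" if g: "g \<in> L2" for g
  proof -
    have s: "sq_norm (\<lambda>x. g (swap2 x)) = sq_norm g" by (rule sq_norm_swap2[OF L2_measurable[OF g]])
    have "ennreal (1 / (c1 * c1)) * (ennreal (9 * C\<phi>\<^sup>2) * q) = ennreal B1 * q"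
      "ennreal (1 / (c1 * c2)) * (ennreal (9 * C\<psi>\<^sup>2 * 40) * q) = ennreal B2 * q" for q
      unfolding B1_def B2_def by (intro ennreal_mult3; use c in simp)+
    then have "E\<Phi> c1 g \<le> ennreal B1 * sq_norm g" "E\<Psi> c1 c2 g \<le> ennreal B2 * sq_norm g"
      "E\<Psi> c1 c2 (\<lambda>x. g (swap2 x)) \<le> ennreal B2 * sq_norm g"
      using E\<Phi>_upper[OF g c(1,2)] E\<Psi>_upper[OF g c] E\<Psi>_upper[OF swap2_L2[OF g] c]
      by (simp_all only: s)
    then have "energy c1 c2 g \<le> ennreal B1 * sq_norm g + ennreal B2 * sq_norm g + ennreal B2 * sq_norm g"
      unfolding energy_def by (intro add_mono)
    also have "\<dots> = ennreal (B1 + B2 + B2) * sq_norm g"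
      using pos by (simp only: ennreal_plus distrib_right less_imp_le add_nonneg_nonneg)
    finally show ?thesis .
  qed
  then show ?thesis using pos by (intro exI[of _ "B1 + B2 + B2"]) auto
qed

lemma cone_sum_lower:
  assumes "1 / 12 \<le> \<bar>\<xi>$1\<bar>" "\<bar>\<xi>$2\<bar> \<le> \<bar>\<xi>$1\<bar>"
  shows "ennreal low \<le> (\<Sum>j. \<Sum>k\<in>shears j. nsq (\<Psi> m1 (shearlet_freq j k \<xi>)))"
proof -
  obtain j k where k: "k \<in> shears j" and *: "1 / 12 \<le> \<bar>\<xi>$1 / 2 ^ j\<bar>" "\<bar>\<xi>$1 / 2 ^ j\<bar> \<le> 1 / 6"
    "\<bar>real_of_int k * (\<xi>$1 / 2 ^ j) + \<xi>$2 / 2 powr (real j / 2)\<bar> \<le> 1 / 12"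
    using horizontal_cone_cover[OF assms] .
  let ?F = "\<lambda>j k. nsq (\<Psi> m1 (shearlet_freq j k \<xi>))"
  have "ennreal low \<le> ?F j k"
    using * by (intro ennreal_leI \<Psi>_lower[OF m1]) (simp_all add: shearlet_freq_def)
  also have "\<dots> \<le> (\<Sum>k\<in>shears j. ?F j k)" using k by (intro member_le_sum) auto
  also have "\<dots> = (\<Sum>j\<in>{j}. \<Sum>k\<in>shears j. ?F j k)" by simp
  also have "\<dots> \<le> (\<Sum>j. \<Sum>k\<in>shears j. ?F j k)" by (intro sum_le_suminf) auto
  finally show ?thesis .
qed

text \<open>Equivalently, the larger coordinate has modulus at least \<open>1 / 12\<close>. The
  complement is a small square inside the region where the coarse generator is bounded
  below.\<close>

definition in_cones :: "real^2 \<Rightarrow> bool"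
  where "in_cones \<xi> \<longleftrightarrow> (1 / 12 \<le> \<bar>\<xi>$1\<bar> \<and> \<bar>\<xi>$2\<bar> \<le> \<bar>\<xi>$1\<bar>) \<or> (1 / 12 \<le> \<bar>\<xi>$2\<bar> \<and> \<bar>\<xi>$1\<bar> \<le> \<bar>\<xi>$2\<bar>)"

text \<open>The support condition on \<open>G\<close> is essential: at each point of the cones one
  of the two orientations has a generator bounded below, and elsewhere there is nothing to
  estimate.\<close>

lemma energy_high:
  assumes G: "G \<in> L2" "\<And>\<xi>. \<not> in_cones \<xi> \<Longrightarrow> G \<xi> = 0" and c: "0 < c1" "c1 \<le> 1" "0 < c2" "c2 \<le> c1"
  shows "ennreal (1 / (c1 * c2)) * (ennreal low * sq_norm G) \<le> E\<Psi> c1 c2 G + E\<Psi> c1 c2 (\<lambda>x. G (swap2 x)) +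
    2 * (ennreal (1 / (c1 * c2)) * (ennreal (36 * c1\<^sup>2 * C\<psi>\<^sup>2 * 40) * sq_norm G))"
proof -
  have [measurable]: "G \<in> borel_measurable borel" using G by (simp add: L2_iff)
  define S where "S \<xi> = (\<Sum>j. \<Sum>k\<in>shears j. nsq (\<Psi> m1 (shearlet_freq j k \<xi>)))" for \<xi>
  have [measurable]: "S \<in> borel_measurable borel" unfolding S_def[abs_def] by measurable
  have "ennreal low * sq_norm G = (\<integral>\<^sup>+\<xi>. nsq (G \<xi>) * ennreal low \<partial>lborel)"
    unfolding sq_norm_def by (subst nn_integral_multc) (auto simp: mult.commute)
  also have "\<dots> \<le> (\<integral>\<^sup>+\<xi>. nsq (G \<xi>) * (S \<xi> + S (swap2 \<xi>)) \<partial>lborel)"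
  proof (rule nn_integral_mono)
    fix \<xi>
    show "nsq (G \<xi>) * ennreal low \<le> nsq (G \<xi>) * (S \<xi> + S (swap2 \<xi>))"
    proof (cases "in_cones \<xi>")
      case True
      then have "ennreal low \<le> S \<xi> \<or> ennreal low \<le> S (swap2 \<xi>)"
        using cone_sum_lower[of \<xi>] cone_sum_lower[of "swap2 \<xi>"] by (auto simp: in_cones_def S_def)
      then have "ennreal low \<le> S \<xi> + S (swap2 \<xi>)" by (auto intro: add_increasing add_increasing2)
      then show ?thesis by (intro mult_left_mono) auto
    qed (simp add: G)
  qed
  also have "\<dots> = (\<integral>\<^sup>+\<xi>. nsq (G \<xi>) * S \<xi> \<partial>lborel) + (\<integral>\<^sup>+\<xi>. nsq (G \<xi>) * S (swap2 \<xi>) \<partial>lborel)"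
    unfolding distrib_left by (rule nn_integral_add) auto
  also have "(\<integral>\<^sup>+\<xi>. nsq (G \<xi>) * S (swap2 \<xi>) \<partial>lborel) = (\<integral>\<^sup>+\<xi>. nsq (G (swap2 \<xi>)) * S \<xi> \<partial>lborel)"
    by (subst nn_integral_swap2[symmetric]) auto
  finally have "ennreal (1 / (c1 * c2)) * (ennreal low * sq_norm G) \<le> ennreal (1 / (c1 * c2)) * (\<integral>\<^sup>+\<xi>. nsq (G \<xi>) * S \<xi> \<partial>lborel)
     + ennreal (1 / (c1 * c2)) * (\<integral>\<^sup>+\<xi>. nsq (G (swap2 \<xi>)) * S \<xi> \<partial>lborel)"
    unfolding distrib_left[symmetric] by (intro mult_left_mono) auto
  also have "\<dots> \<le> (E\<Psi> c1 c2 G + ennreal (1 / (c1 * c2)) * (ennreal (36 * c1\<^sup>2 * C\<psi>\<^sup>2 * 40) * sq_norm G)) +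
     (E\<Psi> c1 c2 (\<lambda>x. G (swap2 x)) + ennreal (1 / (c1 * c2)) * (ennreal (36 * c1\<^sup>2 * C\<psi>\<^sup>2 * 40) * sq_norm (\<lambda>x. G (swap2 x))))"
    unfolding S_def using G by (intro add_mono E\<Psi>_lower swap2_L2 c)
  also have "\<dots> = E\<Psi> c1 c2 G + E\<Psi> c1 c2 (\<lambda>x. G (swap2 x)) +
    2 * (ennreal (1 / (c1 * c2)) * (ennreal (36 * c1\<^sup>2 * C\<psi>\<^sup>2 * 40) * sq_norm G))"
  proof -
    have *: "(u + w) + (v + w) = u + v + 2 * w" for u v w :: ennreal by (simp only: mult_2 add_ac)
    show ?thesis unfolding sq_norm_swap2[OF \<open>G \<in> borel_measurable borel\<close>] by (rule *)
  qed
  finally show ?thesis .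
qed

text \<open>Only the main term is restricted to low frequencies. The coarse energy is that of the
  whole \<open>g\<close>, so the aliasing error contains the full norm, which is why the high part
  must be bounded as well.\<close>

lemma energy_low:
  assumes g: "g \<in> L2" and l: "\<And>\<xi>. l \<xi> = (if in_cones \<xi> then 0 else g \<xi>)" and c: "0 < c1" "c1 \<le> 1"
  shows "ennreal (1 / (c1 * c1)) * (ennreal low * sq_norm l) \<le> E\<Phi> c1 g + ennreal (1 / (c1 * c1)) * (ennreal (36 * c1\<^sup>2 * C\<phi>\<^sup>2) * sq_norm g)"
proof -
  have [measurable]: "g \<in> borel_measurable borel" using g by (simp add: L2_iff)
  have [measurable]: "l \<in> borel_measurable borel" unfolding l[abs_def] in_cones_def by measurable
  have "ennreal low * sq_norm l = (\<integral>\<^sup>+\<xi>. nsq (l \<xi>) * ennreal low \<partial>lborel)"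
    unfolding sq_norm_def by (subst nn_integral_multc) (auto simp: mult.commute)
  also have "\<dots> \<le> (\<integral>\<^sup>+\<xi>. nsq (g \<xi>) * nsq (tensor \<Phi> \<xi>) \<partial>lborel)"
  proof (rule nn_integral_mono)
    fix \<xi>
    show "nsq (l \<xi>) * ennreal low \<le> nsq (g \<xi>) * nsq (tensor \<Phi> \<xi>)"
    proof (cases "in_cones \<xi>")
      case False
      then have "\<bar>\<xi>$1\<bar> \<le> 1 / 6" "\<bar>\<xi>$2\<bar> \<le> 1 / 6" by (auto simp: in_cones_def)
      then show ?thesis using False by (auto simp: l intro!: mult_left_mono ennreal_leI \<Phi>_tensor_lower)
    qed (simp add: l)
  qed
  finally show ?thesis
    by (intro order_trans[OF _ E\<Phi>_lower[OF g c]] mult_left_mono) auto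
qed

lemma energy_lower:
  "\<exists>c0>0. c0 \<le> 1 \<and> (\<forall>c1 c2. 0 < c1 \<and> 0 < c2 \<and> c2 \<le> c1 \<and> c1 \<le> c0 \<longrightarrow>
    (\<exists>A>0. \<forall>g\<in>L2. ennreal A * sq_norm g \<le> energy c1 c2 g))"
proof -
  define \<beta> where "\<beta> = 9 * C\<psi>\<^sup>2 * 40"
  define \<kappa> where "\<kappa> = 8 * \<beta> / low"
  have \<beta>: "0 < \<beta>" "0 < \<kappa>" using constants_pos by (auto simp: \<beta>_def \<kappa>_def)
  \<comment> \<open>The two quotients are the requirements
    \<open>2 * \<epsilon>1 \<le> low / 2\<close> and
    \<open>\<epsilon>0 * (1 + \<kappa>) \<le> low / 2\<close>, solved for
    \<open>c1 ^ 2\<close>.\<close>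
  define c0 where "c0 = min 1 (min (low / (4 * (36 * C\<psi>\<^sup>2 * 40))) (low / (2 * (36 * C\<phi>\<^sup>2 * (1 + \<kappa>)))))"
  have c0: "0 < c0" "c0 \<le> 1" using constants_pos \<beta> by (auto simp: c0_def intro!: divide_pos_pos mult_pos_pos add_pos_pos)
  show ?thesis
  proof (rule exI[of _ c0], intro conjI c0 allI impI)
    fix c1 c2 :: real assume "0 < c1 \<and> 0 < c2 \<and> c2 \<le> c1 \<and> c1 \<le> c0"
    then have c: "0 < c1" "c1 \<le> 1" "0 < c2" "c2 \<le> c1" "c1 \<le> c0" "c2 \<le> 1" using c0 by auto
    define \<epsilon>1 where "\<epsilon>1 = 36 * c1\<^sup>2 * C\<psi>\<^sup>2 * 40"
    define \<epsilon>0 where "\<epsilon>0 = 36 * c1\<^sup>2 * C\<phi>\<^sup>2"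
    \<comment> \<open>Since \<open>c1 \<le> 1\<close>, a bound on \<open>c1\<close> itself bounds
      its square, and the threshold needs no square root.\<close>
    have "c1\<^sup>2 \<le> c1 * 1" unfolding power2_eq_square using c by (intro mult_left_mono) auto
    then have c12: "c1\<^sup>2 \<le> low / (4 * (36 * C\<psi>\<^sup>2 * 40))" "c1\<^sup>2 \<le> low / (2 * (36 * C\<phi>\<^sup>2 * (1 + \<kappa>)))"
      using c by (auto simp: c0_def)
    have "0 < 4 * (36 * C\<psi>\<^sup>2 * 40)" "0 < 2 * (36 * C\<phi>\<^sup>2 * (1 + \<kappa>))" using constants_pos \<beta> by auto
    then have "c1\<^sup>2 * (4 * (36 * C\<psi>\<^sup>2 * 40)) \<le> low" "c1\<^sup>2 * (2 * (36 * C\<phi>\<^sup>2 * (1 + \<kappa>))) \<le> low"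
      using c12 by (simp_all only: pos_le_divide_eq)
    then have small: "2 * \<epsilon>1 \<le> low / 2" "\<epsilon>0 * (1 + 8 * \<beta> / low) \<le> low / 2"
      unfolding \<kappa>_def[symmetric] by (simp_all add: \<epsilon>1_def \<epsilon>0_def mult_ac)
    define M where "M = (1 + 8 * \<beta> / low) * (2 / low * (c1 * c1 + \<epsilon>0 * (4 * (c1 * c2) / low))) + 4 * (c1 * c2) / low"
    have \<epsilon>: "0 \<le> \<epsilon>0" "0 \<le> \<epsilon>1" by (simp_all add: \<epsilon>0_def \<epsilon>1_def)
    have M: "0 < M" unfolding M_def using c \<beta> \<epsilon> constants_pos by (intro add_nonneg_pos mult_nonneg_nonneg) auto
    have bound: "sq_norm g \<le> ennreal M * energy c1 c2 g" if g: "g \<in> L2" for g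
    proof -
      have [measurable]: "g \<in> borel_measurable borel" using g by (simp add: L2_iff)
      define G where "G \<xi> = (if in_cones \<xi> then g \<xi> else 0)" for \<xi>
      define l where "l \<xi> = (if in_cones \<xi> then 0 else g \<xi>)" for \<xi>
      have m[measurable]: "G \<in> borel_measurable borel" "l \<in> borel_measurable borel"
        unfolding l_def[abs_def] G_def[abs_def] in_cones_def by measurable
      have GL: "G \<in> L2" by (rule L2_bound[OF g m(1)]) (simp add: G_def)
      have lL: "l \<in> L2" by (rule L2_bound[OF g m(2)]) (simp add: l_def)
      have nl: "(\<lambda>x. (-1) * l x) \<in> L2" by (rule L2_cmult[OF lL])
      obtain x where x: "sq_norm l = ennreal x" "0 \<le> x" using sq_norm_finite[OF lL] by (cases "sq_norm l") auto
      obtain y where y: "sq_norm G = ennreal y" "0 \<le> y" using sq_norm_finite[OF GL] by (cases "sq_norm G") auto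
      have nlx: "sq_norm (\<lambda>x. (-1) * l x) = ennreal x" using x by (simp add: sq_norm_def)
      have xy: "sq_norm g = ennreal (x + y)"
      proof -
        have "sq_norm g = (\<integral>\<^sup>+\<xi>. nsq (l \<xi>) + nsq (G \<xi>) \<partial>lborel)"
          unfolding sq_norm_def by (intro nn_integral_cong) (simp add: l_def G_def)
        also have "\<dots> = sq_norm l + sq_norm G" unfolding sq_norm_def by (rule nn_integral_add) auto
        finally show ?thesis using x y by simp
      qed
      \<comment> \<open>Finiteness of every energy allows the absorption to be carried out with real
        numbers.\<close>
      have fin: "energy c1 c2 g < \<infinity>"
        using energy_upper[OF c(1,2,3,6)] g sq_norm_finite[OF g]
        by (metis ennreal_mult_less_top ennreal_less_top infinity_ennreal_def le_less_trans)
      then have "E\<Phi> c1 g < top" "E\<Psi> c1 c2 g < top" "E\<Psi> c1 c2 (\<lambda>x. g (swap2 x)) < top"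
        by (auto simp: energy_def)
      then obtain p e e' where p: "E\<Phi> c1 g = ennreal p" "0 \<le> p" and e: "E\<Psi> c1 c2 g = ennreal e" "0 \<le> e"
        and e': "E\<Psi> c1 c2 (\<lambda>x. g (swap2 x)) = ennreal e'" "0 \<le> e'"
        by (metis ennreal_cases top.not_eq_extremum)
      have up: "E\<Psi> c1 c2 h \<le> ennreal (1 / (c1 * c2) * (\<beta> * x))" if "h \<in> L2" "sq_norm h = ennreal x" for h
      proof -
        have "ennreal (1 / (c1 * c2)) * (ennreal \<beta> * ennreal x) = ennreal (1 / (c1 * c2) * (\<beta> * x))"
          by (rule ennreal_mult3) (use c \<beta> x in auto)
        then show ?thesis
          using E\<Psi>_upper[OF that(1) c(1,2,3,6)] unfolding that(2) \<beta>_def[symmetric] by (simp only:)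
      qed
      \<comment> \<open>Applied with \<open>G = g - l\<close>, directly and after the swap: the cone
        energy of the high part is bounded by that of \<open>g\<close> and the norm of the low
        part.\<close>
      have split: "E\<Psi> c1 c2 h \<le> ennreal (2 * r + 2 * (1 / (c1 * c2) * (\<beta> * x)))"
        if "h = (\<lambda>x. h1 x + h2 x)" "h1 \<in> L2" "h2 \<in> L2" "E\<Psi> c1 c2 h1 = ennreal r" "0 \<le> r" "sq_norm h2 = ennreal x" for h h1 h2 r
      proof -
        have "E\<Psi> c1 c2 h \<le> 2 * E\<Psi> c1 c2 h1 + 2 * E\<Psi> c1 c2 h2"
          unfolding that(1) by (rule E\<Psi>_add_le[OF that(2,3) c(1,2,3,6)])
        also have "\<dots> \<le> 2 * ennreal r + 2 * ennreal (1 / (c1 * c2) * (\<beta> * x))"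
          using that by (intro add_mono mult_left_mono up) auto
        also have "\<dots> = ennreal (2 * r + 2 * (1 / (c1 * c2) * (\<beta> * x)))"
        proof -
          have "0 \<le> 1 / (c1 * c2) * (\<beta> * x)" using c \<beta> x by simp
          then show ?thesis using that(5) by (simp only: two_ennreal ennreal_plus mult_nonneg_nonneg zero_le_numeral)
        qed
        finally show ?thesis .
      qed
      have G1: "E\<Psi> c1 c2 G \<le> ennreal (2 * e + 2 * (1 / (c1 * c2) * (\<beta> * x)))"
        by (rule split[OF _ g nl e nlx]) (auto simp: G_def l_def)
      have G2: "E\<Psi> c1 c2 (\<lambda>x. G (swap2 x)) \<le> ennreal (2 * e' + 2 * (1 / (c1 * c2) * (\<beta> * x)))"
        by (rule split[OF _ swap2_L2[OF g] swap2_L2[OF nl] e'])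
           (use nlx sq_norm_swap2[OF L2_measurable[OF nl]] in \<open>auto simp: G_def l_def\<close>)
      have "ennreal (1 / (c1 * c2) * (low * y)) \<le> ennreal (2 * e + 2 * (1 / (c1 * c2) * (\<beta> * x))) + ennreal (2 * e' + 2 * (1 / (c1 * c2) * (\<beta> * x))) +
         2 * ennreal (1 / (c1 * c2) * (\<epsilon>1 * y))"
      proof -
        have G0: "G \<xi> = 0" if "\<not> in_cones \<xi>" for \<xi> using that by (simp add: G_def)
        have k: "ennreal (1 / (c1 * c2)) * (ennreal low * ennreal y) = ennreal (1 / (c1 * c2) * (low * y))"
          "ennreal (1 / (c1 * c2)) * (ennreal \<epsilon>1 * ennreal y) = ennreal (1 / (c1 * c2) * (\<epsilon>1 * y))"
          using c y constants_pos \<epsilon> by (intro ennreal_mult3; simp)+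
        show ?thesis
          using order_trans[OF energy_high[OF GL G0 c(1-4)] add_right_mono[OF add_mono[OF G1 G2]]]
          unfolding y(1) \<epsilon>1_def[symmetric] k .
      qed
      also have "\<dots> = ennreal ((2 * e + 2 * (1 / (c1 * c2) * (\<beta> * x))) + (2 * e' + 2 * (1 / (c1 * c2) * (\<beta> * x))) + 2 * (1 / (c1 * c2) * (\<epsilon>1 * y)))"
      proof -
        have "0 \<le> 1 / (c1 * c2) * (\<beta> * x)" "0 \<le> 1 / (c1 * c2) * (\<epsilon>1 * y)" using c \<beta> x y \<epsilon> by simp_all
        then show ?thesis using e e'
          by (simp only: two_ennreal ennreal_plus add_nonneg_nonneg mult_nonneg_nonneg zero_le_numeral)
      qed
      finally have "1 / (c1 * c2) * (low * y) \<le> (2 * e + 2 * (1 / (c1 * c2) * (\<beta> * x))) + (2 * e' + 2 * (1 / (c1 * c2) * (\<beta> * x))) + 2 * (1 / (c1 * c2) * (\<epsilon>1 * y))"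
        using c y x e e' \<beta> \<epsilon> by (subst (asm) ennreal_le_iff) auto
      \<comment> \<open>Multiplication by \<open>d = c1 * c2\<close> frees the low-frequency term
        from the sampling parameters, which is what makes the threshold independent of
        \<open>c2\<close>.\<close>
      moreover have "a \<le> 2 * d * (e + e') + 4 * b + 2 * w"
        if "1 / d * a \<le> (2 * e + 2 * (1 / d * b)) + (2 * e' + 2 * (1 / d * b)) + 2 * (1 / d * w)" "0 < d" for a b d w :: real
      proof -
        have "d * (1 / d * a) \<le> d * ((2 * e + 2 * (1 / d * b)) + (2 * e' + 2 * (1 / d * b)) + 2 * (1 / d * w))"
          using that by (intro mult_left_mono) auto
        also have "\<dots> = 2 * d * (e + e') + 4 * (d * (1 / d * b)) + 2 * (d * (1 / d * w))"
          by (simp only: algebra_simps) simp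
        finally show ?thesis using that(2) by simp
      qed
      ultimately have high: "low * y \<le> 2 * (c1 * c2) * (e + e') + 4 * \<beta> * x + 2 * \<epsilon>1 * y"
        using c unfolding mult.assoc[of 4] mult.assoc[of 2 \<epsilon>1] by (meson mult_pos_pos)
      have "ennreal (1 / (c1 * c1) * (low * x)) \<le> ennreal p + ennreal (1 / (c1 * c1) * (\<epsilon>0 * (x + y)))"
      proof -
        have k: "ennreal (1 / (c1 * c1)) * (ennreal low * ennreal x) = ennreal (1 / (c1 * c1) * (low * x))"
          "ennreal (1 / (c1 * c1)) * (ennreal \<epsilon>0 * ennreal (x + y)) = ennreal (1 / (c1 * c1) * (\<epsilon>0 * (x + y)))"
          using c x y constants_pos \<epsilon> by (intro ennreal_mult3; simp)+
        show ?thesis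
          using energy_low[OF g l_def c(1,2)] unfolding x(1) xy p(1) \<epsilon>0_def[symmetric] k .
      qed
      then have "1 / (c1 * c1) * (low * x) \<le> p + 1 / (c1 * c1) * (\<epsilon>0 * (x + y))"
        using c x y p \<epsilon> by (subst (asm) ennreal_plus[symmetric]) (auto simp: ennreal_le_iff simp del: ennreal_plus)
      then have low: "low * x \<le> (c1 * c1) * p + \<epsilon>0 * (x + y)"
        using c by (simp add: field_simps)
      have "x + y \<le> M * (p + (e + e'))"
        unfolding M_def
        by (rule combine_low_high[OF _ _ _ _ \<epsilon>(1) _ p(2) x(2) y(2) high low small]) (use c \<beta> e e' constants_pos in auto)
      then have "ennreal (x + y) \<le> ennreal (M * (p + (e + e')))" by (rule ennreal_leI)
      also have "\<dots> = ennreal M * energy c1 c2 g"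
        using M p e e' by (simp add: energy_def ennreal_mult add.assoc)
      finally show ?thesis unfolding xy .
    qed
    show "\<exists>A>0. \<forall>g\<in>L2. ennreal A * sq_norm g \<le> energy c1 c2 g"
    proof (intro exI[of _ "1 / M"] conjI ballI)
      fix g :: "real^2 \<Rightarrow> complex" assume "g \<in> L2"
      then have "ennreal (1 / M) * sq_norm g \<le> ennreal (1 / M) * (ennreal M * energy c1 c2 g)"
        by (intro mult_left_mono bound) auto
      also have "\<dots> = energy c1 c2 g" using M by (simp add: mult.assoc[symmetric] ennreal_mult[symmetric])
      finally show "ennreal (1 / M) * sq_norm g \<le> energy c1 c2 g" .
    qed (use M in simp)
  qed
qed

end

subsection \<open>From compactly supported functions to the frame property\<close>

lemma nn_integral_shearlet_indices:
  "(\<integral>\<^sup>+i. F i \<partial>count_space shearlet_indices) = (\<Sum>\<^sup>+m. F (Coarse m)) +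
    (\<Sum>j. \<Sum>k\<in>shears j. (\<Sum>\<^sup>+m. F (Horizontal j k m))) +
    (\<Sum>j. \<Sum>k\<in>shears j. (\<Sum>\<^sup>+m. F (Vertical j k m)))"
proof -
  define S :: "(nat \<times> int \<times> (int^2)) set" where "S = {(j, k, m). k \<in> shears j}"
  define A where "A = range Coarse"
  define H where "H = (\<lambda>(j, k, m). Horizontal j k m) ` S"
  define V where "V = (\<lambda>(j, k, m). Vertical j k m) ` S"
  have I: "shearlet_indices = A \<union> H \<union> V"
  proof -
    have "Horizontal j k m \<in> H" "Vertical j k m \<in> V" if "k \<in> shears j" for j k m
      unfolding H_def V_def by (rule image_eqI[of _ _ "(j, k, m)"]; use that in \<open>simp add: S_def\<close>)+
    then show ?thesis
      by (auto simp: shearlet_indices_def A_def shears_def) (auto simp: H_def V_def S_def shears_def)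
  qed
  have sum: "(\<integral>\<^sup>+p. f p \<partial>count_space S) = (\<Sum>j. \<Sum>k\<in>shears j. (\<Sum>\<^sup>+m. f (j, k, m)))"
    for f :: "nat \<times> int \<times> (int^2) \<Rightarrow> ennreal"
  proof -
    have "(\<integral>\<^sup>+p. f p \<partial>count_space S) = (\<Sum>\<^sup>+p. f p * indicator S p)"
      by (rule nn_integral_count_space_indicator) simp
    also have "\<dots> = (\<Sum>\<^sup>+j. (\<Sum>\<^sup>+q. f (j, q) * indicator S (j, q)))"
      by (rule nn_integral_fst_count_space[symmetric])
    also have "\<dots> = (\<Sum>\<^sup>+j. (\<Sum>\<^sup>+k. (\<Sum>\<^sup>+m. f (j, k, m) * indicator S (j, k, m))))"
      by (intro nn_integral_cong nn_integral_fst_count_space[symmetric])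
    also have "\<dots> = (\<Sum>\<^sup>+j. (\<Sum>\<^sup>+k. (\<Sum>\<^sup>+m. f (j, k, m)) * indicator (shears j) k))"
      by (intro nn_integral_cong) (auto simp: indicator_def S_def)
    also have "\<dots> = (\<Sum>\<^sup>+j. (\<Sum>k\<in>shears j. (\<Sum>\<^sup>+m. f (j, k, m))))"
      by (simp add: nn_integral_count_space_indicator[symmetric] nn_integral_count_space_finite)
    also have "\<dots> = (\<Sum>j. \<Sum>k\<in>shears j. (\<Sum>\<^sup>+m. f (j, k, m)))"
      by (rule nn_integral_count_space_nat)
    finally show ?thesis .
  qed
  have "(\<integral>\<^sup>+i. F i \<partial>count_space H) = (\<integral>\<^sup>+p. F (case p of (j, k, m) \<Rightarrow> Horizontal j k m) \<partial>count_space S)"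
    by (rule nn_integral_bij_count_space[symmetric]) (auto simp: H_def bij_betw_def inj_on_def)
  then have H: "(\<integral>\<^sup>+i. F i \<partial>count_space H) = (\<Sum>j. \<Sum>k\<in>shears j. (\<Sum>\<^sup>+m. F (Horizontal j k m)))"
    by (simp add: sum)
  have "(\<integral>\<^sup>+i. F i \<partial>count_space V) = (\<integral>\<^sup>+p. F (case p of (j, k, m) \<Rightarrow> Vertical j k m) \<partial>count_space S)"
    by (rule nn_integral_bij_count_space[symmetric]) (auto simp: V_def bij_betw_def inj_on_def)
  then have V: "(\<integral>\<^sup>+i. F i \<partial>count_space V) = (\<Sum>j. \<Sum>k\<in>shears j. (\<Sum>\<^sup>+m. F (Vertical j k m)))"
    by (simp add: sum)
  have "(\<integral>\<^sup>+i. F i \<partial>count_space shearlet_indices) = (\<Sum>\<^sup>+i. F i * indicator (A \<union> H \<union> V) i)"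
    unfolding I by (rule nn_integral_count_space_indicator) simp
  also have "\<dots> = (\<Sum>\<^sup>+i. F i * indicator A i + F i * indicator H i + F i * indicator V i)"
    by (intro nn_integral_cong) (auto simp: indicator_def A_def H_def V_def)
  also have "\<dots> = (\<integral>\<^sup>+i. F i \<partial>count_space A) + (\<integral>\<^sup>+i. F i \<partial>count_space H) + (\<integral>\<^sup>+i. F i \<partial>count_space V)"
    by (simp add: nn_integral_add nn_integral_count_space_indicator)
  also have "(\<integral>\<^sup>+i. F i \<partial>count_space A) = (\<Sum>\<^sup>+m. F (Coarse m))"
    by (rule nn_integral_bij_count_space[symmetric]) (auto simp: A_def bij_betw_def inj_on_def)
  finally show ?thesis unfolding H V .
qed

lemma countable_shearlet_indices: "countable shearlet_indices"
proof -
  have "shearlet_indices \<subseteq> range Coarse \<union> range (\<lambda>(j, k, m). Horizontal j k m) \<union> range (\<lambda>(j, k, m). Vertical j k m)"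
  proof -
    have "Horizontal j k m \<in> range (\<lambda>(j, k, m). Horizontal j k m)" "Vertical j k m \<in> range (\<lambda>(j, k, m). Vertical j k m)" for j k m
      by (rule range_eqI[of _ _ "(j, k, m)"], simp)+
    then show ?thesis by (auto simp: shearlet_indices_def)
  qed
  then show ?thesis by (rule countable_subset) (intro countable_Un countable_image countableI_type)
qed

definition frame_energy :: "'i set \<Rightarrow> ('i \<Rightarrow> real^2 \<Rightarrow> complex) \<Rightarrow> (real^2 \<Rightarrow> complex) \<Rightarrow> ennreal"
  where "frame_energy I \<sigma> f = (\<integral>\<^sup>+i. nsq (L2_inner f (\<sigma> i)) \<partial>count_space I)"

lemma L2_inner_tendsto:
  assumes "f \<in> L2" "\<And>n. a n \<in> L2" "s \<in> L2" "(\<lambda>n. sqdist lborel f (a n)) \<longlonglongrightarrow> 0"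
  shows "(\<lambda>n. L2_inner (a n) s) \<longlonglongrightarrow> L2_inner f s"
proof -
  have "(\<lambda>n. cnj (\<integral>x. s x * cnj (a n x) \<partial>lborel)) \<longlonglongrightarrow> cnj (\<integral>x. s x * cnj (f x) \<partial>lborel)"
    by (intro tendsto_cnj integral_L2_tendsto assms)
  moreover have "cnj (\<integral>x. s x * cnj (h x) \<partial>lborel) = L2_inner h s" for h
    unfolding L2_inner_def
    by (subst Bochner_Integration.integral_cnj[symmetric], rule Bochner_Integration.integral_cong) (simp_all add: mult.commute)
  ultimately show ?thesis by simp
qed

lemma L2_inner_diff:
  assumes "f \<in> L2" "g \<in> L2" "s \<in> L2"
  shows "L2_inner f s = L2_inner g s + L2_inner (\<lambda>x. f x - g x) s"
  using integrable_L2_mult[OF assms(1,3)] integrable_L2_mult[OF assms(2,3)]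
  by (simp add: L2_inner_def left_diff_distrib)

text \<open>Compactly supported functions are dense: Fatou's lemma transfers the upper bound to all of
  \<open>L\<^sup>2\<close>, after which the lower bound follows by approximation.\<close>

lemma is_L2_frame_compact:
  fixes \<sigma> :: "'i \<Rightarrow> real^2 \<Rightarrow> complex"
  assumes I: "countable I" and \<sigma>: "\<And>i. i \<in> I \<Longrightarrow> \<sigma> i \<in> L2"
    and AB: "0 < A" "0 < B"
    and lower: "\<And>f. compact_L2 f \<Longrightarrow> ennreal A * sq_norm f \<le> frame_energy I \<sigma> f"
    and upper: "\<And>f. compact_L2 f \<Longrightarrow> frame_energy I \<sigma> f \<le> ennreal B * sq_norm f"
  shows "is_L2_frame I \<sigma>"
proof -
  define tr where "tr n f x = indicator (cball 0 (real n)) x *\<^sub>R (f x :: complex)" for n f and x :: "real^2"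
  have tr: "compact_L2 (tr n f)" "tr n f \<in> L2" "(\<lambda>n. sqdist lborel f (tr n f)) \<longlonglongrightarrow> 0" if "f \<in> L2" for f n
    using compact_L2_truncation[OF that, of n] truncation_tendsto[OF that]
    unfolding tr_def[abs_def] by (auto simp: compact_L2_def)
  have tr_le: "sq_norm (tr n f) \<le> sq_norm f" for n f
    unfolding sq_norm_def tr_def by (intro nn_integral_mono) (auto simp: indicator_def)
  have up: "frame_energy I \<sigma> f \<le> ennreal B * sq_norm f" if f: "f \<in> L2" for f
  proof -
    have "frame_energy I \<sigma> f = (\<integral>\<^sup>+i. liminf (\<lambda>n. nsq (L2_inner (tr n f) (\<sigma> i))) \<partial>count_space I)"
      unfolding frame_energy_def
    proof (rule nn_integral_cong)
      fix i assume "i \<in> space (count_space I)"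
      then have "(\<lambda>n. nsq (L2_inner (tr n f) (\<sigma> i))) \<longlonglongrightarrow> nsq (L2_inner f (\<sigma> i))"
        using f tr \<sigma> by (intro tendsto_ennrealI tendsto_power tendsto_norm L2_inner_tendsto) auto
      then show "nsq (L2_inner f (\<sigma> i)) = liminf (\<lambda>n. nsq (L2_inner (tr n f) (\<sigma> i)))"
        by (intro lim_imp_Liminf[symmetric]) auto
    qed
    also have "\<dots> \<le> liminf (\<lambda>n. frame_energy I \<sigma> (tr n f))"
      unfolding frame_energy_def by (rule nn_integral_liminf) simp
    also have "\<dots> \<le> liminf (\<lambda>n. ennreal B * sq_norm f)"
      by (intro Liminf_mono always_eventually allI order_trans[OF upper[OF tr(1)[OF f]]] mult_left_mono tr_le) simp
    also have "\<dots> = ennreal B * sq_norm f" by (intro Liminf_const) simp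
    finally show ?thesis .
  qed
  have low: "ennreal A * sq_norm f \<le> 4 * frame_energy I \<sigma> f" if f: "f \<in> L2" for f
  proof -
    define d where "d n = sqdist lborel f (tr n f)" for n
    have d: "d \<longlonglongrightarrow> 0" using tr(3)[OF f] by (simp add: d_def[abs_def])
    have [measurable]: "f \<in> borel_measurable borel" "tr n f \<in> borel_measurable borel" for n
      using f tr(2)[OF f] by (auto simp: L2_iff)
    have "ennreal A * sq_norm f \<le> 4 * frame_energy I \<sigma> f + (4 * ennreal B + 2 * ennreal A) * d n" for n
    proof -
      have diff: "(\<lambda>x. f x - tr n f x) \<in> L2" by (rule L2_diff[OF f tr(2)[OF f]])
      have dn: "d n = sq_norm (\<lambda>x. f x - tr n f x)" by (simp add: d_def sqdist_def sq_norm_def)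
      have 1: "sq_norm f \<le> 2 * sq_norm (tr n f) + 2 * d n"
        using sqint_add_le[of "\<lambda>x. tr n f x" lborel "\<lambda>x. f x - tr n f x"] by (simp add: sq_norm_def d_def sqdist_def)
      have 2: "frame_energy I \<sigma> (tr n f) \<le> 2 * frame_energy I \<sigma> f + 2 * frame_energy I \<sigma> (\<lambda>x. f x - tr n f x)"
      proof -
        have "frame_energy I \<sigma> (tr n f) \<le> (\<integral>\<^sup>+i. 2 * nsq (L2_inner f (\<sigma> i)) + 2 * nsq (L2_inner (\<lambda>x. f x - tr n f x) (\<sigma> i)) \<partial>count_space I)"
          unfolding frame_energy_def
        proof (rule nn_integral_mono)
          fix i assume "i \<in> space (count_space I)"
          then have "L2_inner (tr n f) (\<sigma> i) = L2_inner f (\<sigma> i) + - L2_inner (\<lambda>x. f x - tr n f x) (\<sigma> i)"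
            using L2_inner_diff[OF f tr(2)[OF f, of n] \<sigma>] by simp
          then have "(cmod (L2_inner (tr n f) (\<sigma> i)))\<^sup>2 \<le> 2 * (cmod (L2_inner f (\<sigma> i)))\<^sup>2 + 2 * (cmod (L2_inner (\<lambda>x. f x - tr n f x) (\<sigma> i)))\<^sup>2"
            using cmod_add_sq_le[of "L2_inner f (\<sigma> i)" "- L2_inner (\<lambda>x. f x - tr n f x) (\<sigma> i)"] by simp
          then have "nsq (L2_inner (tr n f) (\<sigma> i)) \<le> ennreal (2 * (cmod (L2_inner f (\<sigma> i)))\<^sup>2 + 2 * (cmod (L2_inner (\<lambda>x. f x - tr n f x) (\<sigma> i)))\<^sup>2)"
            by (rule ennreal_leI)
          then show "nsq (L2_inner (tr n f) (\<sigma> i)) \<le> 2 * nsq (L2_inner f (\<sigma> i)) + 2 * nsq (L2_inner (\<lambda>x. f x - tr n f x) (\<sigma> i))"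
            by (simp add: ennreal_mult)
        qed
        also have "\<dots> = 2 * frame_energy I \<sigma> f + 2 * frame_energy I \<sigma> (\<lambda>x. f x - tr n f x)"
          unfolding frame_energy_def by (simp add: nn_integral_add nn_integral_cmult)
        finally show ?thesis .
      qed
      have "ennreal A * sq_norm f \<le> 2 * (ennreal A * sq_norm (tr n f)) + 2 * ennreal A * d n"
        using mult_left_mono[OF 1, of "ennreal A"] by (simp add: distrib_left mult_ac)
      also have "\<dots> \<le> 2 * (2 * frame_energy I \<sigma> f + 2 * (ennreal B * d n)) + 2 * ennreal A * d n"
        using order_trans[OF lower[OF tr(1)[OF f]] order_trans[OF 2 add_left_mono[OF mult_left_mono[OF up[OF diff]]]]]
        unfolding dn by (intro add_right_mono mult_left_mono) auto
      also have "\<dots> = 4 * frame_energy I \<sigma> f + (4 * ennreal B + 2 * ennreal A) * d n"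
        by (simp add: distrib_left distrib_right mult.assoc[symmetric] add.assoc)
      finally show ?thesis .
    qed
    moreover have "(\<lambda>n. 4 * frame_energy I \<sigma> f + (4 * ennreal B + 2 * ennreal A) * d n) \<longlonglongrightarrow> 4 * frame_energy I \<sigma> f + (4 * ennreal B + 2 * ennreal A) * 0"
      by (intro tendsto_add tendsto_const ennreal_tendsto_cmult d) (simp add: ennreal_mult_less_top)
    ultimately show ?thesis
      by (intro LIMSEQ_le_const[where X="\<lambda>n. 4 * frame_energy I \<sigma> f + (4 * ennreal B + 2 * ennreal A) * d n"]) auto
  qed
  have "\<forall>f\<in>L2. (\<lambda>i. (cmod (L2_inner f (\<sigma> i)))\<^sup>2) summable_on I \<and>
    A / 4 * (L2_norm f)\<^sup>2 \<le> (\<Sum>\<^sub>\<infinity>i\<in>I. (cmod (L2_inner f (\<sigma> i)))\<^sup>2) \<and>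
    (\<Sum>\<^sub>\<infinity>i\<in>I. (cmod (L2_inner f (\<sigma> i)))\<^sup>2) \<le> max (A / 4) B * (L2_norm f)\<^sup>2"
  proof (intro conjI ballI)
    fix f :: "real^2 \<Rightarrow> complex" assume f: "f \<in> L2"
    define r where "r i = (cmod (L2_inner f (\<sigma> i)))\<^sup>2" for i
    have n: "sq_norm f = ennreal ((L2_norm f)\<^sup>2)"
      using f unfolding sq_norm_def L2_norm_def by (subst nn_integral_eq_integral) (auto simp: L2_def)
    have fin: "frame_energy I \<sigma> f < \<infinity>"
      using le_less_trans[OF up[OF f]] by (simp add: n ennreal_mult_less_top)
    then have sm: "r summable_on I"
      by (intro summable_on_nn_integral_count_space) (simp_all add: frame_energy_def r_def)
    show "(\<lambda>i. (cmod (L2_inner f (\<sigma> i)))\<^sup>2) summable_on I" using sm by (simp add: r_def[abs_def])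
    have e: "frame_energy I \<sigma> f = ennreal (infsum r I)"
      using nn_integral_count_space_infsum[OF sm] by (simp add: frame_energy_def r_def)
    have r0: "0 \<le> infsum r I" by (intro infsum_nonneg) (simp add: r_def)
    have "ennreal (A * (L2_norm f)\<^sup>2) \<le> ennreal (4 * infsum r I)"
      using low[OF f] AB r0 unfolding e n by (simp add: ennreal_mult)
    then have "A * (L2_norm f)\<^sup>2 \<le> 4 * infsum r I" using r0 by (subst (asm) ennreal_le_iff) auto
    then show "A / 4 * (L2_norm f)\<^sup>2 \<le> (\<Sum>\<^sub>\<infinity>i\<in>I. (cmod (L2_inner f (\<sigma> i)))\<^sup>2)" by (simp add: r_def[abs_def])
    have "ennreal (infsum r I) \<le> ennreal (B * (L2_norm f)\<^sup>2)"
      using up[OF f] AB unfolding e n by (simp add: ennreal_mult)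
    then have "infsum r I \<le> B * (L2_norm f)\<^sup>2" using AB by (subst (asm) ennreal_le_iff) auto
    also have "\<dots> \<le> max (A / 4) B * (L2_norm f)\<^sup>2" by (intro mult_right_mono) auto
    finally show "(\<Sum>\<^sub>\<infinity>i\<in>I. (cmod (L2_inner f (\<sigma> i)))\<^sup>2) \<le> max (A / 4) B * (L2_norm f)\<^sup>2" by (simp add: r_def[abs_def])
  qed
  moreover have "0 < A / 4" "A / 4 \<le> max (A / 4) B" using AB by auto
  ultimately show ?thesis unfolding is_L2_frame_def using I \<sigma> by blast
qed

section \<open>The shearlet system expressed by the frequency-side energies\<close>

context generators
begin

text \<open>Conjugation by the coordinate swap carries the transposed shear and the second scaling
  to the first ones, and the flipped sampling matrix to the original with the entries of
  \<open>m\<close> exchanged. Vertical coefficients of \<open>f\<close> are thus horizontal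
  coefficients of the swapped \<open>f\<close>, up to a permutation of the lattice.\<close>

lemma frame_energy_shearlet_system:
  assumes f: "compact_L2 f" and c: "0 < c$1" "0 < c$2"
    and \<phi>: "fourier_pair \<phi> (tensor \<Phi>)" and \<psi>: "fourier_pair \<psi> (\<Psi> m1)"
  shows "frame_energy shearlet_indices (shearlet_system c \<phi> \<psi> (\<lambda>x. \<psi> (swap2 x))) f = energy (c$1) (c$2) (ft f)"
proof -
  let ?\<sigma> = "shearlet_system c \<phi> \<psi> (\<lambda>x. \<psi> (swap2 x))"
  have fm: "f \<in> borel_measurable borel" using f by (simp add: compact_L2_def L2_iff)
  have h: "(\<Sum>\<^sup>+m. nsq (L2_inner h (?\<sigma> (Horizontal j k m)))) =
      lat_energy (shearlet_matrix j k) (c$1) (c$2) (2 powr (3 * real j / 4)) (\<Psi> m1) (ft h)" if h: "compact_L2 h" for h j k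
    unfolding lat_energy_def using c
    by (intro nn_integral_cong, subst L2_inner_lat_coef[OF h \<psi>, symmetric])
       (use det_shearlet_matrix[of j k] in \<open>auto simp: shearlet_matrix_def sampling_def\<close>)
  have v: "L2_inner f (?\<sigma> (Vertical j k m)) = L2_inner (\<lambda>x. f (swap2 x)) (?\<sigma> (Horizontal j k (\<chi> i. m $ (if i = 1 then 2 else 1))))" for j k m
  proof -
    have [measurable]: "\<psi> \<in> borel_measurable borel" using \<psi> by (auto simp: fourier_pair_def L2_iff)
    note [measurable] = fm
    have tr: "transpose (shear t) = vector [vector [1, 0], vector [t, 1]]" for t
      by (simp add: shear_def transpose_def vec_eq_iff forall_2)
    let ?u = "\<lambda>x. transpose (shear (- real_of_int k)) ** scaling_tilde (2 ^ j) *v x - sampling_tilde c *v lattice m"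
    have u: "swap2 (?u (swap2 x)) = shear (- real_of_int k) ** scaling (2 ^ j) *v x - sampling c *v lattice (\<chi> i. m $ (if i = 1 then 2 else 1))" for x
      unfolding tr
      by (simp add: vec_eq_iff forall_2 scaling_tilde_def scaling_def sampling_def sampling_tilde_def
          matrix_vector_mul_assoc[symmetric] shear_def matrix_vector_mult_def[of "vector _"] sum_2
          del: transpose_matrix_vector)
    have "L2_inner f (?\<sigma> (Vertical j k m)) = (\<integral>x. f (swap2 x) * cnj (?\<sigma> (Vertical j k m) (swap2 x)) \<partial>lborel)"
      unfolding L2_inner_def shearlet_system.simps
      by (rule integral_swap2[symmetric]) measurable
    also have "\<dots> = L2_inner (\<lambda>x. f (swap2 x)) (?\<sigma> (Horizontal j k (\<chi> i. m $ (if i = 1 then 2 else 1))))"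
      unfolding L2_inner_def shearlet_system.simps u ..
    finally show ?thesis .
  qed
  have bij: "bij_betw (\<lambda>m. \<chi> i. m $ (if i = 1 then 2 else 1)) (UNIV :: (int^2) set) (UNIV :: (int^2) set)"
    by (rule bij_betwI[where g="\<lambda>m. \<chi> i. m $ (if i = 1 then 2 else 1)"]) (auto simp: vec_eq_iff forall_2)
  have v': "(\<Sum>\<^sup>+m. nsq (L2_inner f (?\<sigma> (Vertical j k m)))) =
      lat_energy (shearlet_matrix j k) (c$1) (c$2) (2 powr (3 * real j / 4)) (\<Psi> m1) (\<lambda>x. ft f (swap2 x))" for j k
    unfolding v
    using nn_integral_bij_count_space[OF bij, of "\<lambda>m. nsq (L2_inner (\<lambda>x. f (swap2 x)) (?\<sigma> (Horizontal j k m)))"]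
      h[OF compact_L2_swap2[OF f], of j k] by (simp add: ft_swap2[OF fm, abs_def])
  have a: "(\<Sum>\<^sup>+m. nsq (L2_inner f (?\<sigma> (Coarse m)))) = E\<Phi> (c$1) (ft f)"
  proof -
    have e: "diag2 (c$1) (c$1) *v lattice m = c$1 *\<^sub>R lattice m" for m by (simp add: vec_eq_iff forall_2)
    have "L2_inner f (?\<sigma> (Coarse m)) = lat_coef (mat 1) (c$1) (c$1) 1 (tensor \<Phi>) (ft f) m" for m
      using L2_inner_lat_coef[OF f \<phi>, of "mat 1" "c$1" "c$1" 1 m] c by (simp add: e matrix_vector_mul_lid)
    then show ?thesis by (simp only: E\<Phi>_def lat_energy_def)
  qed
  show ?thesis
    unfolding frame_energy_def nn_integral_shearlet_indices a v' h[OF f] energy_def E\<Psi>_def ..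
qed

lemma shearlet_system_L2:
  assumes "\<phi> \<in> L2" "\<psi> \<in> L2" "i \<in> shearlet_indices"
  shows "shearlet_system c \<phi> \<psi> (\<lambda>x. \<psi> (swap2 x)) i \<in> L2"
proof (cases i)
  case (Coarse m)
  then show ?thesis using affine_L2[OF assms(1), of "mat 1" "- (c$1 *\<^sub>R lattice m)"] by (simp add: matrix_vector_mul_lid)
next
  case (Horizontal j k m)
  then show ?thesis
    using L2_cmult[OF affine_L2[OF assms(2), of "shearlet_matrix j k" "- (sampling c *v lattice m)"]]
    using det_shearlet_matrix[of j k] by (simp add: shearlet_matrix_def)
next
  case (Vertical j k m)
  have "det (scaling_tilde (2 ^ j)) \<noteq> 0" by (simp add: scaling_tilde_def)
  then have "det (transpose (shear (- real_of_int k)) ** scaling_tilde (2 ^ j)) \<noteq> 0"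
    by (simp add: det_mul det_transpose det_shear)
  then show ?thesis
    using L2_cmult[OF affine_L2[OF swap2_L2[OF assms(2)], of _ "- (sampling_tilde c *v lattice m)"]] Vertical by simp
qed

end

theorem theorem4p9:
  fixes K L :: nat
    and m0 m1 :: "real \<Rightarrow> complex"
    and \<phi>1 \<phi>1_hat :: "real \<Rightarrow> complex"
    and \<psi> \<phi> \<psi>t :: "real^2 \<Rightarrow> complex"
  assumes "0 < K" and "0 < L" and "10 \<le> L"
    and "3 * real L / 2 \<le> real K" and "real K \<le> 3 * real L - 2"
    and "real_trig_polynomial m0" and "m0 0 = 1"
    and "\<And>\<xi>. (cmod (m0 \<xi>))\<^sup>2 = (cos (pi * \<xi>)) ^ (2 * K) *
           (\<Sum>n=0..L - 1. real ((K - 1 + n) choose n) * (sin (pi * \<xi>)) ^ (2 * n))"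
    and "trig_polynomial m1"
    and "\<And>\<xi>. (cmod (m1 \<xi>))\<^sup>2 = (cmod (m0 (\<xi> + 1 / 2)))\<^sup>2"
    and "\<And>\<xi>. \<phi>1_hat \<xi> = (\<Prod>j. m0 (\<xi> / 2 ^ j))"
    and "has_L2_fourier_transform \<phi>1 \<phi>1_hat"
    and "has_L2_fourier_transform \<psi> (\<lambda>\<xi>. m1 (4 * \<xi>$1) * \<phi>1_hat (\<xi>$1) * \<phi>1_hat (2 * \<xi>$2))"
    and "\<And>x. \<phi> x = \<phi>1 (x$1) * \<phi>1 (x$2)"
    and "\<And>x. \<psi>t x = \<psi> (vector [x$2, x$1])"
  shows "\<exists>c1_hat>0. \<forall>c::real^2. 0 < c$1 \<and> 0 < c$2 \<and> c$2 \<le> c$1 \<and> c$1 \<le> c1_hat \<longrightarrow>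
           is_L2_frame shearlet_indices (shearlet_system c \<phi> \<psi> \<psi>t)"
proof -
  interpret mask K L m0
  proof
    have "3 * real L \<le> 2 * real K" using assms(4) by simp
    then show "3 * L \<le> 2 * K" by linarith
    show "(cmod (m0 \<xi>))\<^sup>2 = (cos (pi * \<xi>)) ^ (2 * K) * mask_poly K L ((sin (pi * \<xi>))\<^sup>2)" for \<xi>
      unfolding assms(8) mask_poly_def power_mult ..
  qed fact+
  have \<phi>1_hat: "\<phi>1_hat = \<Phi>" using assms(11) by (simp add: \<Phi>_def fun_eq_iff)
  have \<phi>: "\<phi> = tensor \<phi>1" using assms(14) by (simp add: tensor_def fun_eq_iff)
  have \<psi>t: "\<psi>t = (\<lambda>x. \<psi> (swap2 x))" using assms(15) by (simp add: swap2_def vec2_def fun_eq_iff)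
  have p\<phi>: "fourier_pair \<phi> (tensor \<Phi>)"
    unfolding \<phi> using assms(12) unfolding \<phi>1_hat by (rule fourier_pair_tensor)
  have "has_L2_fourier_transform \<psi> (\<Psi> m1)"
    using assms(13) by (simp add: \<phi>1_hat \<Psi>_def[abs_def])
  then have p\<psi>: "fourier_pair \<psi> (\<Psi> m1)" by (rule fourier_pair_has_L2)
  interpret generators K L m0 m1
    by unfold_locales (use p\<phi> p\<psi> assms(10) in \<open>auto simp: fourier_pair_def\<close>)
  obtain c0 where c0: "0 < c0" "c0 \<le> 1" and low: "\<And>c1 c2. 0 < c1 \<Longrightarrow> 0 < c2 \<Longrightarrow> c2 \<le> c1 \<Longrightarrow> c1 \<le> c0 \<Longrightarrow>
    \<exists>A>0. \<forall>g\<in>L2. ennreal A * sq_norm g \<le> energy c1 c2 g"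
    using energy_lower by blast
  show ?thesis
  \<comment> \<open>Only the lower bound dictates the threshold; the upper bound holds for all
    parameters up to 1, and its constant may depend on \<open>c\<close>.\<close>
  proof (intro exI[of _ c0] conjI c0(1) allI impI)
    fix c :: "real^2" assume "0 < c$1 \<and> 0 < c$2 \<and> c$2 \<le> c$1 \<and> c$1 \<le> c0"
    then have c: "0 < c$1" "0 < c$2" "c$2 \<le> c$1" "c$1 \<le> c0" by auto
    obtain A where A: "0 < A" "\<And>g. g \<in> L2 \<Longrightarrow> ennreal A * sq_norm g \<le> energy (c$1) (c$2) g"
      using low[OF c] by blast
    obtain B where B: "0 < B" "\<And>g. g \<in> L2 \<Longrightarrow> energy (c$1) (c$2) g \<le> ennreal B * sq_norm g"
      using energy_upper[of "c$1" "c$2"] c c0 by auto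
    have n: "sq_norm (ft f) = sq_norm f" if "compact_L2 f" for f
      using plancherel_compact[OF that] by (simp add: sq_norm_def)
    show "is_L2_frame shearlet_indices (shearlet_system c \<phi> \<psi> \<psi>t)"
      unfolding \<psi>t
    proof (rule is_L2_frame_compact[OF countable_shearlet_indices _ A(1) B(1)])
      fix i assume "i \<in> shearlet_indices"
      then show "shearlet_system c \<phi> \<psi> (\<lambda>x. \<psi> (swap2 x)) i \<in> L2"
        using p\<phi> p\<psi> by (intro shearlet_system_L2) (auto simp: fourier_pair_def)
    next
      fix f assume f: "compact_L2 f"
      show "ennreal A * sq_norm f \<le> frame_energy shearlet_indices (shearlet_system c \<phi> \<psi> (\<lambda>x. \<psi> (swap2 x))) f"
        using A(2)[OF ft_L2[OF f]] by (simp add: frame_energy_shearlet_system[OF f c(1,2) p\<phi> p\<psi>] n[OF f])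
      show "frame_energy shearlet_indices (shearlet_system c \<phi> \<psi> (\<lambda>x. \<psi> (swap2 x))) f \<le> ennreal B * sq_norm f"
        using B(2)[OF ft_L2[OF f]] by (simp add: frame_energy_shearlet_system[OF f c(1,2) p\<phi> p\<psi>] n[OF f])
    qed
  qed
qed

end
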